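(* Let $l_1>l_2\ge1$ and $r>l_2$. Let $b_1=(x_1,x_2)\in\tilde B_{l_1}$ and $b_2=(y_1,y_2)\in\tilde B_{l_2}$, and let $p\in\mathscr P_L$ be a two-soliton state of the $D_4^{(3)}$-automaton with label $z^{\gamma_1}b_1\otimes z^{\gamma_2}b_2\in\mathrm{Aff}(\tilde B_{l_1})\otimes\mathrm{Aff}(\tilde B_{l_2})$ at time $t=0$ (the two solitons being separated by sufficiently many $(1)$'s). Then for all sufficiently large $t$ (with $L$ sufficiently large), $T_r^t(p)$ is a two-soliton state $\ldots[l_2]\ldots[l_1]\ldots$ whose label at time $t$ is $$z^{\gamma_2'}b_2'\otimes z^{\gamma_1'}b_1'\in\mathrm{Aff}(\tilde B_{l_2})\otimes\mathrm{Aff}(\tilde B_{l_1}),$$ where $b_1\otimes b_2\mapsto b_2'\otimes b_1'$ is the $U'_q(A_1^{(1)})$-crystal isomorphism $\tilde B_{l_1}\otimes\tilde B_{l_2}\simeq\tilde B_{l_2}\otimes\tilde B_{l_1}$, and the phase shift is $$\gamma_2'-\gamma_2=\gamma_1-\gamma_1'=2l_2+3H(b_1\otimes b_2),$$ with $H$ the energy function of the combinatorial $R$ for $U'_q(A_1^{(1)})$-crystals. In other words, the two-body scattering map $S_2:z^{\gamma_1}b_1\otimes z^{\gamma_2}b_2\mapsto z^{\gamma'_2}b'_2\otimes z^{\gamma'_1}b'_1$ is described by the combinatorial $R$ for $U'_q(A_1^{(1)})$-crystals.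
   Context: **Crystals.** A crystal $B$ is a set with maps $\tilde e_i,\tilde f_i:B\sqcup\{0\}\to B\sqcup\{0\}$ with $\tilde e_i0=\tilde f_i0=0$, each nilpotent on every $b$, and $\tilde f_ib=b'\iff b=\tilde e_ib'$ for $b,b'\in B$. Put $\varepsilon_i(b)=\max\{n\ge0:\tilde e_i^nb\ne0\}$, $\varphi_i(b)=\max\{n\ge0:\tilde f_i^nb\neq0\}$. On $B\otimes B'=\{b\otimes b'\}$ (with $b\otimes0=0\otimes b'=0$): $\tilde e_i(b\otimes b')=\tilde e_ib\otimes b'$ if $\varphi_i(b)\ge\varepsilon_i(b')$, else $b\otimes\tilde e_ib'$; $\tilde f_i(b\otimes b')=\tilde f_ib\otimes b'$ if $\varphi_i(b)>\varepsilon_i(b')$, else $b\otimes\tilde f_ib'$. A crystal isomorphism is a bijection commuting with all $\tilde e_i,\tilde f_i$ (fixing $0$). $\mathrm{Aff}(B)=\{z^db: d\in\mathbb{Z},b\in B\}$. **The $U'_q(D_4^{(3)})$-crystal $B_l$** ($i=0,1,2$). $B_l$ is the set of $b=(x_1,x_2,x_3,\bar x_3,\bar x_2,\bar x_1)\in\mathbb{Z}_{\ge0}^6$ with $x_3\equiv\bar x_3 \pmod 2$ and $x_1+x_2+\frac{x_3+\bar x_3}2+\bar x_2+\bar x_1\le l$. Write $(x)_+=\max(x,0)$; in the rules below unlisted coordinates do not change, and the result is $0$ if it is not in $B_l$. - $\tilde e_1$: ($\bar x_2{+}1,\bar x_1{-}1$) if $\bar x_2-\bar x_3\ge(x_2-x_3)_+$;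 ($x_3{+}1,\bar x_3{-}1$) if $\bar x_2-\bar x_3<0\le x_3-x_2$; ($x_1{+}1,x_2{-}1$) if $(\bar x_2-\bar x_3)_+<x_2-x_3$. - $\tilde f_1$: ($x_1{-}1,x_2{+}1$) if $(\bar x_2-\bar x_3)_+\le x_2-x_3$; ($x_3{-}1,\bar x_3{+}1$) if $\bar x_2-\bar x_3\le0<x_3-x_2$; ($\bar x_2{-}1,\bar x_1{+}1$) if $\bar x_2-\bar x_3>(x_2-x_3)_+$. - $\tilde e_2$: ($\bar x_3{+}2,\bar x_2{-}1$) if $\bar x_3\ge x_3$; ($x_2{+}1,x_3{-}2$) if $\bar x_3<x_3$. - $\tilde f_2$: ($x_2{-}1,x_3{+}2$) if $\bar x_3\le x_3$; ($\bar x_3{-}2,\bar x_2{+}1$) if $\bar x_3>x_3$. - For $i=0$ let $z_1=\bar x_1-x_1$, $z_2=\bar x_2-\bar x_3$, $z_3=x_3-x_2$, $z_4=(\bar x_3-x_3)/2$ and $(A_1,\dots,A_6)=(0,\ z_1,\ z_1+z_2,\ z_1+z_2+3z_4,\ z_1+z_2+z_3+3z_4,\ 2z_1+z_2+z_3+3z_4)$. $\tilde f_0$ applies move $j$, where $j$ is the smallest index with $A_j=\max_kA_k$; moves: 1: ($x_1{+}1$); 2: ($x_3{+}1,\bar x_3{+}1,\bar x_1{-}1$); 3: ($x_3{+}2,\bar x_2{-}1$); 4: ($x_2{+}1,\bar x_3{-}2$); 5: ($x_1{+}1,x_3{-}1,\bar x_3{-}1$); 6: ($\bar x_1{-}1$).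 $\tilde e_0$ applies the inverse of move $j$, where $j$ is the largest index with $A_j=\max_kA_k$. In $B_1$ write $(1)=(1,0,0,0,0,0)$, $(2)=(0,1,0,0,0,0)$, $(3)=(0,0,2,0,0,0)$. **$D_4^{(3)}$-automaton.** Fix $L$ sufficiently large. $u_l=(l,0,0,0,0,0)\in B_l$, and $\mathscr P_L=\{b_1\otimes\cdots\otimes b_L\in B_1^{\otimes L}: b_j=u_1\text{ for }j\gg1\}$. There is a unique crystal isomorphism $B_l\otimes B_1\simeq B_1\otimes B_l$; applying it repeatedly from left to right moves the carrier $u_l$ through a path, $u_l\otimes b_1\otimes\cdots\otimes b_L\mapsto\tilde b_1\otimes\cdots\otimes\tilde b_L\otimes u_l$, and $T_l(b_1\otimes\cdots\otimes b_L)=\tilde b_1\otimes\cdots\otimes\tilde b_L$. **Solitons and labels.** A soliton $[l]$ is a block $(3)^{\otimes x_2}\otimes(2)^{\otimes x_1}$, $x_1+x_2=l$, sandwiched by sufficiently many $(1)$'s; it is labelled by $(x_1,x_2)\in\tilde B_l=\{(x_1,x_2)\in\mathbb{Z}_{\ge0}^2:x_1+x_2=l\}$. An $m$-soliton state of length $(l_1,\dots,l_m)$ consists of well-separated blocks $[l_1],\dots,[l_m]$ from left to right, all other tensor factors being $(1)$. Under the time evolution $T_r$, the state at time $t$ has label $z^{\gamma_1}b_1\otimes\cdots\otimes z^{\gamma_m}b_m\in\mathrm{Aff}(\tilde B_{l_1})\otimes\cdots\otimes\mathrm{Aff}(\tilde B_{l_m})$, where $b_i$ is the label of the $i$-th block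 and its phase is $\gamma_i=\min(r,l_i)t+(\text{number of tensor factors to the right of the block})$. **$U'_q(A_1^{(1)})$-crystals.** On $\tilde B_l$: $\tilde e_0(x_1,x_2)=(x_1-1,x_2+1)=\tilde f_1(x_1,x_2)$, $\tilde f_0(x_1,x_2)=(x_1+1,x_2-1)=\tilde e_1(x_1,x_2)$ (being $0$ if a coordinate becomes negative). The isomorphism $\tilde B_l\otimes\tilde B_{l'}\to\tilde B_{l'}\otimes\tilde B_l$ is $(x_1,x_2)\otimes(y_1,y_2)\mapsto(y_1',y_2')\otimes(x_1',x_2')$ with, for $Q_1=\min(x_2,y_1)$ and $Q_2=\min(x_1,y_2)$, $x_1'=x_1+Q_1-Q_2$, $x_2'=x_2+Q_2-Q_1$, $y_1'=y_1+Q_2-Q_1$, $y_2'=y_2+Q_1-Q_2$; the energy function is $H((x_1,x_2)\otimes(y_1,y_2))=-\min(x_1,y_2)$. *)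

theory Defs
  imports "HOL-Library.Product_Plus"
begin

section \<open>Crystals\<close>

text \<open>The extra element $0$ is \<^const>\<open>None\<close>. Operators matter only on the underlying set
  and for indices in the index set.\<close>

record 'b crystal =
  elements :: "'b set"
  indices :: "nat set"
  e_op :: "nat \<Rightarrow> 'b \<Rightarrow> 'b option"
  f_op :: "nat \<Rightarrow> 'b \<Rightarrow> 'b option"

definition iter :: "('b \<Rightarrow> 'b option) \<Rightarrow> nat \<Rightarrow> 'b \<Rightarrow> 'b option" where
  "iter g n b = ((\<lambda>x. Option.bind x g) ^^ n) (Some b)"

definition eps :: "'b crystal \<Rightarrow> nat \<Rightarrow> 'b \<Rightarrow> nat" where
  "eps B i b = Max {n. iter (e_op B i) n b \<noteq> None}"

definition phi :: "'b crystal \<Rightarrow> nat \<Rightarrow> 'b \<Rightarrow> nat" where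
  "phi B i b = Max {n. iter (f_op B i) n b \<noteq> None}"

definition tensor :: "'a crystal \<Rightarrow> 'b crystal \<Rightarrow> ('a \<times> 'b) crystal" (infixr "\<otimes>" 70) where
  "B \<otimes> B' = \<lparr>
     elements = elements B \<times> elements B',
     indices = indices B \<inter> indices B',
     e_op = (\<lambda>i (b, b'). if phi B i b \<ge> eps B' i b'
               then map_option (\<lambda>c. (c, b')) (e_op B i b)
               else map_option (\<lambda>c'. (b, c')) (e_op B' i b')),
     f_op = (\<lambda>i (b, b'). if phi B i b > eps B' i b'
               then map_option (\<lambda>c. (c, b')) (f_op B i b)
               else map_option (\<lambda>c'. (b, c')) (f_op B' i b'))\<rparr>"

definition crystal_iso :: "'a crystal \<Rightarrow> 'b crystal \<Rightarrow> ('a \<Rightarrow> 'b) \<Rightarrow> bool" where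
  "crystal_iso B B' R \<longleftrightarrow>
     indices B = indices B' \<and> bij_betw R (elements B) (elements B') \<and>
     (\<forall>i\<in>indices B. \<forall>b\<in>elements B.
        e_op B' i (R b) = map_option R (e_op B i b) \<and>
        f_op B' i (R b) = map_option R (f_op B i b))"


section \<open>The $U'_q(D_4^{(3)})$-crystal $B_l$\<close>

text \<open>$(x_1,x_2,x_3,\bar x_3,\bar x_2,\bar x_1)$; the barred coordinates are written
  \<open>y3, y2, y1\<close> below.\<close>

type_synonym elt = "int \<times> int \<times> int \<times> int \<times> int \<times> int"

definition B_set :: "nat \<Rightarrow> elt set" where
  "B_set l = {(x1, x2, x3, y3, y2, y1).
     0 \<le> x1 \<and> 0 \<le> x2 \<and> 0 \<le> x3 \<and> 0 \<le> y3 \<and> 0 \<le> y2 \<and> 0 \<le> y1 \<and>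
     x3 mod 2 = y3 mod 2 \<and> x1 + x2 + (x3 + y3) div 2 + y2 + y1 \<le> int l}"

definition into_B :: "nat \<Rightarrow> elt \<Rightarrow> elt option" where
  "into_B l b = (if b \<in> B_set l then Some b else None)"

abbreviation pos :: "int \<Rightarrow> int" where "pos x \<equiv> max x 0"

fun e1_raw :: "elt \<Rightarrow> elt" where
  "e1_raw (x1, x2, x3, y3, y2, y1) =
     (if y2 - y3 \<ge> pos (x2 - x3) then (x1, x2, x3, y3, y2 + 1, y1 - 1)
      else if y2 - y3 < 0 \<and> 0 \<le> x3 - x2 then (x1, x2, x3 + 1, y3 - 1, y2, y1)
      else (x1 + 1, x2 - 1, x3, y3, y2, y1))"

fun f1_raw :: "elt \<Rightarrow> elt" where
  "f1_raw (x1, x2, x3, y3, y2, y1) =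
     (if pos (y2 - y3) \<le> x2 - x3 then (x1 - 1, x2 + 1, x3, y3, y2, y1)
      else if y2 - y3 \<le> 0 \<and> 0 < x3 - x2 then (x1, x2, x3 - 1, y3 + 1, y2, y1)
      else (x1, x2, x3, y3, y2 - 1, y1 + 1))"

fun e2_raw :: "elt \<Rightarrow> elt" where
  "e2_raw (x1, x2, x3, y3, y2, y1) =
     (if y3 \<ge> x3 then (x1, x2, x3, y3 + 2, y2 - 1, y1)
      else (x1, x2 + 1, x3 - 2, y3, y2, y1))"

fun f2_raw :: "elt \<Rightarrow> elt" where
  "f2_raw (x1, x2, x3, y3, y2, y1) =
     (if y3 \<le> x3 then (x1, x2 - 1, x3 + 2, y3, y2, y1)
      else (x1, x2, x3, y3 - 2, y2 + 1, y1))"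

text \<open>For $i = 0$ the indices $j = 1, \dots, 6$ are shifted to list positions $0, \dots, 5$.\<close>

fun A_list :: "elt \<Rightarrow> int list" where
  "A_list (x1, x2, x3, y3, y2, y1) =
     (let z1 = y1 - x1; z2 = y2 - y3; z3 = x3 - x2; z4 = (y3 - x3) div 2
      in [0, z1, z1 + z2, z1 + z2 + 3 * z4, z1 + z2 + z3 + 3 * z4,
          2 * z1 + z2 + z3 + 3 * z4])"

definition moves :: "elt list" where
  "moves = [( 1,  0,  0,  0,  0,  0),
            ( 0,  0,  1,  1,  0, -1),
            ( 0,  0,  2,  0, -1,  0),
            ( 0,  1,  0, -2,  0,  0),
            ( 1,  0, -1, -1,  0,  0),
            ( 0,  0,  0,  0,  0, -1)]"

definition is_max_index :: "elt \<Rightarrow> nat \<Rightarrow> bool" where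
  "is_max_index b j \<longleftrightarrow> j < 6 \<and> A_list b ! j = Max (set (A_list b))"

definition f0_raw :: "elt \<Rightarrow> elt" where
  "f0_raw b = b + moves ! (LEAST j. is_max_index b j)"

definition e0_raw :: "elt \<Rightarrow> elt" where
  "e0_raw b = b - moves ! (GREATEST j. is_max_index b j)"

definition D43 :: "nat \<Rightarrow> elt crystal" where
  "D43 l = \<lparr>
     elements = B_set l,
     indices = {0, 1, 2},
     e_op = (\<lambda>i b. into_B l (if i = 0 then e0_raw b else if i = 1 then e1_raw b else e2_raw b)),
     f_op = (\<lambda>i b. into_B l (if i = 0 then f0_raw b else if i = 1 then f1_raw b else f2_raw b))\<rparr>"

definition u :: "nat \<Rightarrow> elt" where
  "u l = (int l, 0, 0, 0, 0, 0)"

abbreviation letter1 :: elt where "letter1 \<equiv> (1, 0, 0, 0, 0, 0)"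
abbreviation letter2 :: elt where "letter2 \<equiv> (0, 1, 0, 0, 0, 0)"
abbreviation letter3 :: elt where "letter3 \<equiv> (0, 0, 2, 0, 0, 0)"


section \<open>The $D_4^{(3)}$-automaton\<close>

text \<open>\<open>R\<close> stands for the isomorphism $B_l \otimes B_1 \simeq B_1 \otimes B_l$. The path
  $b_1 \otimes \cdots \otimes b_L$ is the list $[b_1, \dots, b_L]$; \<open>paths L m\<close> consists of the
  paths in $\mathscr P_L$ all of whose factors after the first \<open>m\<close> are $u_1$, so \<open>m\<close> is the
  bound behind ``$b_j = u_1$ for $j \gg 1$''.\<close>

definition paths :: "nat \<Rightarrow> nat \<Rightarrow> elt list set" where
  "paths L m = {p. length p = L \<and> set p \<subseteq> elements (D43 1) \<and> (\<forall>j. m \<le> j \<and> j < L \<longrightarrow> p ! j = u 1)}"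

fun carry :: "(elt \<times> elt \<Rightarrow> elt \<times> elt) \<Rightarrow> elt \<Rightarrow> elt list \<Rightarrow> elt list \<times> elt" where
  "carry R c [] = ([], c)"
| "carry R c (b # p) =
     (let (b', c') = R (c, b); (p', c'') = carry R c' p in (b' # p', c''))"

text \<open>\<open>evolves R l p p'\<close> says $T_l(p) = p'$, including that the carrier leaves the path as $u_l$,
  which is what $L$ sufficiently large means for $p$.\<close>

definition evolves :: "(elt \<times> elt \<Rightarrow> elt \<times> elt) \<Rightarrow> nat \<Rightarrow> elt list \<Rightarrow> elt list \<Rightarrow> bool" where
  "evolves R l p p' \<longleftrightarrow> carry R (u l) p = (p', u l)"


section \<open>The $U'_q(A_1^{(1)})$-crystals\<close>

definition A1 :: "nat \<Rightarrow> (nat \<times> nat) crystal" where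
  "A1 l = (let
       up = (\<lambda>(x1, x2). if x2 = 0 then None else Some (x1 + 1, x2 - 1));
       down = (\<lambda>(x1, x2). if x1 = 0 then None else Some (x1 - 1, x2 + 1))
     in \<lparr>elements = {(x1, x2). x1 + x2 = l},
         indices = {0, 1},
         e_op = (\<lambda>i. if i = 0 then down else up),
         f_op = (\<lambda>i. if i = 0 then up else down)\<rparr>)"

text \<open>\<open>A1_R (b\<^sub>1, b\<^sub>2) = (b\<^sub>2', b\<^sub>1')\<close>. No subtraction truncates, since
  $Q_2 \le x_1, y_2$ and $Q_1 \le x_2, y_1$.\<close>

fun A1_R :: "(nat \<times> nat) \<times> (nat \<times> nat) \<Rightarrow> (nat \<times> nat) \<times> (nat \<times> nat)" where
  "A1_R ((x1, x2), (y1, y2)) =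
     (let Q1 = min x2 y1; Q2 = min x1 y2
      in ((y1 + Q2 - Q1, y2 + Q1 - Q2), (x1 + Q1 - Q2, x2 + Q2 - Q1)))"

fun A1_H :: "(nat \<times> nat) \<times> (nat \<times> nat) \<Rightarrow> int" where
  "A1_H ((x1, x2), (y1, y2)) = - int (min x1 y2)"

lemma A1_simps:
  "elements (A1 l) = {(x1, x2). x1 + x2 = l}" "indices (A1 l) = {0, 1}"
  "e_op (A1 l) 0 (x1, x2) = (if x1 = 0 then None else Some (x1 - 1, x2 + 1))"
  "f_op (A1 l) 0 (x1, x2) = (if x2 = 0 then None else Some (x1 + 1, x2 - 1))"
  "e_op (A1 l) (Suc 0) (x1, x2) = (if x2 = 0 then None else Some (x1 + 1, x2 - 1))"
  "f_op (A1 l) (Suc 0) (x1, x2) = (if x1 = 0 then None else Some (x1 - 1, x2 + 1))"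
  by (auto simp: A1_def Let_def)

lemma Max_iter_step:
  assumes "\<And>b. g b = None \<longleftrightarrow> k b = 0" "\<And>b c. g b = Some c \<Longrightarrow> k b = Suc (k c)"
  shows "Max {n. iter g n b \<noteq> None} = k b"
proof -
  have "iter g n b \<noteq> None \<longleftrightarrow> n \<le> k b" for n
  proof (induction n arbitrary: b)
    case (Suc n)
    show ?case
    proof (cases "g b")
      case None
      have "((\<lambda>x. Option.bind x g) ^^ n) None = None" by (induction n) auto
      with None show ?thesis using assms(1)[of b]
        by (simp add: iter_def funpow_Suc_right del: funpow.simps)
    next
      case (Some c)
      then have "iter g (Suc n) b = iter g n c"
        by (simp add: iter_def funpow_Suc_right del: funpow.simps)
      then show ?thesis using Suc.IH[of c] assms(2)[OF Some] by simp
    qed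
  qed (simp add: iter_def)
  then have "{n. iter g n b \<noteq> None} = {..k b}" by auto
  then show ?thesis by (auto intro!: Max_eqI)
qed

lemma A1_eps_phi:
  "eps (A1 l) 0 (x1, x2) = x1" "phi (A1 l) 0 (x1, x2) = x2"
  "eps (A1 l) (Suc 0) (x1, x2) = x2" "phi (A1 l) (Suc 0) (x1, x2) = x1"
proof -
  show "eps (A1 l) 0 (x1, x2) = x1" unfolding eps_def
    by (rule trans[OF Max_iter_step[where k = fst]]) (auto simp: A1_simps split: if_splits)
  show "phi (A1 l) 0 (x1, x2) = x2" unfolding phi_def
    by (rule trans[OF Max_iter_step[where k = snd]]) (auto simp: A1_simps split: if_splits)
  show "eps (A1 l) (Suc 0) (x1, x2) = x2" unfolding eps_def
    by (rule trans[OF Max_iter_step[where k = snd]]) (auto simp: A1_simps split: if_splits)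
  show "phi (A1 l) (Suc 0) (x1, x2) = x1" unfolding phi_def
    by (rule trans[OF Max_iter_step[where k = fst]]) (auto simp: A1_simps split: if_splits)
qed

lemma A1_tensor:
  "elements (A1 l \<otimes> A1 l') = {((x1, x2), (y1, y2)). x1 + x2 = l \<and> y1 + y2 = l'}"
  "indices (A1 l \<otimes> A1 l') = {0, Suc 0}"
  "e_op (A1 l \<otimes> A1 l') 0 ((x1, x2), (y1, y2)) =
     (if y1 \<le> x2 then if x1 = 0 then None else Some ((x1 - 1, x2 + 1), (y1, y2))
      else Some ((x1, x2), (y1 - 1, y2 + 1)))"
  "f_op (A1 l \<otimes> A1 l') 0 ((x1, x2), (y1, y2)) =
     (if y1 < x2 then Some ((x1 + 1, x2 - 1), (y1, y2))
      else if y2 = 0 then None else Some ((x1, x2), (y1 + 1, y2 - 1)))"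
  "e_op (A1 l \<otimes> A1 l') (Suc 0) ((x1, x2), (y1, y2)) =
     (if y2 \<le> x1 then if x2 = 0 then None else Some ((x1 + 1, x2 - 1), (y1, y2))
      else Some ((x1, x2), (y1 + 1, y2 - 1)))"
  "f_op (A1 l \<otimes> A1 l') (Suc 0) ((x1, x2), (y1, y2)) =
     (if y2 < x1 then Some ((x1 - 1, x2 + 1), (y1, y2))
      else if y1 = 0 then None else Some ((x1, x2), (y1 - 1, y2 + 1)))"
  by (simp_all add: tensor_def A1_simps A1_eps_phi) auto

lemma A1_R_cases:
  obtains x1 x2 p q where "b = ((x1, x2), (x2 + p, x1 + q))" "A1_R b = ((x1 + p, x2 + q), (x2, x1))"
  | x2 y2 p q where "b = ((y2 + q, x2), (x2 + p, y2))" "A1_R b = ((y2 + p, x2), (x2 + q, y2))"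
  | x1 y1 p q where "b = ((x1, y1 + p), (y1, x1 + q))" "A1_R b = ((x1, y1 + q), (y1, x1 + p))"
  | y1 y2 p q where "b = ((y2 + q, y1 + p), (y1, y2))" "A1_R b = ((y2, y1), (y1 + q, y2 + p))"
proof -
  obtain x1 x2 y1 y2 where b: "b = ((x1, x2), (y1, y2))" by (metis surj_pair)
  consider p q where "y1 = x2 + p" "y2 = x1 + q" | p q where "y1 = x2 + p" "x1 = y2 + q"
    | p q where "x2 = y1 + p" "y2 = x1 + q" | p q where "x2 = y1 + p" "x1 = y2 + q"
    by (metis le_Suc_ex linear)
  then show thesis
  proof cases
    case 1 then show thesis using that(1)[of x1 x2 p q] b by (simp add: Let_def min_def)
  next
    case 2 then show thesis using that(2)[of y2 q x2 p] b by (simp add: Let_def min_def)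
  next
    case 3 then show thesis using that(3)[of x1 y1 p q] b by (simp add: Let_def min_def)
  next
    case 4 then show thesis using that(4)[of y2 q y1 p] b by (simp add: Let_def min_def)
  qed
qed

lemma A1_R_inverse:
  assumes "b \<in> elements (A1 l \<otimes> A1 l')"
  shows "A1_R b \<in> elements (A1 l' \<otimes> A1 l)" "A1_R (A1_R b) = b"
  using assms by (cases b rule: A1_R_cases; force simp: A1_tensor Let_def min_def)+

lemma A1_R_commute:
  "e_op (A1 l' \<otimes> A1 l) 0 (A1_R b) = map_option A1_R (e_op (A1 l \<otimes> A1 l') 0 b)"
  "f_op (A1 l' \<otimes> A1 l) 0 (A1_R b) = map_option A1_R (f_op (A1 l \<otimes> A1 l') 0 b)"
  "e_op (A1 l' \<otimes> A1 l) (Suc 0) (A1_R b) = map_option A1_R (e_op (A1 l \<otimes> A1 l') (Suc 0) b)"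
  "f_op (A1 l' \<otimes> A1 l) (Suc 0) (A1_R b) = map_option A1_R (f_op (A1 l \<otimes> A1 l') (Suc 0) b)"
  by (cases b rule: A1_R_cases; auto simp: A1_tensor Let_def min_def)+

text \<open>The map \<^const>\<open>A1_R\<close> is the crystal isomorphism, and the only one.\<close>

lemma crystal_iso_A1_R: "crystal_iso (A1 l \<otimes> A1 l') (A1 l' \<otimes> A1 l) A1_R"
proof -
  have "bij_betw A1_R (elements (A1 l \<otimes> A1 l')) (elements (A1 l' \<otimes> A1 l))"
    by (rule bij_betw_byWitness[where f' = A1_R]) (blast intro: A1_R_inverse)+
  then show ?thesis
    unfolding crystal_iso_def A1_tensor(2) by (simp del: A1_R.simps add: A1_R_commute)
qed

lemma crystal_iso_A1_unique:
  assumes R: "crystal_iso (A1 l \<otimes> A1 l') (A1 l' \<otimes> A1 l) R"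
    and b: "b \<in> elements (A1 l \<otimes> A1 l')"
  shows "R b = A1_R b"
proof -
  let ?C = "A1 l \<otimes> A1 l'" and ?D = "A1 l' \<otimes> A1 l"
  define n :: "(nat \<times> nat) \<times> (nat \<times> nat) \<Rightarrow> nat" where "n = (\<lambda>((x1, x2), (y1, y2)). x2 + y2)"
  have base: "c = ((l', 0), (l, 0))"
    if "c \<in> elements ?D" "e_op ?D (Suc 0) c = None" "f_op ?D 0 c = None" for c
    using that by (auto simp: A1_tensor split: if_splits)
  have down1: "f_op ?C (Suc 0) c = Some b \<and> c \<in> elements ?C \<and> n c < n b"
    if "b \<in> elements ?C" "e_op ?C (Suc 0) b = Some c" for b c
    using that by (auto simp: A1_tensor n_def split: if_splits)
  have down0: "e_op ?C 0 c = Some b \<and> c \<in> elements ?C \<and> n c < n b"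
    if "b \<in> elements ?C" "f_op ?C 0 b = Some c" for b c
    using that by (auto simp: A1_tensor n_def split: if_splits)
  have iso: "S c \<in> elements ?D"
      "e_op ?D i (S c) = map_option S (e_op ?C i c)"
      "f_op ?D i (S c) = map_option S (f_op ?C i c)"
    if "crystal_iso ?C ?D S" "c \<in> elements ?C" "i \<in> {0, Suc 0}" for S c i
    using that unfolding crystal_iso_def A1_tensor(2) bij_betw_def by blast+
  note S = crystal_iso_A1_R[of l l']
  from b show ?thesis
  proof (induction "n b" arbitrary: b rule: less_induct)
    case less
    consider c where "e_op ?C (Suc 0) b = Some c" | c where "f_op ?C 0 b = Some c"
      | "e_op ?C (Suc 0) b = None" "f_op ?C 0 b = None" by fastforce
    then show ?case
    proof cases
      case (1 c)
      note c = down1[OF less.prems 1]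
      then have "R c = A1_R c" using less.hyps by blast
      then show ?thesis
        using c iso(3)[OF R, of c "Suc 0"] iso(3)[OF S, of c "Suc 0"] by simp
    next
      case (2 c)
      note c = down0[OF less.prems 2]
      then have "R c = A1_R c" using less.hyps by blast
      then show ?thesis
        using c iso(2)[OF R, of c 0] iso(2)[OF S, of c 0] by simp
    next
      case 3
      have "T b = ((l', 0), (l, 0))" if T: "crystal_iso ?C ?D T" for T
        using base[of "T b"] 3 iso[OF T less.prems, of 0] iso[OF T less.prems, of "Suc 0"]
        by simp
      then show ?thesis using R S by metis
    qed
  qed
qed


section \<open>Solitons and labels\<close>

definition block :: "nat \<times> nat \<Rightarrow> elt list" where
  "block b = replicate (snd b) letter3 @ replicate (fst b) letter2"

text \<open>\<open>soliton_label s r t [l\<^sub>1, \<dots>, l\<^sub>m] [(\<gamma>\<^sub>1, b\<^sub>1), \<dots>, (\<gamma>\<^sub>m, b\<^sub>m)] p\<close>: the path \<open>p\<close> is an $m$-soliton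
  state of length $(l_1, \dots, l_m)$ and, as the state at time \<open>t\<close> under $T_r$, it has the label
  $z^{\gamma_1} b_1 \otimes \cdots \otimes z^{\gamma_m} b_m$; here $z^\gamma b \in \mathrm{Aff}(\tilde B_l)$ is
  the pair \<open>(\<gamma>, b)\<close>. Separation is quantified by \<open>s\<close>: each run of $(1)$'s, between two blocks and
  at the two ends, has length at least \<open>s\<close>. In the second rule \<open>length p\<close> is the number of
  factors to the right of the new leftmost block.\<close>

inductive soliton_label ::
  "nat \<Rightarrow> nat \<Rightarrow> nat \<Rightarrow> nat list \<Rightarrow> (int \<times> (nat \<times> nat)) list \<Rightarrow> elt list \<Rightarrow> bool"
  for s r t where
  no_soliton: "s \<le> n \<Longrightarrow> soliton_label s r t [] [] (replicate n letter1)"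
| add_soliton: "s \<le> n \<Longrightarrow> b \<in> elements (A1 l) \<Longrightarrow> soliton_label s r t ls zs p \<Longrightarrow>
    soliton_label s r t (l # ls) ((int (min r l * t + length p), b) # zs)
      (replicate n letter1 @ block b @ p)"

end

(*
Crystal operators on words commute with the isomorphism R, so whatever maps
u_r^t (x) p to u_r^t (x) q, and similarly with the carriers on the right, maps the
t-step evolution of p to that of q.  On the vacuum, e_2 and f_2 act trivially, and
so does the conjugate E_0 of e_2 by the Weyl group element s_1 s_0 s_2 s_1, which
belongs to the root -alpha_2 + 3 delta.  On well-separated solitons these operators
act as the A_1^(1)-crystal operators on the tensor product of the labels, where E_0
in addition moves the soliton that it changes by three sites.  As the tensor product of
the labels is connected, scattering is determined by the single case of two
solitons 2...2, which collide as in the box-ball system with phase shift 2 l_2, and the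
energy function accounts for the moves made by E_0.
*)
theory Submission
  imports Defs
begin

text \<open>The isomorphism \<open>R\<close> is evaluated only on carriers and letters made of 1 and
  2, where weights force its value; whatever involves threes is transported. An operator transports
  an evolution only if it leaves the carriers \<open>u r\<close> alone at both ends, so it has to
  fix a vacuum of mixed sizes. Among the given operators those of index 2 do so, but they conserve
  H; to change H the operator E_0 is needed. The conjugation in E_0 uses maximal strings, which can
  be undone only on words without brackets of the opposite kind. It is therefore a partial relation,
  and each computation of it also verifies this condition by bracket counting. The block comes out
  at an offset containing y2 - 2*y1; trading a two for a three raises this by 3, so the gap must
  shrink by 3. E_0 is computed only for a left soliton without threes. There it acts on the right
  soliton, before and after the collision alike, and because l2 < l1 these labels are exactly the
  ones from which f_2 reaches all others.\<close>

lemma iter_0 [simp]: "iter g 0 b = Some b"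
  by (simp add: iter_def)

lemma iter_Suc: "iter g (Suc n) b = (case g b of None \<Rightarrow> None | Some c \<Rightarrow> iter g n c)"
proof (cases "g b")
  case None
  have "((\<lambda>x. Option.bind x g) ^^ n) None = None" by (induction n) auto
  with None show ?thesis by (simp add: iter_def funpow_Suc_right del: funpow.simps)
next
  case (Some c)
  then show ?thesis by (simp add: iter_def funpow_Suc_right del: funpow.simps)
qed

lemma iter_add: "iter g (m + n) b = Option.bind (iter g m b) (iter g n)"
  by (induction m arbitrary: b) (auto simp: iter_Suc split: option.split)

text \<open>Relative to a set \<open>A\<close>, since the closed forms for strings in B_l are valid
  only inside \<open>B_set l\<close>; the strings stay there.\<close>

lemma Max_iter_step_on:
  assumes "\<And>b. b \<in> A \<Longrightarrow> g b = None \<longleftrightarrow> k b = 0"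
    "\<And>b c. b \<in> A \<Longrightarrow> g b = Some c \<Longrightarrow> c \<in> A \<and> k b = Suc (k c)" "b \<in> A"
  shows "Max {n. iter g n b \<noteq> None} = k b"
proof -
  have "iter g n b \<noteq> None \<longleftrightarrow> n \<le> k b" for n
    using assms(3)
  proof (induction n arbitrary: b)
    case (Suc n)
    show ?case
    proof (cases "g b")
      case None
      then show ?thesis using assms(1)[OF Suc.prems] by (simp add: iter_Suc)
    next
      case (Some c)
      then show ?thesis using Suc.IH[of c] assms(2)[OF Suc.prems Some] by (auto simp: iter_Suc)
    qed
  qed simp
  then have "{n. iter g n b \<noteq> None} = {..k b}" by auto
  then show ?thesis by (auto intro!: Max_eqI)
qed

section \<open>The crystal structure of $B_l$\<close>

text \<open>These closed forms are the signature rule for brackets in the order y1, y2, y3, x3, x2,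
  x1 for index 1, and y2, y3/2, x3/2, x2 for index 2, where eps and phi brackets alternate,
  beginning with eps. Each \<open>pos\<close> is one cancellation.\<close>

fun phi1 :: "elt \<Rightarrow> int" where
  "phi1 (x1, x2, x3, y3, y2, y1) = x1 + pos (x3 - x2 + pos (y2 - y3))"
fun eps1 :: "elt \<Rightarrow> int" where
  "eps1 (x1, x2, x3, y3, y2, y1) = y1 + pos (y3 - y2 + pos (x2 - x3))"
fun phi2 :: "elt \<Rightarrow> int" where
  "phi2 (x1, x2, x3, y3, y2, y1) = x2 + pos (y3 - x3) div 2"
fun eps2 :: "elt \<Rightarrow> int" where
  "eps2 (x1, x2, x3, y3, y2, y1) = y2 + pos (x3 - y3) div 2"

lemma into_B_eq: "into_B l b = Some c \<longleftrightarrow> c = b \<and> b \<in> B_set l" "into_B l b = None \<longleftrightarrow> b \<notin> B_set l"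
  by (auto simp: into_B_def)

lemma D43_simps:
  "elements (D43 l) = B_set l" "indices (D43 l) = {0, 1, 2}"
  "f_op (D43 l) 0 b = into_B l (f0_raw b)" "f_op (D43 l) (Suc 0) b = into_B l (f1_raw b)"
  "f_op (D43 l) 2 b = into_B l (f2_raw b)"
  "e_op (D43 l) 0 b = into_B l (e0_raw b)" "e_op (D43 l) (Suc 0) b = into_B l (e1_raw b)"
  "e_op (D43 l) 2 b = into_B l (e2_raw b)"
  by (auto simp: D43_def)

text \<open>The parameter m is z4. It builds in the parity condition and removes \<open>div\<close>
  and \<open>mod\<close>, so that later case distinctions are linear arithmetic.\<close>

lemma B_cases:
  assumes "b \<in> B_set l"
  obtains x1 x2 x3 m y2 y1 where "b = (x1, x2, x3, x3 + 2 * m, y2, y1)"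
    "0 \<le> x1" "0 \<le> x2" "0 \<le> x3" "0 \<le> x3 + 2 * m" "0 \<le> y2" "0 \<le> y1"
    "x1 + x2 + x3 + m + y2 + y1 \<le> int l"
proof -
  obtain x1 x2 x3 y3 y2 y1 where b: "b = (x1, x2, x3, y3, y2, y1)" by (metis surj_pair)
  with assms have *: "0 \<le> x1" "0 \<le> x2" "0 \<le> x3" "0 \<le> y3" "0 \<le> y2" "0 \<le> y1"
    "x3 mod 2 = y3 mod 2" "x1 + x2 + (x3 + y3) div 2 + y2 + y1 \<le> int l"
    by (auto simp: B_set_def)
  from *(7) have "y3 = x3 + 2 * ((y3 - x3) div 2)" by presburger
  moreover have "(x3 + y3) div 2 = x3 + (y3 - x3) div 2" using *(7) by presburger
  ultimately show thesis using that[of x1 x2 x3 "(y3 - x3) div 2" y2 y1] * b by auto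
qed

lemma B_set_iff: "(x1, x2, x3, x3 + 2 * m, y2, y1) \<in> B_set l \<longleftrightarrow>
    0 \<le> x1 \<and> 0 \<le> x2 \<and> 0 \<le> x3 \<and> 0 \<le> x3 + 2 * m \<and> 0 \<le> y2 \<and> 0 \<le> y1 \<and>
    x1 + x2 + x3 + m + y2 + y1 \<le> int l"
proof -
  have "(x3 + (x3 + 2 * m)) div 2 = x3 + m" "x3 mod 2 = (x3 + 2 * m) mod 2" by presburger+
  then show ?thesis by (auto simp: B_set_def)
qed

lemma B_mem:
  assumes "y3 = x3 + 2 * m"
  shows "(x1, x2, x3, y3, y2, y1) \<in> B_set l \<longleftrightarrow>
    0 \<le> x1 \<and> 0 \<le> x2 \<and> 0 \<le> x3 \<and> 0 \<le> y3 \<and> 0 \<le> y2 \<and> 0 \<le> y1 \<and>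
    x1 + x2 + x3 + m + y2 + y1 \<le> int l"
  using assms B_set_iff by auto

lemma D43_f1:
  assumes "b \<in> B_set l"
  shows "into_B l (f1_raw b) = None \<longleftrightarrow> nat (phi1 b) = 0"
    "into_B l (f1_raw b) = Some c \<Longrightarrow> c \<in> B_set l \<and> nat (phi1 b) = Suc (nat (phi1 c)) \<and> e1_raw c = b"
proof -
  obtain x1 x2 x3 m y2 y1 where b: "b = (x1, x2, x3, x3 + 2 * m, y2, y1)"
    "0 \<le> x1" "0 \<le> x2" "0 \<le> x3" "0 \<le> x3 + 2 * m" "0 \<le> y2" "0 \<le> y1"
    "x1 + x2 + x3 + m + y2 + y1 \<le> int l" by (rule B_cases[OF assms])
  \<comment> \<open>The move shifts x3 and y3 in opposite directions, so the half difference m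
    becomes m + 1 and membership has to be restated with the new value.\<close>
  have m: "(x1', x2', x3 - 1, x3 + 2 * m + 1, y2', y1') \<in> B_set l \<longleftrightarrow>
    0 \<le> x1' \<and> 0 \<le> x2' \<and> 0 \<le> x3 - 1 \<and> 0 \<le> x3 + 2 * m + 1 \<and> 0 \<le> y2' \<and> 0 \<le> y1' \<and>
    x1' + x2' + (x3 - 1) + (m + 1) + y2' + y1' \<le> int l" for x1' x2' y2' y1'
    by (subst B_mem[where m = "m + 1"]) auto
  note m' = m
  show "into_B l (f1_raw b) = None \<longleftrightarrow> nat (phi1 b) = 0"
    using b(2-) unfolding b(1) by (auto simp: into_B_eq B_set_iff m m')
  show "into_B l (f1_raw b) = Some c \<Longrightarrow> c \<in> B_set l \<and> nat (phi1 b) = Suc (nat (phi1 c)) \<and> e1_raw c = b"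
    using b(2-) unfolding b(1) by (auto simp: into_B_eq B_set_iff m m' split: if_splits)
qed

lemma D43_e1:
  assumes "b \<in> B_set l"
  shows "into_B l (e1_raw b) = None \<longleftrightarrow> nat (eps1 b) = 0"
    "into_B l (e1_raw b) = Some c \<Longrightarrow> c \<in> B_set l \<and> nat (eps1 b) = Suc (nat (eps1 c)) \<and> f1_raw c = b"
proof -
  obtain x1 x2 x3 m y2 y1 where b: "b = (x1, x2, x3, x3 + 2 * m, y2, y1)"
    "0 \<le> x1" "0 \<le> x2" "0 \<le> x3" "0 \<le> x3 + 2 * m" "0 \<le> y2" "0 \<le> y1"
    "x1 + x2 + x3 + m + y2 + y1 \<le> int l" by (rule B_cases[OF assms])
  have m: "(x1', x2', x3 + 1, x3 + 2 * m - 1, y2', y1') \<in> B_set l \<longleftrightarrow>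
    0 \<le> x1' \<and> 0 \<le> x2' \<and> 0 \<le> x3 + 1 \<and> 0 \<le> x3 + 2 * m - 1 \<and> 0 \<le> y2' \<and> 0 \<le> y1' \<and>
    x1' + x2' + (x3 + 1) + (m - 1) + y2' + y1' \<le> int l" for x1' x2' y2' y1'
    by (subst B_mem[where m = "m - 1"]) auto
  note m' = m
  show "into_B l (e1_raw b) = None \<longleftrightarrow> nat (eps1 b) = 0"
    using b(2-) unfolding b(1) by (auto simp: into_B_eq B_set_iff m m')
  show "into_B l (e1_raw b) = Some c \<Longrightarrow> c \<in> B_set l \<and> nat (eps1 b) = Suc (nat (eps1 c)) \<and> f1_raw c = b"
    using b(2-) unfolding b(1) by (auto simp: into_B_eq B_set_iff m m' split: if_splits)
qed

lemma D43_f2: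
  assumes "b \<in> B_set l"
  shows "into_B l (f2_raw b) = None \<longleftrightarrow> nat (phi2 b) = 0"
    "into_B l (f2_raw b) = Some c \<Longrightarrow> c \<in> B_set l \<and> nat (phi2 b) = Suc (nat (phi2 c)) \<and> e2_raw c = b"
proof -
  obtain x1 x2 x3 m y2 y1 where b: "b = (x1, x2, x3, x3 + 2 * m, y2, y1)"
    "0 \<le> x1" "0 \<le> x2" "0 \<le> x3" "0 \<le> x3 + 2 * m" "0 \<le> y2" "0 \<le> y1"
    "x1 + x2 + x3 + m + y2 + y1 \<le> int l" by (rule B_cases[OF assms])
  have m: "(x1', x2', x3 + 2, x3 + 2 * m, y2', y1') \<in> B_set l \<longleftrightarrow>
    0 \<le> x1' \<and> 0 \<le> x2' \<and> 0 \<le> x3 + 2 \<and> 0 \<le> x3 + 2 * m \<and> 0 \<le> y2' \<and> 0 \<le> y1' \<and>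
    x1' + x2' + (x3 + 2) + (m - 1) + y2' + y1' \<le> int l" for x1' x2' y2' y1'
    by (subst B_mem[where m = "m - 1"]) auto
  have m': "(x1', x2', x3, x3 + 2 * m - 2, y2', y1') \<in> B_set l \<longleftrightarrow>
    0 \<le> x1' \<and> 0 \<le> x2' \<and> 0 \<le> x3 \<and> 0 \<le> x3 + 2 * m - 2 \<and> 0 \<le> y2' \<and> 0 \<le> y1' \<and>
    x1' + x2' + (x3) + (m - 1) + y2' + y1' \<le> int l" for x1' x2' y2' y1'
    by (subst B_mem[where m = "m - 1"]) auto
  show "into_B l (f2_raw b) = None \<longleftrightarrow> nat (phi2 b) = 0"
    using b(2-) unfolding b(1) by (auto simp: into_B_eq B_set_iff m m')
  show "into_B l (f2_raw b) = Some c \<Longrightarrow> c \<in> B_set l \<and> nat (phi2 b) = Suc (nat (phi2 c)) \<and> e2_raw c = b"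
    using b(2-) unfolding b(1) by (auto simp: into_B_eq B_set_iff m m' split: if_splits)
qed

lemma D43_e2:
  assumes "b \<in> B_set l"
  shows "into_B l (e2_raw b) = None \<longleftrightarrow> nat (eps2 b) = 0"
    "into_B l (e2_raw b) = Some c \<Longrightarrow> c \<in> B_set l \<and> nat (eps2 b) = Suc (nat (eps2 c)) \<and> f2_raw c = b"
proof -
  obtain x1 x2 x3 m y2 y1 where b: "b = (x1, x2, x3, x3 + 2 * m, y2, y1)"
    "0 \<le> x1" "0 \<le> x2" "0 \<le> x3" "0 \<le> x3 + 2 * m" "0 \<le> y2" "0 \<le> y1"
    "x1 + x2 + x3 + m + y2 + y1 \<le> int l" by (rule B_cases[OF assms])
  have m: "(x1', x2', x3 - 2, x3 + 2 * m, y2', y1') \<in> B_set l \<longleftrightarrow>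
    0 \<le> x1' \<and> 0 \<le> x2' \<and> 0 \<le> x3 - 2 \<and> 0 \<le> x3 + 2 * m \<and> 0 \<le> y2' \<and> 0 \<le> y1' \<and>
    x1' + x2' + (x3 - 2) + (m + 1) + y2' + y1' \<le> int l" for x1' x2' y2' y1'
    by (subst B_mem[where m = "m + 1"]) auto
  have m': "(x1', x2', x3, x3 + 2 * m + 2, y2', y1') \<in> B_set l \<longleftrightarrow>
    0 \<le> x1' \<and> 0 \<le> x2' \<and> 0 \<le> x3 \<and> 0 \<le> x3 + 2 * m + 2 \<and> 0 \<le> y2' \<and> 0 \<le> y1' \<and>
    x1' + x2' + (x3) + (m + 1) + y2' + y1' \<le> int l" for x1' x2' y2' y1'
    by (subst B_mem[where m = "m + 1"]) auto
  show "into_B l (e2_raw b) = None \<longleftrightarrow> nat (eps2 b) = 0"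
    using b(2-) unfolding b(1) by (auto simp: into_B_eq B_set_iff m m')
  show "into_B l (e2_raw b) = Some c \<Longrightarrow> c \<in> B_set l \<and> nat (eps2 b) = Suc (nat (eps2 c)) \<and> f2_raw c = b"
    using b(2-) unfolding b(1) by (auto simp: into_B_eq B_set_iff m m' split: if_splits)
qed

section \<open>Index 0: strings of the maximum rule\<close>

lemma less6: "(\<forall>j<6. P j) \<longleftrightarrow> P 0 \<and> P (Suc 0) \<and> P 2 \<and> P 3 \<and> P 4 \<and> P (5::nat)"
proof -
  have "j < 6 \<longleftrightarrow> j = 0 \<or> j = Suc 0 \<or> j = 2 \<or> j = 3 \<or> j = 4 \<or> j = 5" for j :: nat
    by linarith
  then show ?thesis by (auto)
qed

definition amax :: "elt \<Rightarrow> int" where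
  "amax b = Max (set (A_list b))"

lemma amax_eqI:
  assumes "j < 6" "\<forall>k<6. A_list b ! k \<le> A_list b ! j"
  shows "amax b = A_list b ! j"
proof -
  have "length (A_list b) = 6" by (cases b) (simp add: Let_def)
  then show ?thesis unfolding amax_def using assms
    by (intro Max_eqI) (auto simp: in_set_conv_nth)
qed

lemma f0_eqI:
  assumes "j < 6" "\<forall>k<6. A_list b ! k \<le> A_list b ! j" "\<forall>k<6. k < j \<longrightarrow> A_list b ! k < A_list b ! j"
  shows "f0_raw b = b + moves ! j"
proof -
  have "(LEAST j. is_max_index b j) = j"
  proof (rule Least_equality)
    fix k assume "is_max_index b k"
    then show "j \<le> k"
      using assms(3) amax_eqI[OF assms(1,2)] by (metis is_max_index_def amax_def not_le less_irrefl)
  qed (use assms(1) amax_eqI[OF assms(1,2)] in \<open>simp add: is_max_index_def amax_def\<close>)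
  then show ?thesis by (simp add: f0_raw_def)
qed

lemma e0_eqI:
  assumes "j < 6" "\<forall>k<6. A_list b ! k \<le> A_list b ! j" "\<forall>k<6. j < k \<longrightarrow> A_list b ! k < A_list b ! j"
  shows "e0_raw b = b - moves ! j"
proof -
  have "(GREATEST j. is_max_index b j) = j"
  proof (rule Greatest_equality)
    fix k assume "is_max_index b k"
    then show "k \<le> j"
      using assms(3) amax_eqI[OF assms(1,2)] by (metis is_max_index_def amax_def not_le less_irrefl)
  qed (use assms(1) amax_eqI[OF assms(1,2)] in \<open>simp add: is_max_index_def amax_def\<close>)
  then show ?thesis by (simp add: e0_raw_def)
qed

lemma length_A_list: "length (A_list b) = 6"
  by (cases b) (simp add: Let_def)

lemma is_max_index_ex: "\<exists>j. is_max_index b j"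
proof -
  have "Max (set (A_list b)) \<in> set (A_list b)" using length_A_list[of b] by (intro Max_in) auto
  then obtain j where "j < length (A_list b)" "A_list b ! j = Max (set (A_list b))"
    unfolding in_set_conv_nth by blast
  then show ?thesis unfolding is_max_index_def length_A_list by blast
qed

lemma is_max_index_ge: "k < 6 \<Longrightarrow> is_max_index b j \<Longrightarrow> A_list b ! k \<le> A_list b ! j"
  using length_A_list[of b] by (simp add: is_max_index_def)

lemma is_max_index_gt:
  assumes "k < 6" "is_max_index b j" "\<not> is_max_index b k"
  shows "A_list b ! k < A_list b ! j"
proof -
  have "A_list b ! k \<noteq> A_list b ! j" using assms by (metis is_max_index_def)
  then show ?thesis using is_max_index_ge[OF assms(1,2)] by linarith
qed

lemma f0_cases:
  obtains j where "j < 6" "\<forall>k<6. A_list b ! k \<le> A_list b ! j"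
    "\<forall>k<6. k < j \<longrightarrow> A_list b ! k < A_list b ! j"
proof -
  let ?j = "LEAST j. is_max_index b j"
  have L: "is_max_index b ?j" using is_max_index_ex by (rule LeastI_ex)
  show thesis
  proof (rule that[of ?j])
    show "?j < 6" using L unfolding is_max_index_def by blast
  qed (use L is_max_index_ge is_max_index_gt not_less_Least[of _ "is_max_index b"] in blast)+
qed

lemma e0_cases:
  obtains j where "j < 6" "\<forall>k<6. A_list b ! k \<le> A_list b ! j"
    "\<forall>k<6. j < k \<longrightarrow> A_list b ! k < A_list b ! j"
proof -
  have bd: "y \<le> 6" if "is_max_index b y" for y using that by (simp add: is_max_index_def)
  let ?j = "GREATEST j. is_max_index b j"
  obtain j0 where "is_max_index b j0" using is_max_index_ex by blast
  then have L: "is_max_index b ?j" using bd by (rule GreatestI_nat)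
  have G: "k \<le> ?j" if "is_max_index b k" for k using that bd by (rule Greatest_le_nat)
  show thesis
  proof (rule that[of ?j])
    show "?j < 6" using L unfolding is_max_index_def by blast
    show "\<forall>k<6. A_list b ! k \<le> A_list b ! ?j" using L is_max_index_ge by blast
    show "\<forall>k<6. ?j < k \<longrightarrow> A_list b ! k < A_list b ! ?j"
      using G L is_max_index_gt by (meson not_le)
  qed
qed

fun size0 :: "elt \<Rightarrow> int" where
  "size0 (x1, x2, x3, y3, y2, y1) = x1 + x2 + (x3 + y3) div 2 + y2 + y1"

definition phi0 :: "nat \<Rightarrow> elt \<Rightarrow> int" where
  "phi0 l b = int l - size0 b + amax b"

text \<open>The last entry of \<open>A_list\<close> is the weight phi_0 - eps_0.\<close>

definition eps0 :: "nat \<Rightarrow> elt \<Rightarrow> int" where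
  "eps0 l b = phi0 l b - A_list b ! 5"

lemma A_list_param:
  "A_list (x1, x2, x3, x3 + 2 * m, y2, y1) =
     [0, y1 - x1, y1 - x1 + (y2 - (x3 + 2 * m)), y1 - x1 + (y2 - (x3 + 2 * m)) + 3 * m,
      y1 - x1 + (y2 - (x3 + 2 * m)) + (x3 - x2) + 3 * m,
      2 * (y1 - x1) + (y2 - (x3 + 2 * m)) + (x3 - x2) + 3 * m]"
  by (simp add: Let_def)

lemma size0_param: "size0 (x1, x2, x3, x3 + 2 * m, y2, y1) = x1 + x2 + x3 + m + y2 + y1"
proof -
  have "(x3 + (x3 + 2 * m)) div 2 = x3 + m" by presburger
  then show ?thesis by simp
qed

text \<open>After the first maximal move j the index j is still maximal and is now the last such
  index, so \<open>e0_raw\<close> picks the same move. The value l - size + A_j drops by exactly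
  one: the first move enlarges the size, the middle four lower A_j by one, and the last lowers A_j
  by two while the size drops by one.\<close>

lemma D43_f0:
  assumes "b \<in> B_set l"
  shows "f0_raw b \<notin> B_set l \<longleftrightarrow> nat (phi0 l b) = 0" (is ?A)
    "f0_raw b \<in> B_set l \<Longrightarrow> nat (phi0 l b) = Suc (nat (phi0 l (f0_raw b))) \<and> e0_raw (f0_raw b) = b"
    (is "?P \<Longrightarrow> ?Q")
proof -
  obtain x1 x2 x3 m y2 y1 where b: "b = (x1, x2, x3, x3 + 2 * m, y2, y1)"
    and bnd: "0 \<le> x1" "0 \<le> x2" "0 \<le> x3" "0 \<le> x3 + 2 * m" "0 \<le> y2" "0 \<le> y1"
    "x1 + x2 + x3 + m + y2 + y1 \<le> int l" by (rule B_cases[OF assms])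
  have "?A \<and> (?P \<longrightarrow> ?Q)"
  proof (rule f0_cases[of b])
    fix j assume j: "j < 6" "\<forall>k<6. A_list b ! k \<le> A_list b ! j"
      "\<forall>k<6. k < j \<longrightarrow> A_list b ! k < A_list b ! j"
    have phi: "phi0 l b = int l - size0 b + A_list b ! j"
      using amax_eqI[OF j(1,2)] by (simp add: phi0_def)
    note fb = f0_eqI[OF j]
    note j' = j(2,3)
    consider "j = 0" | "j = 1" | "j = 2" | "j = 3" | "j = 4" | "j = 5" using j(1) by linarith
    then show ?thesis
    proof cases
      case 1
      have raw: "f0_raw b = (x1 + 1, x2, x3, x3 + 2 * (m), y2, y1)" (is "_ = ?c")
        using fb unfolding 1 b by (simp add: moves_def)
      have c1: "\<forall>k<6. A_list ?c ! k \<le> A_list ?c ! 0"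
        and c2: "\<forall>k<6. 0 < k \<longrightarrow> A_list ?c ! k < A_list ?c ! 0"
        using j' unfolding b less6 1 A_list_param by simp_all
      have inv: "e0_raw ?c = b"
        using e0_eqI[of 0 ?c, OF _ c1 c2] unfolding b by (simp add: moves_def)
      have phi': "phi0 l ?c = int l - size0 ?c + A_list ?c ! 0"
        using amax_eqI[of 0 ?c, OF _ c1] by (simp add: phi0_def)
      show ?thesis
        unfolding raw inv phi phi' unfolding B_set_iff size0_param b A_list_param
        using bnd j' unfolding b 1 less6 A_list_param by (auto simp: B_set_iff)
    next
      case 2
      have raw: "f0_raw b = (x1, x2, x3 + 1, x3 + 1 + 2 * (m), y2, y1 - 1)" (is "_ = ?c")
        using fb unfolding 2 b by (simp add: moves_def)
      have c1: "\<forall>k<6. A_list ?c ! k \<le> A_list ?c ! 1"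
        and c2: "\<forall>k<6. 1 < k \<longrightarrow> A_list ?c ! k < A_list ?c ! 1"
        using j' unfolding b less6 2 A_list_param by simp_all
      have inv: "e0_raw ?c = b"
        using e0_eqI[of 1 ?c, OF _ c1 c2] unfolding b by (simp add: moves_def)
      have phi': "phi0 l ?c = int l - size0 ?c + A_list ?c ! 1"
        using amax_eqI[of 1 ?c, OF _ c1] by (simp add: phi0_def)
      show ?thesis
        unfolding raw inv phi phi' unfolding B_set_iff size0_param b A_list_param
        using bnd j' unfolding b 2 less6 A_list_param by (auto simp: B_set_iff)
    next
      case 3
      have raw: "f0_raw b = (x1, x2, x3 + 2, x3 + 2 + 2 * (m - 1), y2 - 1, y1)" (is "_ = ?c")
        using fb unfolding 3 b by (simp add: moves_def)
      have c1: "\<forall>k<6. A_list ?c ! k \<le> A_list ?c ! 2"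
        and c2: "\<forall>k<6. 2 < k \<longrightarrow> A_list ?c ! k < A_list ?c ! 2"
        using j' unfolding b less6 3 A_list_param by simp_all
      have inv: "e0_raw ?c = b"
        using e0_eqI[of 2 ?c, OF _ c1 c2] unfolding b by (simp add: moves_def)
      have phi': "phi0 l ?c = int l - size0 ?c + A_list ?c ! 2"
        using amax_eqI[of 2 ?c, OF _ c1] by (simp add: phi0_def)
      show ?thesis
        unfolding raw inv phi phi' unfolding B_set_iff size0_param b A_list_param
        using bnd j' unfolding b 3 less6 A_list_param by (auto simp: B_set_iff)
    next
      case 4
      have raw: "f0_raw b = (x1, x2 + 1, x3, x3 + 2 * (m - 1), y2, y1)" (is "_ = ?c")
        using fb unfolding 4 b by (simp add: moves_def)
      have c1: "\<forall>k<6. A_list ?c ! k \<le> A_list ?c ! 3"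
        and c2: "\<forall>k<6. 3 < k \<longrightarrow> A_list ?c ! k < A_list ?c ! 3"
        using j' unfolding b less6 4 A_list_param by simp_all
      have inv: "e0_raw ?c = b"
        using e0_eqI[of 3 ?c, OF _ c1 c2] unfolding b by (simp add: moves_def)
      have phi': "phi0 l ?c = int l - size0 ?c + A_list ?c ! 3"
        using amax_eqI[of 3 ?c, OF _ c1] by (simp add: phi0_def)
      show ?thesis
        unfolding raw inv phi phi' unfolding B_set_iff size0_param b A_list_param
        using bnd j' unfolding b 4 less6 A_list_param by (auto simp: B_set_iff)
    next
      case 5
      have raw: "f0_raw b = (x1 + 1, x2, x3 - 1, x3 - 1 + 2 * (m), y2, y1)" (is "_ = ?c")
        using fb unfolding 5 b by (simp add: moves_def)
      have c1: "\<forall>k<6. A_list ?c ! k \<le> A_list ?c ! 4"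
        and c2: "\<forall>k<6. 4 < k \<longrightarrow> A_list ?c ! k < A_list ?c ! 4"
        using j' unfolding b less6 5 A_list_param by simp_all
      have inv: "e0_raw ?c = b"
        using e0_eqI[of 4 ?c, OF _ c1 c2] unfolding b by (simp add: moves_def)
      have phi': "phi0 l ?c = int l - size0 ?c + A_list ?c ! 4"
        using amax_eqI[of 4 ?c, OF _ c1] by (simp add: phi0_def)
      show ?thesis
        unfolding raw inv phi phi' unfolding B_set_iff size0_param b A_list_param
        using bnd j' unfolding b 5 less6 A_list_param by (auto simp: B_set_iff)
    next
      case 6
      have raw: "f0_raw b = (x1, x2, x3, x3 + 2 * (m), y2, y1 - 1)" (is "_ = ?c")
        using fb unfolding 6 b by (simp add: moves_def)
      have c1: "\<forall>k<6. A_list ?c ! k \<le> A_list ?c ! 5"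
        and c2: "\<forall>k<6. 5 < k \<longrightarrow> A_list ?c ! k < A_list ?c ! 5"
        using j' unfolding b less6 6 A_list_param by simp_all
      have inv: "e0_raw ?c = b"
        using e0_eqI[of 5 ?c, OF _ c1 c2] unfolding b by (simp add: moves_def)
      have phi': "phi0 l ?c = int l - size0 ?c + A_list ?c ! 5"
        using amax_eqI[of 5 ?c, OF _ c1] by (simp add: phi0_def)
      show ?thesis
        unfolding raw inv phi phi' unfolding B_set_iff size0_param b A_list_param
        using bnd j' unfolding b 6 less6 A_list_param by (auto simp: B_set_iff)
    qed
  qed
  then show ?A "?P \<Longrightarrow> ?Q" by blast+
qed

text \<open>Mirror image of \<open>D43_f0\<close>: undoing the last maximal move makes its index the
  first maximal one.\<close>

lemma D43_e0:
  assumes "b \<in> B_set l"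
  shows "e0_raw b \<notin> B_set l \<longleftrightarrow> nat (eps0 l b) = 0" (is ?A)
    "e0_raw b \<in> B_set l \<Longrightarrow> nat (eps0 l b) = Suc (nat (eps0 l (e0_raw b))) \<and> f0_raw (e0_raw b) = b"
    (is "?P \<Longrightarrow> ?Q")
proof -
  obtain x1 x2 x3 m y2 y1 where b: "b = (x1, x2, x3, x3 + 2 * m, y2, y1)"
    and bnd: "0 \<le> x1" "0 \<le> x2" "0 \<le> x3" "0 \<le> x3 + 2 * m" "0 \<le> y2" "0 \<le> y1"
    "x1 + x2 + x3 + m + y2 + y1 \<le> int l" by (rule B_cases[OF assms])
  have "?A \<and> (?P \<longrightarrow> ?Q)"
  proof (rule e0_cases[of b])
    fix j assume j: "j < 6" "\<forall>k<6. A_list b ! k \<le> A_list b ! j"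
      "\<forall>k<6. j < k \<longrightarrow> A_list b ! k < A_list b ! j"
    have phi: "eps0 l b = int l - size0 b + A_list b ! j - A_list b ! 5"
      using amax_eqI[OF j(1,2)] by (simp add: phi0_def eps0_def)
    note fb = e0_eqI[OF j]
    note j' = j(2,3)
    consider "j = 0" | "j = 1" | "j = 2" | "j = 3" | "j = 4" | "j = 5" using j(1) by linarith
    then show ?thesis
    proof cases
      case 1
      have raw: "e0_raw b = (x1 - 1, x2, x3, x3 + 2 * (m), y2, y1)" (is "_ = ?c")
        using fb unfolding 1 b by (simp add: moves_def)
      have c1: "\<forall>k<6. A_list ?c ! k \<le> A_list ?c ! 0"
        and c2: "\<forall>k<6. k < 0 \<longrightarrow> A_list ?c ! k < A_list ?c ! 0"
        using j' unfolding b less6 1 A_list_param by simp_all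
      have inv: "f0_raw ?c = b"
        using f0_eqI[of 0 ?c, OF _ c1 c2] unfolding b by (simp add: moves_def)
      have phi': "eps0 l ?c = int l - size0 ?c + A_list ?c ! 0 - A_list ?c ! 5"
        using amax_eqI[of 0 ?c, OF _ c1] by (simp add: phi0_def eps0_def)
      show ?thesis
        unfolding raw inv phi phi' unfolding B_set_iff size0_param b A_list_param
        using bnd j' unfolding b 1 less6 A_list_param by (auto simp: B_set_iff)
    next
      case 2
      have raw: "e0_raw b = (x1, x2, x3 - 1, x3 - 1 + 2 * (m), y2, y1 + 1)" (is "_ = ?c")
        using fb unfolding 2 b by (simp add: moves_def)
      have c1: "\<forall>k<6. A_list ?c ! k \<le> A_list ?c ! 1"
        and c2: "\<forall>k<6. k < 1 \<longrightarrow> A_list ?c ! k < A_list ?c ! 1"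
        using j' unfolding b less6 2 A_list_param by simp_all
      have inv: "f0_raw ?c = b"
        using f0_eqI[of 1 ?c, OF _ c1 c2] unfolding b by (simp add: moves_def)
      have phi': "eps0 l ?c = int l - size0 ?c + A_list ?c ! 1 - A_list ?c ! 5"
        using amax_eqI[of 1 ?c, OF _ c1] by (simp add: phi0_def eps0_def)
      show ?thesis
        unfolding raw inv phi phi' unfolding B_set_iff size0_param b A_list_param
        using bnd j' unfolding b 2 less6 A_list_param by (auto simp: B_set_iff)
    next
      case 3
      have raw: "e0_raw b = (x1, x2, x3 - 2, x3 - 2 + 2 * (m + 1), y2 + 1, y1)" (is "_ = ?c")
        using fb unfolding 3 b by (simp add: moves_def)
      have c1: "\<forall>k<6. A_list ?c ! k \<le> A_list ?c ! 2"
        and c2: "\<forall>k<6. k < 2 \<longrightarrow> A_list ?c ! k < A_list ?c ! 2"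
        using j' unfolding b less6 3 A_list_param by simp_all
      have inv: "f0_raw ?c = b"
        using f0_eqI[of 2 ?c, OF _ c1 c2] unfolding b by (simp add: moves_def)
      have phi': "eps0 l ?c = int l - size0 ?c + A_list ?c ! 2 - A_list ?c ! 5"
        using amax_eqI[of 2 ?c, OF _ c1] by (simp add: phi0_def eps0_def)
      show ?thesis
        unfolding raw inv phi phi' unfolding B_set_iff size0_param b A_list_param
        using bnd j' unfolding b 3 less6 A_list_param by (auto simp: B_set_iff)
    next
      case 4
      have raw: "e0_raw b = (x1, x2 - 1, x3, x3 + 2 * (m + 1), y2, y1)" (is "_ = ?c")
        using fb unfolding 4 b by (simp add: moves_def)
      have c1: "\<forall>k<6. A_list ?c ! k \<le> A_list ?c ! 3"
        and c2: "\<forall>k<6. k < 3 \<longrightarrow> A_list ?c ! k < A_list ?c ! 3"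
        using j' unfolding b less6 4 A_list_param by simp_all
      have inv: "f0_raw ?c = b"
        using f0_eqI[of 3 ?c, OF _ c1 c2] unfolding b by (simp add: moves_def)
      have phi': "eps0 l ?c = int l - size0 ?c + A_list ?c ! 3 - A_list ?c ! 5"
        using amax_eqI[of 3 ?c, OF _ c1] by (simp add: phi0_def eps0_def)
      show ?thesis
        unfolding raw inv phi phi' unfolding B_set_iff size0_param b A_list_param
        using bnd j' unfolding b 4 less6 A_list_param by (auto simp: B_set_iff)
    next
      case 5
      have raw: "e0_raw b = (x1 - 1, x2, x3 + 1, x3 + 1 + 2 * (m), y2, y1)" (is "_ = ?c")
        using fb unfolding 5 b by (simp add: moves_def)
      have c1: "\<forall>k<6. A_list ?c ! k \<le> A_list ?c ! 4"
        and c2: "\<forall>k<6. k < 4 \<longrightarrow> A_list ?c ! k < A_list ?c ! 4"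
        using j' unfolding b less6 5 A_list_param by simp_all
      have inv: "f0_raw ?c = b"
        using f0_eqI[of 4 ?c, OF _ c1 c2] unfolding b by (simp add: moves_def)
      have phi': "eps0 l ?c = int l - size0 ?c + A_list ?c ! 4 - A_list ?c ! 5"
        using amax_eqI[of 4 ?c, OF _ c1] by (simp add: phi0_def eps0_def)
      show ?thesis
        unfolding raw inv phi phi' unfolding B_set_iff size0_param b A_list_param
        using bnd j' unfolding b 5 less6 A_list_param by (auto simp: B_set_iff)
    next
      case 6
      have raw: "e0_raw b = (x1, x2, x3, x3 + 2 * (m), y2, y1 + 1)" (is "_ = ?c")
        using fb unfolding 6 b by (simp add: moves_def)
      have c1: "\<forall>k<6. A_list ?c ! k \<le> A_list ?c ! 5"
        and c2: "\<forall>k<6. k < 5 \<longrightarrow> A_list ?c ! k < A_list ?c ! 5"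
        using j' unfolding b less6 6 A_list_param by simp_all
      have inv: "f0_raw ?c = b"
        using f0_eqI[of 5 ?c, OF _ c1 c2] unfolding b by (simp add: moves_def)
      have phi': "eps0 l ?c = int l - size0 ?c + A_list ?c ! 5 - A_list ?c ! 5"
        using amax_eqI[of 5 ?c, OF _ c1] by (simp add: phi0_def eps0_def)
      show ?thesis
        unfolding raw inv phi phi' unfolding B_set_iff size0_param b A_list_param
        using bnd j' unfolding b 6 less6 A_list_param by (auto simp: B_set_iff)
    qed
  qed
  then show ?A "?P \<Longrightarrow> ?Q" by blast+
qed

lemma D43_phi_eps:
  assumes b: "b \<in> B_set l"
  shows "phi (D43 l) 0 b = nat (phi0 l b)" "eps (D43 l) 0 b = nat (eps0 l b)"
    "phi (D43 l) (Suc 0) b = nat (phi1 b)" "eps (D43 l) (Suc 0) b = nat (eps1 b)"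
    "phi (D43 l) 2 b = nat (phi2 b)" "eps (D43 l) 2 b = nat (eps2 b)"
proof -
  show "phi (D43 l) 0 b = nat (phi0 l b)" unfolding phi_def
    by (rule Max_iter_step_on[where A = "B_set l"])
      (use b D43_f0 in \<open>auto simp: D43_simps into_B_eq\<close>)
  show "eps (D43 l) 0 b = nat (eps0 l b)" unfolding eps_def
    by (rule Max_iter_step_on[where A = "B_set l"])
      (use b D43_e0 in \<open>auto simp: D43_simps into_B_eq\<close>)
  show "phi (D43 l) (Suc 0) b = nat (phi1 b)" unfolding phi_def
    by (rule Max_iter_step_on[where A = "B_set l"]) (use b D43_f1 in \<open>auto simp: D43_simps\<close>)
  show "eps (D43 l) (Suc 0) b = nat (eps1 b)" unfolding eps_def
    by (rule Max_iter_step_on[where A = "B_set l"]) (use b D43_e1 in \<open>auto simp: D43_simps\<close>)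
  show "phi (D43 l) 2 b = nat (phi2 b)" unfolding phi_def
    by (rule Max_iter_step_on[where A = "B_set l"]) (use b D43_f2 in \<open>auto simp: D43_simps\<close>)
  show "eps (D43 l) 2 b = nat (eps2 b)" unfolding eps_def
    by (rule Max_iter_step_on[where A = "B_set l"]) (use b D43_e2 in \<open>auto simp: D43_simps\<close>)
qed

text \<open>Uniform in i, so that the calculus of words need not distinguish the three families of
  moves.\<close>

lemma D43_f:
  assumes i: "i \<in> {0, 1, 2}" and b: "b \<in> B_set l"
  shows "f_op (D43 l) i b = None \<longleftrightarrow> phi (D43 l) i b = 0"
    and "f_op (D43 l) i b = Some c \<Longrightarrow> c \<in> B_set l"
    and "f_op (D43 l) i b = Some c \<Longrightarrow> e_op (D43 l) i c = Some b"
    and "f_op (D43 l) i b = Some c \<Longrightarrow> phi (D43 l) i b = Suc (phi (D43 l) i c)"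
proof -
  show "f_op (D43 l) i b = None \<longleftrightarrow> phi (D43 l) i b = 0"
    using i D43_f0(1)[OF b] D43_f1(1)[OF b] D43_f2(1)[OF b]
    by (auto simp: D43_simps into_B_eq D43_phi_eps[OF b])
  assume c: "f_op (D43 l) i b = Some c"
  show c': "c \<in> B_set l"
    using i c D43_f1(2)[OF b, of c] D43_f2(2)[OF b, of c] by (auto simp: D43_simps into_B_eq)
  show "e_op (D43 l) i c = Some b"
    using i c b D43_f0(2)[OF b] D43_f1(2)[OF b, of c] D43_f2(2)[OF b, of c]
    by (auto simp: D43_simps into_B_eq)
  from i consider "i = 0" | "i = Suc 0" | "i = 2" by auto
  then show "phi (D43 l) i b = Suc (phi (D43 l) i c)"
  proof cases
    case 1
    with c show ?thesis using D43_f0(2)[OF b]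
      unfolding 1 D43_phi_eps(1)[OF b] D43_phi_eps(1)[OF c'] by (simp add: D43_simps into_B_eq)
  next
    case 2
    with c show ?thesis using D43_f1(2)[OF b, of c]
      by (simp add: D43_phi_eps[OF b] D43_phi_eps[OF c'] D43_simps)
  next
    case 3
    with c show ?thesis using D43_f2(2)[OF b, of c]
      by (simp add: D43_phi_eps[OF b] D43_phi_eps[OF c'] D43_simps)
  qed
qed

lemma D43_e:
  assumes i: "i \<in> {0, 1, 2}" and b: "b \<in> B_set l"
  shows "e_op (D43 l) i b = None \<longleftrightarrow> eps (D43 l) i b = 0"
    and "e_op (D43 l) i b = Some c \<Longrightarrow> c \<in> B_set l"
    and "e_op (D43 l) i b = Some c \<Longrightarrow> f_op (D43 l) i c = Some b"
    and "e_op (D43 l) i b = Some c \<Longrightarrow> eps (D43 l) i b = Suc (eps (D43 l) i c)"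
proof -
  show "e_op (D43 l) i b = None \<longleftrightarrow> eps (D43 l) i b = 0"
    using i D43_e0(1)[OF b] D43_e1(1)[OF b] D43_e2(1)[OF b]
    by (auto simp: D43_simps into_B_eq D43_phi_eps[OF b])
  assume c: "e_op (D43 l) i b = Some c"
  show c': "c \<in> B_set l"
    using i c D43_e1(2)[OF b, of c] D43_e2(2)[OF b, of c] by (auto simp: D43_simps into_B_eq)
  show "f_op (D43 l) i c = Some b"
    using i c b D43_e0(2)[OF b] D43_e1(2)[OF b, of c] D43_e2(2)[OF b, of c]
    by (auto simp: D43_simps into_B_eq)
  from i consider "i = 0" | "i = Suc 0" | "i = 2" by auto
  then show "eps (D43 l) i b = Suc (eps (D43 l) i c)"
  proof cases
    case 1
    with c show ?thesis using D43_e0(2)[OF b]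
      unfolding 1 D43_phi_eps(2)[OF b] D43_phi_eps(2)[OF c'] by (simp add: D43_simps into_B_eq)
  next
    case 2
    with c show ?thesis using D43_e1(2)[OF b, of c]
      by (simp add: D43_phi_eps[OF b] D43_phi_eps[OF c'] D43_simps)
  next
    case 3
    with c show ?thesis using D43_e2(2)[OF b, of c]
      by (simp add: D43_phi_eps[OF b] D43_phi_eps[OF c'] D43_simps)
  qed
qed

section \<open>Words and the signature rule\<close>

text \<open>A letter \<open>(l, b)\<close> stands for \<open>b \<in> B_l\<close>, so that carriers and path entries can be mixed
  in one word.\<close>

type_synonym letter = "nat \<times> elt"

definition ok :: "letter \<Rightarrow> bool" where
  "ok x \<longleftrightarrow> snd x \<in> B_set (fst x)"
definition lf :: "nat \<Rightarrow> letter \<Rightarrow> letter option" where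
  "lf i x = map_option (Pair (fst x)) (f_op (D43 (fst x)) i (snd x))"
definition le :: "nat \<Rightarrow> letter \<Rightarrow> letter option" where
  "le i x = map_option (Pair (fst x)) (e_op (D43 (fst x)) i (snd x))"
definition lphi :: "nat \<Rightarrow> letter \<Rightarrow> nat" where
  "lphi i x = phi (D43 (fst x)) i (snd x)"
definition leps :: "nat \<Rightarrow> letter \<Rightarrow> nat" where
  "leps i x = eps (D43 (fst x)) i (snd x)"

lemma lf_None: "i \<in> {0, 1, 2} \<Longrightarrow> ok x \<Longrightarrow> lf i x = None \<longleftrightarrow> lphi i x = 0"
  using D43_f(1) by (simp add: lf_def lphi_def ok_def)

lemma le_None: "i \<in> {0, 1, 2} \<Longrightarrow> ok x \<Longrightarrow> le i x = None \<longleftrightarrow> leps i x = 0"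
  using D43_e(1) by (simp add: le_def leps_def ok_def)

lemma lf_Some:
  assumes "i \<in> {0, 1, 2}" "ok x" "lf i x = Some y"
  shows "fst y = fst x" "ok y" "le i y = Some x" "lphi i x = Suc (lphi i y)" "leps i y = Suc (leps i x)"
proof -
  obtain c where c: "f_op (D43 (fst x)) i (snd x) = Some c" "y = (fst x, c)"
    using assms(3) by (auto simp: lf_def)
  have b: "snd x \<in> B_set (fst x)" using assms(2) by (simp add: ok_def)
  note f = D43_f(2-4)[OF assms(1) b c(1)]
  show "fst y = fst x" "ok y" "le i y = Some x" "lphi i x = Suc (lphi i y)"
    using c f by (simp_all add: ok_def le_def lphi_def)
  show "leps i y = Suc (leps i x)"
    using c D43_e(4)[OF assms(1) f(1,2)] by (simp add: leps_def)
qed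

lemma le_Some:
  assumes "i \<in> {0, 1, 2}" "ok x" "le i x = Some y"
  shows "fst y = fst x" "ok y" "lf i y = Some x" "leps i x = Suc (leps i y)" "lphi i y = Suc (lphi i x)"
proof -
  obtain c where c: "e_op (D43 (fst x)) i (snd x) = Some c" "y = (fst x, c)"
    using assms(3) by (auto simp: le_def)
  have b: "snd x \<in> B_set (fst x)" using assms(2) by (simp add: ok_def)
  note f = D43_e(2-4)[OF assms(1) b c(1)]
  show "fst y = fst x" "ok y" "lf i y = Some x" "leps i x = Suc (leps i y)"
    using c f by (simp_all add: ok_def lf_def leps_def)
  show "lphi i y = Suc (lphi i x)"
    using c D43_f(4)[OF assms(1) f(1,2)] by (simp add: lphi_def)
qed

text \<open>The tensor product rule with the leftmost factor split off. Subtraction of naturals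
  truncates, which is precisely the cancellation of brackets.\<close>

fun epsw :: "nat \<Rightarrow> letter list \<Rightarrow> nat" where
  "epsw i [] = 0"
| "epsw i (x # w) = leps i x + (epsw i w - lphi i x)"
fun phiw :: "nat \<Rightarrow> letter list \<Rightarrow> nat" where
  "phiw i [] = 0"
| "phiw i (x # w) = phiw i w + (lphi i x - epsw i w)"
fun fw :: "nat \<Rightarrow> letter list \<Rightarrow> letter list option" where
  "fw i [] = None"
| "fw i (x # w) = (if epsw i w < lphi i x then map_option (\<lambda>y. y # w) (lf i x)
     else map_option ((#) x) (fw i w))"
fun ew :: "nat \<Rightarrow> letter list \<Rightarrow> letter list option" where
  "ew i [] = None"
| "ew i (x # w) = (if epsw i w \<le> lphi i x then map_option (\<lambda>y. y # w) (le i x)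
     else map_option ((#) x) (ew i w))"

definition okw :: "letter list \<Rightarrow> bool" where
  "okw w \<longleftrightarrow> (\<forall>x\<in>set w. ok x)"

lemma okw_simps [simp]: "okw []" "okw (x # w) \<longleftrightarrow> ok x \<and> okw w" "okw (v @ w) \<longleftrightarrow> okw v \<and> okw w"
  by (auto simp: okw_def)

lemma epsw_append: "epsw i (v @ w) = epsw i v + (epsw i w - phiw i v)"
  by (induction v) auto

lemma phiw_append: "phiw i (v @ w) = phiw i w + (phiw i v - epsw i w)"
  by (induction v) (auto simp: epsw_append)

lemma map_option_append_Nil [simp]: "map_option ((@) []) z = z"
  by (cases z) auto

lemma fw_append: "fw i (v @ w) = (if epsw i w < phiw i v then map_option (\<lambda>v'. v' @ w) (fw i v)
    else map_option ((@) v) (fw i w))"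
  by (induction v) (auto simp: epsw_append option.map_comp o_def option.map_ident)

lemma ew_None:
  assumes "i \<in> {0, 1, 2}" "okw w"
  shows "ew i w = None \<longleftrightarrow> epsw i w = 0"
  using assms(2) by (induction w) (auto simp: le_None[OF assms(1)])

lemma fw_None:
  assumes "i \<in> {0, 1, 2}" "okw w"
  shows "fw i w = None \<longleftrightarrow> phiw i w = 0"
  using assms(2) by (induction w) (auto simp: lf_None[OF assms(1)])

text \<open>Unlike for \<open>fw\<close>, a tie points to the left. If both counts are 0, the left
  word may even be empty, and \<open>okw\<close> is what makes the right word yield
  \<open>None\<close> too.\<close>

lemma ew_append:
  assumes "i \<in> {0, 1, 2}" "okw w"
  shows "ew i (v @ w) = (if epsw i w \<le> phiw i v then map_option (\<lambda>v'. v' @ w) (ew i v)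
    else map_option ((@) v) (ew i w))"
  by (induction v)
    (auto simp: epsw_append option.map_comp o_def option.map_ident ew_None[OF assms])

lemma fw_Some:
  assumes i: "i \<in> {0, 1, 2}" and "okw w" "fw i w = Some v"
  shows "okw v \<and> map fst v = map fst w \<and> ew i v = Some w \<and>
    phiw i w = Suc (phiw i v) \<and> epsw i v = Suc (epsw i w)"
  using assms(2,3)
proof (induction w arbitrary: v)
  case (Cons x w)
  show ?case
  proof (cases "epsw i w < lphi i x")
    case True
    then obtain y where y: "lf i x = Some y" "v = y # w" using Cons.prems by auto
    have "ok x" using Cons.prems by simp
    from lf_Some[OF i this y(1)] show ?thesis using True y Cons.prems by auto
  next
    case False
    then obtain v' where v': "fw i w = Some v'" "v = x # v'" using Cons.prems by auto
    from Cons.IH[OF _ v'(1)] show ?thesis using False v' Cons.prems by auto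
  qed
qed simp

lemma ew_Some:
  assumes i: "i \<in> {0, 1, 2}" and "okw w" "ew i w = Some v"
  shows "okw v \<and> map fst v = map fst w \<and> fw i v = Some w \<and>
    epsw i w = Suc (epsw i v) \<and> phiw i v = Suc (phiw i w)"
  using assms(2,3)
proof (induction w arbitrary: v)
  case (Cons x w)
  show ?case
  proof (cases "epsw i w \<le> lphi i x")
    case True
    then obtain y where y: "le i x = Some y" "v = y # w" using Cons.prems by auto
    have "ok x" using Cons.prems by simp
    from le_Some[OF i this y(1)] show ?thesis using True y Cons.prems by auto
  next
    case False
    then obtain v' where v': "ew i w = Some v'" "v = x # v'" using Cons.prems by auto
    from Cons.IH[OF _ v'(1)] show ?thesis using False v' Cons.prems by auto
  qed
qed simp

lemma iter_Some_1: "iter g (Suc 0) b = g b"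
  by (cases "g b") (auto simp: iter_Suc)

lemma iter_chain:
  assumes "\<And>j. j < k \<Longrightarrow> g (h j) = Some (h (Suc j))"
  shows "iter g k (h 0) = Some (h k)"
  using assms
proof (induction k)
  case (Suc k)
  then show ?case using iter_add[of g k 1 "h 0"] by (simp add: iter_Some_1)
qed simp

lemma iter_fw_Some:
  assumes i: "i \<in> {0, 1, 2}" and "okw w" "iter (fw i) k w = Some v"
  shows "okw v \<and> map fst v = map fst w \<and> iter (ew i) k v = Some w \<and>
    phiw i w = k + phiw i v \<and> epsw i v = k + epsw i w"
  using assms(2,3)
proof (induction k arbitrary: w)
  case (Suc k)
  then obtain w1 where w1: "fw i w = Some w1" "iter (fw i) k w1 = Some v"
    by (auto simp: iter_Suc split: option.splits)
  note s = fw_Some[OF i Suc.prems(1) w1(1)]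
  have "iter (ew i) (k + 1) v = Some w"
    using Suc.IH[OF _ w1(2)] s unfolding iter_add by (simp add: iter_Some_1)
  then show ?case using Suc.IH[OF _ w1(2)] s by simp
qed auto

lemma iter_ew_Some:
  assumes i: "i \<in> {0, 1, 2}" and "okw w" "iter (ew i) k w = Some v"
  shows "okw v \<and> map fst v = map fst w \<and> iter (fw i) k v = Some w \<and>
    epsw i w = k + epsw i v \<and> phiw i v = k + phiw i w"
  using assms(2,3)
proof (induction k arbitrary: w)
  case (Suc k)
  then obtain w1 where w1: "ew i w = Some w1" "iter (ew i) k w1 = Some v"
    by (auto simp: iter_Suc split: option.splits)
  note s = ew_Some[OF i Suc.prems(1) w1(1)]
  have "iter (fw i) (k + 1) v = Some w"
    using Suc.IH[OF _ w1(2)] s unfolding iter_add by (simp add: iter_Some_1)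
  then show ?case using Suc.IH[OF _ w1(2)] s by simp
qed auto

lemma iter_fw_left:
  assumes i: "i \<in> {0, 1, 2}" and "okw v" "k \<le> phiw i v - epsw i w"
  shows "iter (fw i) k (v @ w) = map_option (\<lambda>v'. v' @ w) (iter (fw i) k v)"
  using assms(2,3)
proof (induction k arbitrary: v)
  case (Suc k)
  then obtain v1 where v1: "fw i v = Some v1" using fw_None[OF i, of v] by (cases "fw i v") auto
  note s = fw_Some[OF i Suc.prems(1) v1]
  have "k \<le> phiw i v1 - epsw i w" using s Suc.prems by linarith
  with s Suc.IH[of v1] v1 Suc.prems show ?case by (auto simp: iter_Suc fw_append)
qed simp

lemma iter_fw_right:
  assumes i: "i \<in> {0, 1, 2}" and "okw w" "phiw i v \<le> epsw i w"
  shows "iter (fw i) k (v @ w) = map_option ((@) v) (iter (fw i) k w)"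
  using assms(2,3)
proof (induction k arbitrary: w)
  case (Suc k)
  show ?case
  proof (cases "fw i w")
    case None
    then show ?thesis using Suc.prems by (simp add: iter_Suc fw_append)
  next
    case (Some w1)
    note s = fw_Some[OF i Suc.prems(1) Some]
    with Suc.IH[of w1] Some Suc.prems show ?thesis by (simp add: iter_Suc fw_append)
  qed
qed simp

lemma iter_ew_right:
  assumes i: "i \<in> {0, 1, 2}" and "okw w" "k \<le> epsw i w - phiw i v"
  shows "iter (ew i) k (v @ w) = map_option ((@) v) (iter (ew i) k w)"
  using assms(2,3)
proof (induction k arbitrary: w)
  case (Suc k)
  then obtain w1 where w1: "ew i w = Some w1" using ew_None[OF i, of w] by (cases "ew i w") auto
  note s = ew_Some[OF i Suc.prems(1) w1]
  have "k \<le> epsw i w1 - phiw i v" using s Suc.prems by linarith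
  with s Suc.IH[of w1] w1 Suc.prems show ?case by (auto simp: iter_Suc ew_append[OF i])
qed simp

lemma iter_ew_left:
  assumes i: "i \<in> {0, 1, 2}" and "okw v" "okw w" "epsw i w \<le> phiw i v"
  shows "iter (ew i) k (v @ w) = map_option (\<lambda>v'. v' @ w) (iter (ew i) k v)"
  using assms(2-)
proof (induction k arbitrary: v)
  case (Suc k)
  show ?case
  proof (cases "ew i v")
    case None
    then show ?thesis using Suc.prems by (simp add: iter_Suc ew_append[OF i])
  next
    case (Some v1)
    note s = ew_Some[OF i Suc.prems(1) Some]
    with Suc.IH[of v1] Some Suc.prems show ?thesis by (simp add: iter_Suc ew_append[OF i])
  qed
qed simp

text \<open>\<open>fpass i w w' e\<close>: the word \<open>w'\<close> is $\tilde f_i^{\max} w$, and \<open>e = \<epsilon>\<^sub>i(w)\<close> counts the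
  $\tilde e_i$-brackets that \<open>w\<close> offers to whatever is prepended to it. Hence a word is
  processed from right to left, with \<open>e\<close> as a counter, and for \<open>epass\<close> from left to right.\<close>

definition fpass :: "nat \<Rightarrow> letter list \<Rightarrow> letter list \<Rightarrow> nat \<Rightarrow> bool" where
  "fpass i w w' e \<longleftrightarrow> okw w \<and> iter (fw i) (phiw i w) w = Some w' \<and> epsw i w = e"
definition epass :: "nat \<Rightarrow> letter list \<Rightarrow> letter list \<Rightarrow> nat \<Rightarrow> bool" where
  "epass i w w' f \<longleftrightarrow> okw w \<and> iter (ew i) (epsw i w) w = Some w' \<and> phiw i w = f"

lemma fpass_Nil: "fpass i [] [] 0"
  by (simp add: fpass_def)
lemma epass_Nil: "epass i [] [] 0"
  by (simp add: epass_def)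

text \<open>The brackets of v left unmatched by w are spent first. Then phi of the left part has
  dropped to at most eps of w, and all remaining steps go to w.\<close>

lemma fpass_append:
  assumes i: "i \<in> {0, 1, 2}" and w: "fpass i w w' e" and v: "okw v"
    "iter (fw i) (phiw i v - e) v = Some v'"
  shows "fpass i (v @ w) (v' @ w') (epsw i v + (e - phiw i v))"
proof -
  note w' = w[unfolded fpass_def]
  have "iter (fw i) (phiw i v - e) (v @ w) = Some (v' @ w)"
    using iter_fw_left[OF i v(1), of "phiw i v - e" w] w' v(2) by simp
  moreover have "phiw i v' \<le> epsw i w" using iter_fw_Some[OF i v] w' by linarith
  then have "iter (fw i) (phiw i w) (v' @ w) = Some (v' @ w')"
    using iter_fw_right[OF i] w' by simp
  ultimately have "iter (fw i) ((phiw i v - e) + phiw i w) (v @ w) = Some (v' @ w')"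
    unfolding iter_add by simp
  then show ?thesis using w' v(1) by (simp add: fpass_def phiw_append epsw_append add.commute)
qed

lemma epass_append:
  assumes i: "i \<in> {0, 1, 2}" and v: "epass i v v' f" and w: "okw w"
    "iter (ew i) (epsw i w - f) w = Some w'"
  shows "epass i (v @ w) (v' @ w') (phiw i w + (f - epsw i w))"
proof -
  note v' = v[unfolded epass_def]
  have "iter (ew i) (epsw i w - f) (v @ w) = Some (v @ w')"
    using iter_ew_right[OF i w(1), of "epsw i w - f" v] v' w(2) by simp
  moreover have "epsw i w' \<le> phiw i v" "okw w'" using iter_ew_Some[OF i w] v' by auto
  then have "iter (ew i) (epsw i v) (v @ w') = Some (v' @ w')"
    using iter_ew_left[OF i] v' by simp
  ultimately have "iter (ew i) ((epsw i w - f) + epsw i v) (v @ w) = Some (v' @ w')"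
    unfolding iter_add by simp
  then show ?thesis using v' w(1) by (simp add: epass_def phiw_append epsw_append add.commute)
qed

text \<open>Counter 0 says that w is highest for i, hence w' is lowest and the string can be run
  back. On such words a pass is the action of a simple reflection.\<close>

lemma fpass_inverse:
  assumes "i \<in> {0, 1, 2}" "fpass i w w' 0"
  shows "epass i w' w 0"
  using iter_fw_Some[OF assms(1), of w "phiw i w" w'] assms(2) by (auto simp: fpass_def epass_def)

lemma epass_inverse:
  assumes "i \<in> {0, 1, 2}" "epass i w w' 0"
  shows "fpass i w' w 0"
  using iter_ew_Some[OF assms(1), of w "epsw i w" w'] assms(2) by (auto simp: fpass_def epass_def)

section \<open>Passes through runs of equal letters\<close>

lemma epsw_free: "(\<And>x. x \<in> set w \<Longrightarrow> leps i x = 0) \<Longrightarrow> epsw i w = 0"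
  by (induction w) auto
lemma phiw_free: "(\<And>x. x \<in> set w \<Longrightarrow> lphi i x = 0) \<Longrightarrow> phiw i w = 0"
  by (induction w) auto
lemma epsw_replicate: "lphi i x = 0 \<Longrightarrow> epsw i (replicate k x) = k * leps i x"
  by (induction k) auto
lemma phiw_replicate:
  assumes "leps i x = 0"
  shows "phiw i (replicate k x) = k * lphi i x"
proof (induction k)
  case (Suc k)
  have "epsw i (replicate k x) = 0" by (rule epsw_free) (simp add: assms)
  with Suc show ?case by simp
qed simp

lemma iter_fw_single:
  assumes i: "i \<in> {0, 1, 2}" and "ok x"
  shows "iter (fw i) k [x] = map_option (\<lambda>y. [y]) (iter (lf i) k x)"
  using assms(2)
proof (induction k arbitrary: x)
  case (Suc k)
  show ?case
  proof (cases "lf i x")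
    case None
    then show ?thesis by (simp add: iter_Suc)
  next
    case (Some y)
    then have "0 < lphi i x" using lf_None[OF i Suc.prems] by auto
    then show ?thesis using Suc.IH[of y] lf_Some(2)[OF i Suc.prems Some] Some by (simp add: iter_Suc)
  qed
qed simp

lemma iter_ew_single:
  assumes i: "i \<in> {0, 1, 2}" and "ok x"
  shows "iter (ew i) k [x] = map_option (\<lambda>y. [y]) (iter (le i) k x)"
  using assms(2)
proof (induction k arbitrary: x)
  case (Suc k)
  show ?case
  proof (cases "le i x")
    case None
    then show ?thesis by (simp add: iter_Suc)
  next
    case (Some y)
    then show ?thesis using Suc.IH[of y] le_Some(2)[OF i Suc.prems Some] by (simp add: iter_Suc)
  qed
qed simp

lemma okw_replicate [simp]: "okw (replicate k x) \<longleftrightarrow> k = 0 \<or> ok x"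
  by (auto simp: okw_def)

lemma fpass_eps:
  assumes "i \<in> {0, 1, 2}" "ok x" "lphi i x = 0" "fpass i w w' e" "e' = k * leps i x + e"
  shows "fpass i (replicate k x @ w) (replicate k x @ w') e'"
proof -
  have "phiw i (replicate k x) = 0" by (rule phiw_free) (simp add: assms)
  then show ?thesis using fpass_append[OF assms(1,4), of "replicate k x" "replicate k x"] assms
    by (simp add: epsw_replicate)
qed

lemma fpass_phi:
  assumes "i \<in> {0, 1, 2}" "ok x" "leps i x = 0" "fpass i w w' e" "k * lphi i x + e' = e"
  shows "fpass i (replicate k x @ w) (replicate k x @ w') e'"
proof -
  have "epsw i (replicate k x) = 0" by (rule epsw_free) (simp add: assms)
  then show ?thesis using fpass_append[OF assms(1,4), of "replicate k x" "replicate k x"] assms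
    by (auto simp: phiw_replicate)
qed

lemma fpass_Cons:
  assumes "i \<in> {0, 1, 2}" "ok x" "fpass i w w' e" "iter (lf i) (lphi i x - e) x = Some y"
    "e' = leps i x + (e - lphi i x)"
  shows "fpass i (x # w) (y # w') e'"
  using fpass_append[OF assms(1,3), of "[x]" "[y]"] assms by (simp add: iter_fw_single)

text \<open>For a family \<open>h l\<close> instead of a single letter, because a vacuum mixes
  carriers of size r with path letters of size 1.\<close>

lemma fpass_free:
  assumes i: "i \<in> {0, 1, 2}" and w: "fpass i w w' 0"
    and v: "\<And>l. ok (h l) \<and> leps i (h l) = 0 \<and> iter (lf i) (lphi i (h l)) (h l) = Some (k l)"
  shows "fpass i (map h ls @ w) (map k ls @ w') 0"
proof (induction ls)
  case (Cons l ls)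
  then show ?case using fpass_Cons[OF i, of "h l" "map h ls @ w" "map k ls @ w'" 0 "k l" 0] v[of l]
    by simp
qed (simp add: w)

lemma fpass_free_replicate:
  assumes "i \<in> {0, 1, 2}" "fpass i w w' 0" "ok x" "leps i x = 0" "iter (lf i) (lphi i x) x = Some y"
  shows "fpass i (replicate n x @ w) (replicate n y @ w') 0"
  using fpass_free[OF assms(1,2), of "\<lambda>_. x" "\<lambda>_. y" "replicate n ()"] assms(3-) by simp

lemma epass_phi:
  assumes "i \<in> {0, 1, 2}" "ok x" "leps i x = 0" "epass i v v' f" "f' = k * lphi i x + f"
  shows "epass i (v @ replicate k x) (v' @ replicate k x) f'"
proof -
  have "epsw i (replicate k x) = 0" by (rule epsw_free) (simp add: assms)
  then show ?thesis using epass_append[OF assms(1,4), of "replicate k x" "replicate k x"] assms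
    by (simp add: phiw_replicate)
qed

lemma epass_eps:
  assumes "i \<in> {0, 1, 2}" "ok x" "lphi i x = 0" "epass i v v' f" "k * leps i x + f' = f"
  shows "epass i (v @ replicate k x) (v' @ replicate k x) f'"
proof -
  have "phiw i (replicate k x) = 0" by (rule phiw_free) (simp add: assms)
  then show ?thesis using epass_append[OF assms(1,4), of "replicate k x" "replicate k x"] assms
    by (auto simp: epsw_replicate)
qed

lemma epass_free:
  assumes i: "i \<in> {0, 1, 2}" and v: "epass i v v' 0"
    and w: "\<And>l. ok (h l) \<and> lphi i (h l) = 0 \<and> iter (le i) (leps i (h l)) (h l) = Some (k l)"
  shows "epass i (v @ map h ls) (v' @ map k ls) 0"
proof (induction ls rule: rev_induct)
  case (snoc l ls)
  then show ?case
    using epass_append[OF i, of "v @ map h ls" "v' @ map k ls" 0 "[h l]" "[k l]"] w[of l] i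
    by (simp add: iter_ew_single)
qed (simp add: v)

lemma epass_free_replicate:
  assumes "i \<in> {0, 1, 2}" "epass i v v' 0" "ok x" "lphi i x = 0" "iter (le i) (leps i x) x = Some y"
  shows "epass i (v @ replicate n x) (v' @ replicate n y) 0"
  using epass_free[OF assms(1,2), of "\<lambda>_. x" "\<lambda>_. y" "replicate n ()"] assms(3-) by simp

section \<open>The extremal letters\<close>

text \<open>The Weyl group orbit of the vacuum $u_l$: \<open>1, 2, 3\<close> and \<open>c, b, a\<close> for their barred versions.
  For \<open>l = 1\<close> these are letters of paths, and \<open>X0\<close> is the element $(0,0,1,1,0,0)$ of $B_1$.\<close>

definition "X1 l = (l, (int l, 0, 0, 0, 0, 0) :: elt)"
definition "X2 l = (l, (0, int l, 0, 0, 0, 0) :: elt)"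
definition "X3 l = (l, (0, 0, 2 * int l, 0, 0, 0) :: elt)"
definition "Xc l = (l, (0, 0, 0, 2 * int l, 0, 0) :: elt)"
definition "Xb l = (l, (0, 0, 0, 0, int l, 0) :: elt)"
definition "Xa l = (l, (0, 0, 0, 0, 0, int l) :: elt)"
definition "X0 = (Suc 0, (0, 0, 1, 1, 0, 0) :: elt)"

lemmas X_defs = X1_def X2_def X3_def Xc_def Xb_def Xa_def X0_def

lemma X_ok [simp]: "ok (X1 l)" "ok (X2 l)" "ok (X3 l)" "ok (Xc l)" "ok (Xb l)" "ok (Xa l)" "ok X0"
  by (auto simp: ok_def X_defs B_set_def)

lemma lphi_leps_eq:
  assumes "ok (l, b)"
  shows "lphi 0 (l, b) = nat (phi0 l b)" "leps 0 (l, b) = nat (eps0 l b)"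
    "lphi (Suc 0) (l, b) = nat (phi1 b)" "leps (Suc 0) (l, b) = nat (eps1 b)"
    "lphi 2 (l, b) = nat (phi2 b)" "leps 2 (l, b) = nat (eps2 b)"
  using assms D43_phi_eps by (auto simp: lphi_def leps_def ok_def)

lemma X_vals1 [simp]:
  "lphi (Suc 0) (X1 l) = l" "leps (Suc 0) (X1 l) = 0"
  "lphi (Suc 0) (X2 l) = 0" "leps (Suc 0) (X2 l) = l"
  "lphi (Suc 0) (X3 l) = 2 * l" "leps (Suc 0) (X3 l) = 0"
  "lphi (Suc 0) (Xc l) = 0" "leps (Suc 0) (Xc l) = 2 * l"
  "lphi (Suc 0) (Xb l) = l" "leps (Suc 0) (Xb l) = 0"
  "lphi (Suc 0) (Xa l) = 0" "leps (Suc 0) (Xa l) = l"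
  "lphi (Suc 0) X0 = 1" "leps (Suc 0) X0 = 1"
  using X_ok(1-6)[of l] X_ok(7) unfolding X_defs by (auto simp: lphi_leps_eq)

lemma X_vals2 [simp]:
  "lphi 2 (X1 l) = 0" "leps 2 (X1 l) = 0"
  "lphi 2 (X2 l) = l" "leps 2 (X2 l) = 0"
  "lphi 2 (X3 l) = 0" "leps 2 (X3 l) = l"
  "lphi 2 (Xc l) = l" "leps 2 (Xc l) = 0"
  "lphi 2 (Xb l) = 0" "leps 2 (Xb l) = l"
  "lphi 2 (Xa l) = 0" "leps 2 (Xa l) = 0"
  "lphi 2 X0 = 0" "leps 2 X0 = 0"
  using X_ok(1-6)[of l] X_ok(7) unfolding X_defs by (auto simp: lphi_leps_eq)

lemma X_vals0 [simp]:
  "lphi 0 (X1 l) = 0" "leps 0 (X1 l) = 2 * l"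
  "lphi 0 (X2 l) = 0" "leps 0 (X2 l) = l"
  "lphi 0 (X3 l) = 0" "leps 0 (X3 l) = l"
  "lphi 0 (Xc l) = l" "leps 0 (Xc l) = 0"
  "lphi 0 (Xb l) = l" "leps 0 (Xb l) = 0"
  "lphi 0 (Xa l) = 2 * l" "leps 0 (Xa l) = 0"
  "lphi 0 X0 = 0" "leps 0 X0 = 0"
proof -
  have [simp]: "(- (2 * int l)) div 2 = - int l" by simp
  show
  "lphi 0 (X1 l) = 0" "leps 0 (X1 l) = 2 * l"
  "lphi 0 (X2 l) = 0" "leps 0 (X2 l) = l"
  "lphi 0 (X3 l) = 0" "leps 0 (X3 l) = l"
  "lphi 0 (Xc l) = l" "leps 0 (Xc l) = 0"
  "lphi 0 (Xb l) = l" "leps 0 (Xb l) = 0"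
  "lphi 0 (Xa l) = 2 * l" "leps 0 (Xa l) = 0"
  "lphi 0 X0 = 0" "leps 0 X0 = 0"
    using X_ok(1-6)[of l] X_ok(7) unfolding X_defs
    by (auto simp: lphi_leps_eq phi0_def eps0_def amax_def Let_def max_def)
qed

lemma X1_X2: "iter (lf (Suc 0)) l (X1 l) = Some (X2 l)"
proof -
  have "iter (lf (Suc 0)) l ((\<lambda>j. (l, (int l - int j, int j, 0, 0, 0, 0))) 0) =
    Some ((\<lambda>j. (l, (int l - int j, int j, 0, 0, 0, 0))) l)"
    by (rule iter_chain) (auto simp: lf_def D43_simps into_B_def B_set_def)
  then show ?thesis by (simp add: X_defs)
qed

lemma Xb_Xa: "iter (lf (Suc 0)) l (Xb l) = Some (Xa l)"
proof -
  have "iter (lf (Suc 0)) l ((\<lambda>j. (l, (0, 0, 0, 0, int l - int j, int j))) 0) =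
    Some ((\<lambda>j. (l, (0, 0, 0, 0, int l - int j, int j))) l)"
    by (rule iter_chain) (auto simp: lf_def D43_simps into_B_def B_set_def)
  then show ?thesis by (simp add: X_defs)
qed

lemma X2_X3: "iter (lf 2) l (X2 l) = Some (X3 l)"
proof -
  have "iter (lf 2) l ((\<lambda>j. (l, (0, int l - int j, 2 * int j, 0, 0, 0))) 0) =
    Some ((\<lambda>j. (l, (0, int l - int j, 2 * int j, 0, 0, 0))) l)"
    by (rule iter_chain) (auto simp: lf_def D43_simps into_B_def B_set_def)
  then show ?thesis by (simp add: X_defs)
qed

lemma Xc_Xb: "lf 2 (Xc (Suc 0)) = Some (Xb (Suc 0))"
  by (auto simp: X_defs lf_def D43_simps into_B_def B_set_def)

lemma X3_X0: "lf (Suc 0) (X3 (Suc 0)) = Some X0"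
  by (auto simp: X_defs lf_def D43_simps into_B_def B_set_def)

lemma X0_Xc: "lf (Suc 0) X0 = Some (Xc (Suc 0))"
  by (auto simp: X_defs lf_def D43_simps into_B_def B_set_def)

lemma X3_Xc: "iter (lf (Suc 0)) 2 (X3 (Suc 0)) = Some (Xc (Suc 0))"
  by (simp add: numeral_2_eq_2 iter_Suc X3_X0 X0_Xc)

lemma X3_Xb: "iter (le 0) l (X3 l) = Some (Xb l)"
proof -
  let ?h = "\<lambda>j. (l, (0, 0, 2 * (int l - int j), 0, int j, 0) :: elt)"
  have "iter (le 0) l (?h 0) = Some (?h l)"
  proof (rule iter_chain)
    fix j assume j: "j < l"
    have "e0_raw (snd (?h j)) = snd (?h j) - moves ! 2"
      by (rule e0_eqI) (use j in \<open>auto simp: less6 Let_def\<close>)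
    then show "le 0 (?h j) = Some (?h (Suc j))"
      using j by (auto simp: le_def D43_simps into_B_def B_set_def moves_def zero_prod_def)
  qed
  then show ?thesis by (simp add: X_defs)
qed

lemma X2_Xc: "le 0 (X2 (Suc 0)) = Some (Xc (Suc 0))"
proof -
  have "e0_raw (0, 1, 0, 0, 0, 0) = (0, 1, 0, 0, 0, 0) - moves ! 3"
    by (rule e0_eqI) (auto simp: less6 Let_def)
  then show ?thesis by (auto simp: X_defs le_def D43_simps into_B_def B_set_def moves_def zero_prod_def)
qed

text \<open>The string runs through the element of B_1 with all coordinates zero, entered by the
  inverse of the first move and left by the inverse of the last.\<close>

lemma X1_Xa: "iter (le 0) 2 (X1 (Suc 0)) = Some (Xa (Suc 0))"
proof -
  have "e0_raw (1, 0, 0, 0, 0, 0) = (1, 0, 0, 0, 0, 0) - moves ! 0"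
    by (rule e0_eqI) (auto simp: less6 Let_def)
  then have 1: "le 0 (X1 (Suc 0)) = Some (Suc 0, (0, 0, 0, 0, 0, 0))"
    by (auto simp: X_defs le_def D43_simps into_B_def B_set_def moves_def zero_prod_def)
  have "e0_raw (0, 0, 0, 0, 0, 0) = (0, 0, 0, 0, 0, 0) - moves ! 5"
    by (rule e0_eqI) (auto simp: less6 Let_def)
  then have "le 0 (Suc 0, (0, 0, 0, 0, 0, 0)) = Some (Xa (Suc 0))"
    by (auto simp: X_defs le_def D43_simps into_B_def B_set_def moves_def zero_prod_def)
  with 1 show ?thesis by (simp add: numeral_2_eq_2 iter_Suc)
qed

abbreviation "R1 k \<equiv> replicate k (X1 (Suc 0))"
abbreviation "R2 k \<equiv> replicate k (X2 (Suc 0))"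
abbreviation "R3 k \<equiv> replicate k (X3 (Suc 0))"
abbreviation "Rc k \<equiv> replicate k (Xc (Suc 0))"
abbreviation "Rb k \<equiv> replicate k (Xb (Suc 0))"
abbreviation "Ra k \<equiv> replicate k (Xa (Suc 0))"
abbreviation "R0 k \<equiv> replicate k X0"

lemma lf_letter_iter:
  "iter (lf (Suc 0)) (Suc 0) (X1 (Suc 0)) = Some (X2 (Suc 0))"
  "iter (lf (Suc 0)) (Suc 0) (Xb (Suc 0)) = Some (Xa (Suc 0))"
  "iter (lf (Suc 0)) 2 (X3 (Suc 0)) = Some (Xc (Suc 0))"
  "iter (lf (Suc 0)) (Suc 0) (X3 (Suc 0)) = Some X0"
  "iter (lf (Suc 0)) (Suc 0) X0 = Some (Xc (Suc 0))"
  "iter (lf 2) (Suc 0) (X2 (Suc 0)) = Some (X3 (Suc 0))"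
  "iter (lf 2) (Suc 0) (Xc (Suc 0)) = Some (Xb (Suc 0))"
  "iter (le 0) (Suc 0) (X3 (Suc 0)) = Some (Xb (Suc 0))"
  "iter (le 0) (Suc 0) (X2 (Suc 0)) = Some (Xc (Suc 0))"
  "iter (le 0) 2 (X1 (Suc 0)) = Some (Xa (Suc 0))"
  using X1_X2[of "Suc 0"] Xb_Xa[of "Suc 0"] X3_Xc X3_X0 X0_Xc X2_X3[of "Suc 0"] Xc_Xb
    X3_Xb[of "Suc 0"] X2_Xc X1_Xa by (simp_all add: iter_Some_1)

text \<open>Names: \<open>fpass1\<close>, \<open>fpass2\<close>, \<open>epass0\<close> and the letters of the block; suffix \<open>f\<close> if its brackets are free
  and get flipped, \<open>m\<close> if they are all matched by the counter.\<close>

lemma fpass1_vac: "fpass (Suc 0) w w' 0 \<Longrightarrow> e = 0 \<Longrightarrow> fpass (Suc 0) (map X1 ls @ w) (map X2 ls @ w') e"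
  using fpass_free[of "(Suc 0)" w w' X1 X2 ls] by (simp add: X1_X2)
lemma fpass1_vac_b: "fpass (Suc 0) w w' 0 \<Longrightarrow> e = 0 \<Longrightarrow> fpass (Suc 0) (map Xb ls @ w) (map Xa ls @ w') e"
  using fpass_free[of "(Suc 0)" w w' Xb Xa ls] by (simp add: Xb_Xa)
lemma fpass2_vac: "fpass 2 w w' 0 \<Longrightarrow> e = 0 \<Longrightarrow> fpass 2 (map X2 ls @ w) (map X3 ls @ w') e"
  using fpass_free[of "2" w w' X2 X3 ls] by (simp add: X2_X3)
lemma fpass1_1f: "fpass (Suc 0) w w' 0 \<Longrightarrow> e = 0 \<Longrightarrow> fpass (Suc 0) (R1 k @ w) (R2 k @ w') e"
  using fpass_free_replicate[of "(Suc 0)" w w'] lf_letter_iter by simp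
lemma fpass1_1m: "fpass (Suc 0) w w' (k + e) \<Longrightarrow> fpass (Suc 0) (R1 k @ w) (R1 k @ w') e"
  using fpass_phi[of "(Suc 0)" _ w w' "k + e" k e] by simp
lemma fpass1_2: "fpass (Suc 0) w w' (e - k) \<Longrightarrow> k \<le> e \<Longrightarrow> fpass (Suc 0) (R2 k @ w) (R2 k @ w') e"
  using fpass_eps[of "(Suc 0)" _ w w' "e - k" e k] by simp
lemma fpass1_3m: "fpass (Suc 0) w w' (2 * k + e) \<Longrightarrow> fpass (Suc 0) (R3 k @ w) (R3 k @ w') e"
  using fpass_phi[of "(Suc 0)" _ w w' "2 * k + e" k e] by simp
lemma fpass1_3f: "fpass (Suc 0) w w' 0 \<Longrightarrow> e = 0 \<Longrightarrow> fpass (Suc 0) (R3 k @ w) (Rc k @ w') e"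
  using fpass_free_replicate[of "(Suc 0)" w w'] lf_letter_iter by simp
lemma fpass1_c: "fpass (Suc 0) w w' (e - 2 * k) \<Longrightarrow> 2 * k \<le> e \<Longrightarrow> fpass (Suc 0) (Rc k @ w) (Rc k @ w') e"
  using fpass_eps[of "(Suc 0)" _ w w' "e - 2 * k" e k] by simp
lemma fpass1_bm: "fpass (Suc 0) w w' (k + e) \<Longrightarrow> fpass (Suc 0) (Rb k @ w) (Rb k @ w') e"
  using fpass_phi[of "(Suc 0)" _ w w' "k + e" k e] by simp
lemma fpass1_bf: "fpass (Suc 0) w w' 0 \<Longrightarrow> e = 0 \<Longrightarrow> fpass (Suc 0) (Rb k @ w) (Ra k @ w') e"
  using fpass_free_replicate[of "(Suc 0)" w w'] lf_letter_iter by simp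
lemma fpass1_a: "fpass (Suc 0) w w' (e - k) \<Longrightarrow> k \<le> e \<Longrightarrow> fpass (Suc 0) (Ra k @ w) (Ra k @ w') e"
  using fpass_eps[of "(Suc 0)" _ w w' "e - k" e k] by simp
lemma fpass2_2f: "fpass 2 w w' 0 \<Longrightarrow> e = 0 \<Longrightarrow> fpass 2 (R2 k @ w) (R3 k @ w') e"
  using fpass_free_replicate[of "2" w w'] lf_letter_iter by simp
lemma fpass2_2m: "fpass 2 w w' (k + e) \<Longrightarrow> fpass 2 (R2 k @ w) (R2 k @ w') e"
  using fpass_phi[of "2" _ w w' "k + e" k e] by simp
lemma fpass2_3: "fpass 2 w w' (e - k) \<Longrightarrow> k \<le> e \<Longrightarrow> fpass 2 (R3 k @ w) (R3 k @ w') e"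
  using fpass_eps[of "2" _ w w' "e - k" e k] by simp
lemma fpass2_cm: "fpass 2 w w' (k + e) \<Longrightarrow> fpass 2 (Rc k @ w) (Rc k @ w') e"
  using fpass_phi[of "2" _ w w' "k + e" k e] by simp
lemma fpass2_cf: "fpass 2 w w' 0 \<Longrightarrow> e = 0 \<Longrightarrow> fpass 2 (Rc k @ w) (Rb k @ w') e"
  using fpass_free_replicate[of "2" w w'] lf_letter_iter by simp
lemma fpass2_1: "fpass 2 w w' e \<Longrightarrow> fpass 2 (R1 k @ w) (R1 k @ w') e"
  using fpass_phi[of "2" _ w w' e k e] by simp
lemma fpass2_0: "fpass 2 w w' e \<Longrightarrow> fpass 2 (R0 k @ w) (R0 k @ w') e"
  using fpass_phi[of "2" _ w w' e k e] by simp
text \<open>With counter 1 one of the two brackets of a three is matched, and the single remaining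
  step stops halfway at \<open>X0\<close>. Letting d be both the number of letters and the counter
  treats both parities at once.\<close>

lemma fpass1_30: "fpass (Suc 0) w w' d \<Longrightarrow> e = 0 \<Longrightarrow> d \<le> Suc 0 \<Longrightarrow> fpass (Suc 0) (R3 d @ w) (R0 d @ w') e"
  using fpass_Cons[of "Suc 0" "X3 (Suc 0)" w w' "Suc 0" X0 0] lf_letter_iter by (cases d) auto
lemma fpass1_0: "fpass (Suc 0) w w' 0 \<Longrightarrow> e = d \<Longrightarrow> d \<le> Suc 0 \<Longrightarrow> fpass (Suc 0) (R0 d @ w) (Rc d @ w') e"
  using fpass_Cons[of "Suc 0" X0 w w' 0 "Xc (Suc 0)" "Suc 0"] lf_letter_iter by (cases d) auto
lemma epass0_3f: "epass 0 w w' 0 \<Longrightarrow> e = 0 \<Longrightarrow> epass 0 (w @ R3 k) (w' @ Rb k) e"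
  using epass_free_replicate[of 0 w w'] lf_letter_iter by simp
lemma epass0_2f: "epass 0 w w' 0 \<Longrightarrow> e = 0 \<Longrightarrow> epass 0 (w @ R2 k) (w' @ Rc k) e"
  using epass_free_replicate[of 0 w w'] lf_letter_iter by simp
lemma epass0_1f: "epass 0 w w' 0 \<Longrightarrow> e = 0 \<Longrightarrow> epass 0 (w @ R1 k) (w' @ Ra k) e"
  using epass_free_replicate[of 0 w w'] lf_letter_iter by simp
lemma epass0_c: "epass 0 w w' (e - k) \<Longrightarrow> k \<le> e \<Longrightarrow> epass 0 (w @ Rc k) (w' @ Rc k) e"
  using epass_phi[of 0 _ w w' "e - k" e k] by simp
lemma epass0_b: "epass 0 w w' (e - k) \<Longrightarrow> k \<le> e \<Longrightarrow> epass 0 (w @ Rb k) (w' @ Rb k) e"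
  using epass_phi[of 0 _ w w' "e - k" e k] by simp
lemma epass0_3m: "epass 0 w w' (k + e) \<Longrightarrow> epass 0 (w @ R3 k) (w' @ R3 k) e"
  using epass_eps[of 0 _ w w' "k + e" k e] by simp
lemma epass0_0: "epass 0 w w' e \<Longrightarrow> epass 0 (w @ R0 k) (w' @ R0 k) e"
  using epass_eps[of 0 _ w w' e k e] by simp
lemma epass0_vac: "epass 0 w w' 0 \<Longrightarrow> e = 0 \<Longrightarrow> epass 0 (w @ map X3 ls) (w' @ map Xb ls) e"
  using epass_free[of 0 w w' X3 Xb ls] by (simp add: X3_Xb)

section \<open>The operator $\tilde e_0$ on solitons\<close>

text \<open>The action of the Weyl group element $s_1 s_0 s_2 s_1$. It moves the vacuum from $u_l$ to the
  letters \<open>Xa\<close>, which are again invariant under $\tilde e_2$ and $\tilde f_2$, and it turns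
  the soliton $(3)^{\otimes y_2}\otimes(2)^{\otimes y_1}$ into $b^{y_1}c^{y_2}$ with a shift
  depending on the label.\<close>

definition S_rel :: "letter list \<Rightarrow> letter list \<Rightarrow> bool" where
  "S_rel w q \<longleftrightarrow> (\<exists>w1 w2 w3. fpass (Suc 0) w w1 0 \<and> fpass 2 w1 w2 0 \<and> epass 0 w2 w3 0 \<and> fpass (Suc 0) w3 q 0)"

text \<open>For \<open>y1 \<ge> 2 y2\<close> the twos of the soliton use up all brackets of its threes in the first pass.\<close>

lemma S_rel_C:
  assumes "y1 = 2 * y2 + n" "2 * y1 \<le> g"
  shows "S_rel (map X1 ls @ R1 a @ R1 a @ R2 a @ R1 (g - n) @ R1 n @ R3 y2 @ R2 y1 @ R1 M @ map X1 ms)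
    (map Xa ls @ Rb a @ Ra a @ Ra (a + g - n - y2 - y1) @ Rb y1 @ Rc y2 @ Ra n @ Ra y2 @ Ra y1 @ Ra M @ map Xa ms)"
proof -
  have 1: "fpass (Suc 0) (map X1 ls @ R1 a @ R1 a @ R2 a @ R1 (g - n) @ R1 n @ R3 y2 @ R2 y1 @ R1 M @ map X1 ms @ [])
    (map X2 ls @ R2 a @ R1 a @ R2 a @ R2 (g - n) @ R1 n @ R3 y2 @ R2 y1 @ R2 M @ map X2 ms @ []) 0"
    by (rule fpass1_vac, rule fpass1_1f, rule fpass1_1m, rule fpass1_2, rule fpass1_1f, rule fpass1_1m, rule fpass1_3m, rule fpass1_2,
        rule fpass1_1f, rule fpass1_vac, rule fpass_Nil) (use assms in simp_all)
  \<comment> \<open>The last y2 twos of this run will be matched by the y2 threes of the soliton in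
    the pass for index 2.\<close>
  have e1: "R2 (g - n) = R2 (g - n - y2) @ R2 y2"
    using assms by (simp flip: replicate_add)
  have 2: "fpass 2 (map X2 ls @ R2 a @ R1 a @ R2 a @ R2 (g - n - y2) @ R2 y2 @ R1 n @ R3 y2 @ R2 y1 @ R2 M @ map X2 ms @ [])
    (map X3 ls @ R3 a @ R1 a @ R3 a @ R3 (g - n - y2) @ R2 y2 @ R1 n @ R3 y2 @ R3 y1 @ R3 M @ map X3 ms @ []) 0"
    by (rule fpass2_vac, rule fpass2_2f, rule fpass2_1, rule fpass2_2f, rule fpass2_2f, rule fpass2_2m, rule fpass2_1, rule fpass2_3,
        rule fpass2_2f, rule fpass2_2f, rule fpass2_vac, rule fpass_Nil) (use assms in simp_all)
  have 3: "epass 0 ((((((((((([] @ map X3 ls) @ R3 a) @ R1 a) @ R3 a) @ R3 (g - n - y2)) @ R2 y2) @ R1 n) @ R3 y2) @ R3 y1) @ R3 M) @ map X3 ms)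
    ((((((((((([] @ map Xb ls) @ Rb a) @ Ra a) @ Rb a) @ Rb (g - n - y2)) @ Rc y2) @ Ra n) @ Rb y2) @ Rb y1) @ Rb M) @ map Xb ms) 0"
    by (rule epass0_vac, rule epass0_3f, rule epass0_3f, rule epass0_3f, rule epass0_1f, rule epass0_2f, rule epass0_3f, rule epass0_3f,
        rule epass0_1f, rule epass0_3f, rule epass0_vac, rule epass_Nil) (use assms in simp_all)
  \<comment> \<open>Regrouping for the last pass: c^y2 a^n offers 2*y2 + n = y1 brackets, which keep
    the y1 letters b before it from being flipped.\<close>
  have e3: "Rb a @ Rb (g - n - y2) @ w = Rb (a + g - n - y2 - y1) @ Rb y1 @ w" for w
    using assms by (simp flip: append_assoc replicate_add)
  have 4: "fpass (Suc 0) (map Xb ls @ Rb a @ Ra a @ Rb (a + g - n - y2 - y1) @ Rb y1 @ Rc y2 @ Ra n @ Rb y2 @ Rb y1 @ Rb M @ map Xb ms @ [])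
    (map Xa ls @ Rb a @ Ra a @ Ra (a + g - n - y2 - y1) @ Rb y1 @ Rc y2 @ Ra n @ Ra y2 @ Ra y1 @ Ra M @ map Xa ms @ []) 0"
    by (rule fpass1_vac_b, rule fpass1_bm, rule fpass1_a, rule fpass1_bf, rule fpass1_bm, rule fpass1_c, rule fpass1_a, rule fpass1_bf,
        rule fpass1_bf, rule fpass1_bf, rule fpass1_vac_b, rule fpass_Nil) (use assms in simp_all)
  show ?thesis unfolding S_rel_def
    using 1[unfolded e1 append_assoc append_Nil2 append_Nil] 2[unfolded append_assoc append_Nil2 append_Nil]
      3[unfolded append_assoc append_Nil2 append_Nil e3] 4[unfolded append_assoc append_Nil2 append_Nil]
    unfolding e1 append_assoc by blast
qed

text \<open>For \<open>y1 \<le> 2 y2\<close> a parity matters: when \<open>y1\<close> is odd (\<open>d = 1\<close>) one of the threes is half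
  matched and becomes \<open>X0\<close>.\<close>

lemma S_rel_A:
  assumes "y1 = 2 * h + d" "d \<le> Suc 0" "y2 = m + d + h" "2 * y1 \<le> g" "m \<le> M"
  shows "S_rel (map X1 ls @ R1 a @ R1 a @ R2 a @ R1 g @ R3 m @ R3 d @ R3 h @ R2 y1 @ R1 M @ map X1 ms)
    (map Xa ls @ Rb a @ Ra a @ Ra (a + g + m - h - y1) @ Rb y1 @ Rc h @ Rc d @ Rc m @ Ra (3 * h + d + M - m) @ map Xa ms)"
proof -
  have 1: "fpass (Suc 0) (map X1 ls @ R1 a @ R1 a @ R2 a @ R1 g @ R3 m @ R3 d @ R3 h @ R2 y1 @ R1 M @ map X1 ms @ [])
    (map X2 ls @ R2 a @ R1 a @ R2 a @ R2 g @ Rc m @ R0 d @ R3 h @ R2 y1 @ R2 M @ map X2 ms @ []) 0"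
    by (rule fpass1_vac, rule fpass1_1f, rule fpass1_1m, rule fpass1_2, rule fpass1_1f, rule fpass1_3f, rule fpass1_30, rule fpass1_3m, rule fpass1_2,
        rule fpass1_1f, rule fpass1_vac, rule fpass_Nil) (use assms in simp_all)
  \<comment> \<open>In the pass for index 0 the first m threes are matched by m letters b or c in
    front of them, and only the others become b.\<close>
  have e2: "R3 h @ R3 y1 @ R3 M @ w = R3 m @ R3 (3 * h + d + M - m) @ w" for w
    using assms by (simp flip: append_assoc replicate_add)
  have "\<exists>w2. fpass 2 (map X2 ls @ R2 a @ R1 a @ R2 a @ R2 g @ Rc m @ R0 d @ R3 h @ R2 y1 @ R2 M @ map X2 ms @ []) w2 0 \<and>
     epass 0 w2 (map Xb ls @ Rb a @ Ra a @ Rb a @ Rb (g + m - h) @ Rc h @ R0 d @ R3 m @ Rb (3 * h + d + M - m) @ map Xb ms) 0"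
  \<comment> \<open>The h remaining threes are matched in the pass for index 2 by letters c if there
    are enough of them, and otherwise also by h - m twos of the gap.\<close>
  proof (cases "h \<le> m")
    case True
    have s: "Rc m = Rc (m - h) @ Rc h" using True by (simp flip: replicate_add)
    have 2: "fpass 2 (map X2 ls @ R2 a @ R1 a @ R2 a @ R2 g @ Rc (m - h) @ Rc h @ R0 d @ R3 h @ R2 y1 @ R2 M @ map X2 ms @ [])
      (map X3 ls @ R3 a @ R1 a @ R3 a @ R3 g @ Rb (m - h) @ Rc h @ R0 d @ R3 h @ R3 y1 @ R3 M @ map X3 ms @ []) 0"
      by (rule fpass2_vac, rule fpass2_2f, rule fpass2_1, rule fpass2_2f, rule fpass2_2f, rule fpass2_cf, rule fpass2_cm, rule fpass2_0, rule fpass2_3,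
          rule fpass2_2f, rule fpass2_2f, rule fpass2_vac, rule fpass_Nil) (use assms in simp_all)
    have 3: "epass 0 ((((((((((([] @ map X3 ls) @ R3 a) @ R1 a) @ R3 a) @ R3 g) @ Rb (m - h)) @ Rc h) @ R0 d) @ R3 m) @ R3 (3 * h + d + M - m)) @ map X3 ms)
      ((((((((((([] @ map Xb ls) @ Rb a) @ Ra a) @ Rb a) @ Rb g) @ Rb (m - h)) @ Rc h) @ R0 d) @ R3 m) @ Rb (3 * h + d + M - m)) @ map Xb ms) 0"
      by (rule epass0_vac, rule epass0_3f, rule epass0_3m, rule epass0_0, rule epass0_c, rule epass0_b, rule epass0_3f, rule epass0_3f,
          rule epass0_1f, rule epass0_3f, rule epass0_vac, rule epass_Nil) (use assms True in simp_all)
    have e3: "Rb g @ Rb (m - h) @ w = Rb (g + m - h) @ w" for w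
      using True by (simp flip: append_assoc replicate_add)
    show ?thesis unfolding s append_assoc
      using 2[unfolded e2] 3[unfolded append_assoc append_Nil2 append_Nil e3]
      unfolding append_Nil2 by blast
  next
    case False
    have s: "R2 g = R2 (g - (h - m)) @ R2 (h - m)" using False assms by (simp flip: replicate_add)
    have 2: "fpass 2 (map X2 ls @ R2 a @ R1 a @ R2 a @ R2 (g - (h - m)) @ R2 (h - m) @ Rc m @ R0 d @ R3 h @ R2 y1 @ R2 M @ map X2 ms @ [])
      (map X3 ls @ R3 a @ R1 a @ R3 a @ R3 (g - (h - m)) @ R2 (h - m) @ Rc m @ R0 d @ R3 h @ R3 y1 @ R3 M @ map X3 ms @ []) 0"
      by (rule fpass2_vac, rule fpass2_2f, rule fpass2_1, rule fpass2_2f, rule fpass2_2f, rule fpass2_2m, rule fpass2_cm, rule fpass2_0, rule fpass2_3,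
          rule fpass2_2f, rule fpass2_2f, rule fpass2_vac, rule fpass_Nil) (use assms False in simp_all)
    have 3: "epass 0 ((((((((((([] @ map X3 ls) @ R3 a) @ R1 a) @ R3 a) @ R3 (g - (h - m))) @ R2 (h - m)) @ Rc m) @ R0 d) @ R3 m) @ R3 (3 * h + d + M - m)) @ map X3 ms)
      ((((((((((([] @ map Xb ls) @ Rb a) @ Ra a) @ Rb a) @ Rb (g - (h - m))) @ Rc (h - m)) @ Rc m) @ R0 d) @ R3 m) @ Rb (3 * h + d + M - m)) @ map Xb ms) 0"
      by (rule epass0_vac, rule epass0_3f, rule epass0_3m, rule epass0_0, rule epass0_c, rule epass0_2f, rule epass0_3f, rule epass0_3f,
          rule epass0_1f, rule epass0_3f, rule epass0_vac, rule epass_Nil) (use assms False in simp_all)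
    have e3: "Rb (g - (h - m)) @ Rc (h - m) @ Rc m @ w = Rb (g + m - h) @ Rc h @ w" for w
      using False assms by (simp flip: append_assoc replicate_add)
    show ?thesis unfolding s append_assoc
      using 2[unfolded e2] 3[unfolded append_assoc append_Nil2 append_Nil e3]
      unfolding append_Nil2 by blast
  qed
  then obtain w2 where 23: "fpass 2 (map X2 ls @ R2 a @ R1 a @ R2 a @ R2 g @ Rc m @ R0 d @ R3 h @ R2 y1 @ R2 M @ map X2 ms @ []) w2 0"
     "epass 0 w2 (map Xb ls @ Rb a @ Ra a @ Rb a @ Rb (g + m - h) @ Rc h @ R0 d @ R3 m @ Rb (3 * h + d + M - m) @ map Xb ms) 0"
    by blast
  have e3: "Rb a @ Rb (g + m - h) @ w = Rb (a + g + m - h - y1) @ Rb y1 @ w" for w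
    using assms by (simp flip: append_assoc replicate_add)
  have 4: "fpass (Suc 0) (map Xb ls @ Rb a @ Ra a @ Rb (a + g + m - h - y1) @ Rb y1 @ Rc h @ R0 d @ R3 m @ Rb (3 * h + d + M - m) @ map Xb ms @ [])
    (map Xa ls @ Rb a @ Ra a @ Ra (a + g + m - h - y1) @ Rb y1 @ Rc h @ Rc d @ Rc m @ Ra (3 * h + d + M - m) @ map Xa ms @ []) 0"
    by (rule fpass1_vac_b, rule fpass1_bm, rule fpass1_a, rule fpass1_bf, rule fpass1_bm, rule fpass1_c, rule fpass1_0, rule fpass1_3f,
        rule fpass1_bf, rule fpass1_vac_b, rule fpass_Nil) (use assms in simp_all)
  show ?thesis unfolding S_rel_def
    using 1 23(1) 23(2)[unfolded e3] 4 unfolding append_Nil2 by blast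
qed

text \<open>Both regimes give the same offset, linear in y1 and y2; linearity is what makes E_0 move
  a soliton by a constant distance. The displacement of the left soliton depends on a alone and uses
  up the 2*a ones before it.\<close>

lemma S_rel_soliton:
  assumes "2 * y1 \<le> g" "y2 \<le> M"
  shows "S_rel (map X1 ls @ R1 (2 * a) @ R2 a @ R1 g @ R3 y2 @ R2 y1 @ R1 M @ map X1 ms)
    (map Xa ls @ Rb a @ Ra (2 * a + g + y2 - 2 * y1) @ Rb y1 @ Rc y2 @ Ra (M + 2 * y1 - y2) @ map Xa ms)"
proof (cases "2 * y2 \<le> y1")
  case True
  then obtain n where n: "y1 = 2 * y2 + n" using le_Suc_ex by blast
  have e: "R1 a @ R1 a @ w = R1 (2 * a) @ w" "R1 (g - n) @ R1 n @ w = R1 g @ w"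
    "Ra a @ Ra (a + g - n - y2 - y1) @ w = Ra (2 * a + g + y2 - 2 * y1) @ w"
    "Ra n @ Ra y2 @ Ra y1 @ Ra M @ w = Ra (M + 2 * y1 - y2) @ w" for w
    using n assms by (simp_all flip: append_assoc replicate_add add: mult_2 algebra_simps)
  show ?thesis using S_rel_C[OF n assms(1), of ls a M ms] unfolding e .
next
  case False
  define h d m where "h = y1 div 2" "d = y1 mod 2" "m = y2 - d - h"
  then have n: "y1 = 2 * h + d" "d \<le> Suc 0" "y2 = m + d + h" "m \<le> M" using False assms by auto
  have e: "R1 a @ R1 a @ w = R1 (2 * a) @ w" "R3 m @ R3 d @ R3 h @ w = R3 y2 @ w"
    "Rc h @ Rc d @ Rc m @ w = Rc y2 @ w"
    "Ra a @ Ra (a + g + m - h - y1) @ w = Ra (2 * a + g + y2 - 2 * y1) @ w"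
    "Ra (3 * h + d + M - m) @ w = Ra (M + 2 * y1 - y2) @ w" for w
    using n assms by (simp_all flip: append_assoc replicate_add add: mult_2 algebra_simps)
  show ?thesis using S_rel_A[OF n(1-3) assms(1) n(4), of ls a ms] unfolding e .
qed

section \<open>The conjugated operator E_0\<close>

lemma fpass_fun: "fpass i w v e \<Longrightarrow> fpass i w v' e' \<Longrightarrow> v = v'"
  by (simp add: fpass_def)
lemma epass_fun: "epass i w v e \<Longrightarrow> epass i w v' e' \<Longrightarrow> v = v'"
  by (simp add: epass_def)

lemma S_rel_fun: "S_rel w q \<Longrightarrow> S_rel w q' \<Longrightarrow> q = q'"
  unfolding S_rel_def by (metis fpass_fun epass_fun)

lemma S_rel_inj:
  assumes "S_rel w q" "S_rel w' q"
  shows "w = w'"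
proof -
  obtain w1 w2 w3 w1' w2' w3' where
    "fpass (Suc 0) w w1 0" "fpass 2 w1 w2 0" "epass 0 w2 w3 0" "fpass (Suc 0) w3 q 0"
    "fpass (Suc 0) w' w1' 0" "fpass 2 w1' w2' 0" "epass 0 w2' w3' 0" "fpass (Suc 0) w3' q 0"
    using assms unfolding S_rel_def by blast
  then have *: "epass (Suc 0) w1 w 0" "epass 2 w2 w1 0" "fpass 0 w3 w2 0" "epass (Suc 0) q w3 0"
    "epass (Suc 0) w1' w' 0" "epass 2 w2' w1' 0" "fpass 0 w3' w2' 0" "epass (Suc 0) q w3' 0"
    by (auto intro: fpass_inverse epass_inverse)
  then show ?thesis by (metis fpass_fun epass_fun)
qed

text \<open>The conjugate of $\tilde e_2$ by $s_1 s_0 s_2 s_1$ belongs to the real root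
  $-\alpha_2+3\delta$, which together with $\alpha_2$ generates the $A_1^{(1)}$ fixing the vacuum.
  The multiple of $\delta$ is the reason for the factor $3$ in the phase shift.\<close>

definition E_rel :: "letter list \<Rightarrow> letter list \<Rightarrow> bool" where
  "E_rel w v \<longleftrightarrow> (\<exists>q q'. S_rel w q \<and> ew 2 q = Some q' \<and> S_rel v q')"

lemma E_rel_fun: "E_rel w v \<Longrightarrow> E_rel w v' \<Longrightarrow> v = v'"
  unfolding E_rel_def by (metis S_rel_fun S_rel_inj option.inject)

text \<open>The vacuum and the left soliton have no phi_2 brackets in the image, so e_2 acts on the
  last b of the right block and turns it into c. This matches e_0 of the A_1 crystal, which acts on
  the second factor when the first label is (a, 0).\<close>

lemma E_rel_soliton:
  assumes "2 * y1 + 3 \<le> g" "y2 \<le> M"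
  shows "E_rel (map X1 ls @ R1 (2 * a) @ R2 a @ R1 g @ R3 y2 @ R2 (Suc y1) @ R1 M @ map X1 ms)
    (map X1 ls @ R1 (2 * a) @ R2 a @ R1 (g - 3) @ R3 (Suc y2) @ R2 y1 @ R1 (M + 3) @ map X1 ms)"
proof -
  define G where "G = 2 * a + g + y2 - 2 * Suc y1"
  define N where "N = M + 2 * Suc y1 - y2"
  \<comment> \<open>Pulling back requires equal vacua around both images. From (y1 + 1, y2) to (y1,
    y2 + 1) the term y2 - 2*y1 grows by 3, so g drops by 3 and M grows by 3.\<close>
  have G: "2 * a + (g - 3) + Suc y2 - 2 * y1 = G" "M + 3 + 2 * y1 - Suc y2 = N"
    using assms by (auto simp: G_def N_def)
  let ?A = "map Xa ls @ Rb a @ Ra G" and ?D = "Ra N @ map Xa ms"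
  have S1: "S_rel (map X1 ls @ R1 (2 * a) @ R2 a @ R1 g @ R3 y2 @ R2 (Suc y1) @ R1 M @ map X1 ms)
    (?A @ Rb (Suc y1) @ Rc y2 @ ?D)"
    using S_rel_soliton[of "Suc y1" g y2 M ls a ms] assms by (simp add: G_def N_def)
  have S2: "S_rel (map X1 ls @ R1 (2 * a) @ R2 a @ R1 (g - 3) @ R3 (Suc y2) @ R2 y1 @ R1 (M + 3) @ map X1 ms)
    (?A @ Rb y1 @ Rc (Suc y2) @ ?D)"
    using S_rel_soliton[of "y1" "g - 3" "Suc y2" "M + 3" ls a ms] assms unfolding G by simp
  have okD: "okw (Rc y2 @ ?D)" "okw (Xb (Suc 0) # Rc y2 @ ?D)" by (auto simp: okw_def)
  have z: "epsw 2 (Rc y2 @ ?D) = 0" by (rule epsw_free) auto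
  have f: "phiw 2 (?A @ Rb y1) = 0" by (rule phiw_free) auto
  have "le 2 (Xb (Suc 0)) = Some (Xc (Suc 0))"
    by (rule lf_Some(3)) (auto simp: Xc_Xb)
  then have "ew 2 ((?A @ Rb y1) @ (Xb (Suc 0) # Rc y2 @ ?D)) = Some ((?A @ Rb y1) @ (Xc (Suc 0) # Rc y2 @ ?D))"
    using z f okD by (subst ew_append) auto
  then have "ew 2 (?A @ Rb (Suc y1) @ Rc y2 @ ?D) = Some (?A @ Rb y1 @ Rc (Suc y2) @ ?D)"
    by (simp add: replicate_app_Cons_same)
  with S1 S2 show ?thesis unfolding E_rel_def by blast
qed

section \<open>Naturality with respect to the combinatorial R\<close>

lemma fw_pair:
  assumes "i \<in> {0, 1, 2}" "okw [(l, c), (l', b)]"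
  shows "fw i [(l, c), (l', b)] =
    map_option (\<lambda>(c, b). [(l, c), (l', b)]) (f_op (D43 l \<otimes> D43 l') i (c, b))"
proof -
  have "fw i [(l', b)] = map_option (\<lambda>y. [y]) (lf i (l', b))"
    using lf_None[OF assms(1), of "(l', b)"] assms(2) by auto
  then show ?thesis
    by (simp add: tensor_def lf_def lphi_def leps_def option.map_comp o_def)
qed

lemma ew_pair:
  assumes "i \<in> {0, 1, 2}"
  shows "ew i [(l, c), (l', b)] =
    map_option (\<lambda>(c, b). [(l, c), (l', b)]) (e_op (D43 l \<otimes> D43 l') i (c, b))"
  by (simp add: tensor_def le_def lphi_def leps_def option.map_comp o_def)

context
  fixes r :: nat and R :: "elt \<times> elt \<Rightarrow> elt \<times> elt"
begin

definition pairR :: "letter list \<Rightarrow> letter list \<Rightarrow> bool" where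
  "pairR P P' \<longleftrightarrow> (\<exists>c b b' c'. P = [(r, c), (1, b)] \<and> P' = [(1, b'), (r, c')] \<and> R (c, b) = (b', c'))"

definition swap :: "nat \<Rightarrow> letter list \<Rightarrow> letter list \<Rightarrow> bool" where
  "swap k w w' \<longleftrightarrow> (\<exists>x P P' y. length x = k \<and> w = x @ P @ y \<and> w' = x @ P' @ y \<and> pairR P P')"

lemma swap_fun:
  assumes "swap k w v" "swap k w v'"
  shows "v = v'"
proof -
  obtain x P P' y where 1: "length x = k" "w = x @ P @ y" "v = x @ P' @ y" "pairR P P'"
    using assms(1) unfolding swap_def by blast
  obtain x2 P2 P2' y2 where 2: "length x2 = k" "w = x2 @ P2 @ y2" "v' = x2 @ P2' @ y2" "pairR P2 P2'"
    using assms(2) unfolding swap_def by blast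
  have "x = x2" "P @ y = P2 @ y2" using 1(1,2) 2(1,2) by (metis append_eq_append_conv)+
  moreover have "length P = length P2" using 1(4) 2(4) by (auto simp: pairR_def)
  ultimately have "P = P2" "y = y2" by (metis append_eq_append_conv)+
  moreover have "P' = P2'" using 1(4) 2(4) \<open>P = P2\<close> by (auto simp: pairR_def)
  ultimately show ?thesis using 1(3) 2(3) \<open>x = x2\<close> by simp
qed

text \<open>\<open>okw v\<close> is part of the conclusion so that natural relations
  compose.\<close>

definition natural :: "(letter list \<Rightarrow> letter list \<Rightarrow> bool) \<Rightarrow> bool" where
  "natural Q \<longleftrightarrow> (\<forall>k w w' v. okw w \<longrightarrow> swap k w w' \<longrightarrow> Q w v \<longrightarrow> okw v \<and> (\<exists>v'. Q w' v' \<and> swap k v v'))"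

lemma natural_comp: "natural Q \<Longrightarrow> natural Q' \<Longrightarrow> natural (Q OO Q')"
  unfolding natural_def relcompp_apply by meson

fun swaps :: "nat list \<Rightarrow> letter list \<Rightarrow> letter list \<Rightarrow> bool" where
  "swaps [] w w' \<longleftrightarrow> w = w'"
| "swaps (k # ks) w w' \<longleftrightarrow> (\<exists>v. swap k w v \<and> swaps ks v w')"

lemma swaps_append: "swaps (ks @ js) w w' \<longleftrightarrow> (\<exists>v. swaps ks w v \<and> swaps js v w')"
  by (induction ks arbitrary: w) auto

lemma swaps_fun: "swaps ks w v \<Longrightarrow> swaps ks w v' \<Longrightarrow> v = v'"
proof (induction ks arbitrary: w)
  case (Cons k ks)
  then show ?case using swap_fun by (metis swaps.simps(2))
qed simp

end

context
  fixes r :: nat and R :: "elt \<times> elt \<Rightarrow> elt \<times> elt"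
  assumes iso: "crystal_iso (D43 r \<otimes> D43 1) (D43 1 \<otimes> D43 r) R"
begin

lemma pairR_props:
  assumes P: "pairR r R P P'" "okw P"
  shows "okw P'"
    "i \<in> {0, 1, 2} \<Longrightarrow> fw i P = None \<Longrightarrow> fw i P' = None"
    "i \<in> {0, 1, 2} \<Longrightarrow> fw i P = Some Q \<Longrightarrow> \<exists>Q'. fw i P' = Some Q' \<and> pairR r R Q Q'"
    "i \<in> {0, 1, 2} \<Longrightarrow> ew i P = None \<Longrightarrow> ew i P' = None"
    "i \<in> {0, 1, 2} \<Longrightarrow> ew i P = Some Q \<Longrightarrow> \<exists>Q'. ew i P' = Some Q' \<and> pairR r R Q Q'"
proof -
  obtain c b b' c' where p: "P = [(r, c), (1, b)]" "P' = [(1, b'), (r, c')]" "R (c, b) = (b', c')"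
    using P(1) unfolding pairR_def by blast
  have el: "(c, b) \<in> elements (D43 r \<otimes> D43 1)"
    using P(2) p by (simp add: tensor_def D43_simps ok_def)
  have "(b', c') \<in> elements (D43 1 \<otimes> D43 r)"
    using iso el p(3) unfolding crystal_iso_def bij_betw_def by (metis imageI)
  then show ok': "okw P'" using p by (simp add: tensor_def D43_simps ok_def)
  have ind: "indices (D43 r \<otimes> D43 1) = {0, 1, 2}" by (simp add: tensor_def D43_def)
  have R: "e_op (D43 1 \<otimes> D43 r) i (b', c') = map_option R (e_op (D43 r \<otimes> D43 1) i (c, b))"
    "f_op (D43 1 \<otimes> D43 r) i (b', c') = map_option R (f_op (D43 r \<otimes> D43 1) i (c, b))"
    if "i \<in> {0, 1, 2}" for i
    using iso el that p(3) unfolding crystal_iso_def ind by metis+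
  have *: "pairR r R [(r, c1), (1, b1)] ((\<lambda>(b, c). [(1, b), (r, c)]) (R (c1, b1)))" for c1 b1
    by (auto simp: pairR_def split: prod.split)
  assume i: "i \<in> {0, 1, 2}"
  note f = fw_pair[OF i P(2)[unfolded p]] fw_pair[OF i ok'[unfolded p]]
    ew_pair[OF i, of r c 1 b] ew_pair[OF i, of 1 b' r c']
  show "fw i P = None \<Longrightarrow> fw i P' = None" unfolding p f R[OF i] by simp
  show "ew i P = None \<Longrightarrow> ew i P' = None" unfolding p f R[OF i] by simp
  show "fw i P = Some Q \<Longrightarrow> \<exists>Q'. fw i P' = Some Q' \<and> pairR r R Q Q'"
    unfolding p f R[OF i] using * by (auto simp: option.map_comp)
  show "ew i P = Some Q \<Longrightarrow> \<exists>Q'. ew i P' = Some Q' \<and> pairR r R Q Q'"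
    unfolding p f R[OF i] using * by (auto simp: option.map_comp)
qed

text \<open>\<open>R\<close> maps the f_i-string of a pair step by step onto that of its image, so
  both strings have the same length.\<close>

lemma pairR_phiw:
  assumes i: "i \<in> {0, 1, 2}" and "pairR r R P P'" "okw P"
  shows "phiw i P' = phiw i P"
  using assms(2,3)
proof (induction "phiw i P" arbitrary: P P')
  case 0
  then show ?case using pairR_props(1,2)[OF 0(2,3)] i fw_None[OF i] by metis
next
  case (Suc n)
  then obtain Q where Q: "fw i P = Some Q" using fw_None[OF i, of P] by (cases "fw i P") auto
  obtain Q' where Q': "fw i P' = Some Q'" "pairR r R Q Q'" using pairR_props(3)[OF Suc(3,4) i Q] by blast
  note s = fw_Some[OF i Suc(4) Q] fw_Some[OF i pairR_props(1)[OF Suc(3,4)] Q'(1)]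
  then show ?case using Suc(1)[OF _ Q'(2)] Suc(2) by simp
qed

lemma pairR_epsw:
  assumes i: "i \<in> {0, 1, 2}" and "pairR r R P P'" "okw P"
  shows "epsw i P' = epsw i P"
  using assms(2,3)
proof (induction "epsw i P" arbitrary: P P')
  case 0
  then show ?case using pairR_props(1,4)[OF 0(2,3)] i ew_None[OF i] by metis
next
  case (Suc n)
  then obtain Q where Q: "ew i P = Some Q" using ew_None[OF i, of P] by (cases "ew i P") auto
  obtain Q' where Q': "ew i P' = Some Q'" "pairR r R Q Q'" using pairR_props(5)[OF Suc(3,4) i Q] by blast
  note s = ew_Some[OF i Suc(4) Q] ew_Some[OF i pairR_props(1)[OF Suc(3,4)] Q'(1)]
  then show ?case using Suc(1)[OF _ Q'(2)] Suc(2) by simp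
qed

text \<open>An operator changes exactly one of x, P and y. The choice depends on P only through eps
  and phi, which \<open>R\<close> preserves, so the operator acts at the same place after the
  swap.\<close>

lemma swap_props:
  assumes w: "swap r R k w w'" "okw w"
  shows "okw w'"
    "i \<in> {0, 1, 2} \<Longrightarrow> phiw i w' = phiw i w"
    "i \<in> {0, 1, 2} \<Longrightarrow> epsw i w' = epsw i w"
    "i \<in> {0, 1, 2} \<Longrightarrow> fw i w = Some v \<Longrightarrow> \<exists>v'. fw i w' = Some v' \<and> swap r R k v v'"
    "i \<in> {0, 1, 2} \<Longrightarrow> ew i w = Some v \<Longrightarrow> \<exists>v'. ew i w' = Some v' \<and> swap r R k v v'"
proof -
  obtain x P P' y where p: "length x = k" "w = x @ P @ y" "w' = x @ P' @ y" "pairR r R P P'"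
    using w(1) unfolding swap_def by blast
  have ok: "okw x" "okw P" "okw y" using w(2) p by auto
  note P = pairR_props[OF p(4) ok(2)]
  show "okw w'" using ok P(1) p by simp
  assume i: "i \<in> {0, 1, 2}"
  note e = pairR_phiw[OF i p(4) ok(2)] pairR_epsw[OF i p(4) ok(2)]
  show "phiw i w' = phiw i w" "epsw i w' = epsw i w"
    unfolding p by (simp_all add: phiw_append epsw_append e)
  have mid: "swap r R k (x @ P @ z) (x @ P' @ z)" for z
    unfolding swap_def using p by blast
  have okPy: "okw (P @ y)" "okw (P' @ y)" using ok P(1) by auto
  have eq: "epsw i (P' @ y) = epsw i (P @ y)" by (simp add: epsw_append e)
  show "\<exists>v'. fw i w' = Some v' \<and> swap r R k v v'" if v: "fw i w = Some v"
  proof (cases "epsw i (P @ y) < phiw i x")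
    case True
    then have "map_option (\<lambda>x'. x' @ P @ y) (fw i x) = Some v"
      using v by (simp add: p(2) fw_append[of i x])
    then obtain x' where x': "fw i x = Some x'" "v = x' @ P @ y" by blast
    have "length x' = k" using fw_Some[OF i ok(1) x'(1)] p(1) by (metis length_map)
    then have "swap r R k v (x' @ P' @ y)" unfolding swap_def x' using p(4) by blast
    moreover have "fw i w' = Some (x' @ P' @ y)"
      using True x'(1) by (simp add: p(3) fw_append[of i x] eq)
    ultimately show ?thesis by blast
  next
    case F1: False
    then have "map_option ((@) x) (fw i (P @ y)) = Some v"
      using v by (simp add: p(2) fw_append[of i x])
    then obtain v1 where v1: "fw i (P @ y) = Some v1" "v = x @ v1" by blast
    show ?thesis
    proof (cases "epsw i y < phiw i P")
      case True
      then have "map_option (\<lambda>x'. x' @ y) (fw i P) = Some v1"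
        using v1(1) by (simp add: fw_append[of i P])
      then obtain Q where Q: "fw i P = Some Q" "v1 = Q @ y" by blast
      obtain Q' where Q': "fw i P' = Some Q'" "pairR r R Q Q'" using P(3)[OF i Q(1)] by blast
      then have "swap r R k v (x @ Q' @ y)" unfolding swap_def v1 Q using p(1) by blast
      moreover have "fw i w' = Some (x @ Q' @ y)"
        using True F1 Q'(1) by (simp add: p(3) fw_append[of i x] fw_append[of i P'] eq e)
      ultimately show ?thesis by blast
    next
      case False
      then have "map_option ((@) P) (fw i y) = Some v1"
        using v1(1) by (simp add: fw_append[of i P])
      then obtain z where z: "fw i y = Some z" "v1 = P @ z" by blast
      have "fw i w' = Some (x @ P' @ z)"
        using False F1 z(1) by (simp add: p(3) fw_append[of i x] fw_append[of i P'] eq e)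
      then show ?thesis using mid[of z] unfolding v1 z by blast
    qed
  qed
  show "\<exists>v'. ew i w' = Some v' \<and> swap r R k v v'" if v: "ew i w = Some v"
  proof (cases "epsw i (P @ y) \<le> phiw i x")
    case True
    then have "map_option (\<lambda>x'. x' @ P @ y) (ew i x) = Some v"
      using v by (simp add: p(2) ew_append[OF i okPy(1)])
    then obtain x' where x': "ew i x = Some x'" "v = x' @ P @ y" by blast
    have "length x' = k" using ew_Some[OF i ok(1) x'(1)] p(1) by (metis length_map)
    then have "swap r R k v (x' @ P' @ y)" unfolding swap_def x' using p(4) by blast
    moreover have "ew i w' = Some (x' @ P' @ y)"
      using True x'(1) by (simp add: p(3) ew_append[OF i okPy(2)] eq)
    ultimately show ?thesis by blast
  next
    case F1: False
    then have "map_option ((@) x) (ew i (P @ y)) = Some v"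
      using v by (simp add: p(2) ew_append[OF i okPy(1)])
    then obtain v1 where v1: "ew i (P @ y) = Some v1" "v = x @ v1" by blast
    show ?thesis
    proof (cases "epsw i y \<le> phiw i P")
      case True
      then have "map_option (\<lambda>x'. x' @ y) (ew i P) = Some v1"
        using v1(1) by (simp add: ew_append[OF i ok(3)])
      then obtain Q where Q: "ew i P = Some Q" "v1 = Q @ y" by blast
      obtain Q' where Q': "ew i P' = Some Q'" "pairR r R Q Q'" using P(5)[OF i Q(1)] by blast
      then have "swap r R k v (x @ Q' @ y)" unfolding swap_def v1 Q using p(1) by blast
      moreover have "ew i w' = Some (x @ Q' @ y)"
        using True F1 Q'(1) by (simp add: p(3) ew_append[OF i okPy(2)] ew_append[OF i ok(3)] eq e)
      ultimately show ?thesis by blast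
    next
      case False
      then have "map_option ((@) P) (ew i y) = Some v1"
        using v1(1) by (simp add: ew_append[OF i ok(3)])
      then obtain z where z: "ew i y = Some z" "v1 = P @ z" by blast
      have "ew i w' = Some (x @ P' @ z)"
        using False F1 z(1) by (simp add: p(3) ew_append[OF i okPy(2)] ew_append[OF i ok(3)] eq e)
      then show ?thesis using mid[of z] unfolding v1 z by blast
    qed
  qed
qed

lemma swap_iter_fw:
  assumes "i \<in> {0, 1, 2}" "swap r R k w w'" "okw w" "iter (fw i) n w = Some v"
  shows "\<exists>v'. iter (fw i) n w' = Some v' \<and> swap r R k v v'"
  using assms(2-)
proof (induction n arbitrary: w w')
  case (Suc n)
  then obtain w1 where w1: "fw i w = Some w1" "iter (fw i) n w1 = Some v"
    by (auto simp: iter_Suc split: option.splits)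
  obtain w1' where w1': "fw i w' = Some w1'" "swap r R k w1 w1'"
    using swap_props(4)[OF Suc.prems(1,2) assms(1) w1(1)] by blast
  have "okw w1" using fw_Some[OF assms(1) Suc.prems(2) w1(1)] by blast
  from Suc.IH[OF w1'(2) this w1(2)] w1'(1) show ?case by (simp add: iter_Suc)
qed auto

lemma swap_iter_ew:
  assumes "i \<in> {0, 1, 2}" "swap r R k w w'" "okw w" "iter (ew i) n w = Some v"
  shows "\<exists>v'. iter (ew i) n w' = Some v' \<and> swap r R k v v'"
  using assms(2-)
proof (induction n arbitrary: w w')
  case (Suc n)
  then obtain w1 where w1: "ew i w = Some w1" "iter (ew i) n w1 = Some v"
    by (auto simp: iter_Suc split: option.splits)
  obtain w1' where w1': "ew i w' = Some w1'" "swap r R k w1 w1'"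
    using swap_props(5)[OF Suc.prems(1,2) assms(1) w1(1)] by blast
  have "okw w1" using ew_Some[OF assms(1) Suc.prems(2) w1(1)] by blast
  from Suc.IH[OF w1'(2) this w1(2)] w1'(1) show ?case by (simp add: iter_Suc)
qed auto

lemma natural_fw: "i \<in> {0, 1, 2} \<Longrightarrow> natural r R (\<lambda>w v. fw i w = Some v)"
  unfolding natural_def by (meson swap_props(4) fw_Some)
lemma natural_ew: "i \<in> {0, 1, 2} \<Longrightarrow> natural r R (\<lambda>w v. ew i w = Some v)"
  unfolding natural_def by (meson swap_props(5) ew_Some)
lemma natural_fpass:
  assumes i: "i \<in> {0, 1, 2}"
  shows "natural r R (\<lambda>w v. fpass i w v m)"
  unfolding natural_def
proof (intro allI impI)
  fix k w w' v assume w: "okw w" "swap r R k w w'" "fpass i w v m"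
  then have v: "iter (fw i) (phiw i w) w = Some v" "epsw i w = m" by (simp_all add: fpass_def)
  obtain v' where v': "iter (fw i) (phiw i w) w' = Some v'" "swap r R k v v'"
    using swap_iter_fw[OF i w(2,1) v(1)] by blast
  have "fpass i w' v' m"
    using v(2) v'(1) swap_props(1)[OF w(2,1)] swap_props(2,3)[OF w(2,1) i] by (simp add: fpass_def)
  then show "okw v \<and> (\<exists>v'. fpass i w' v' m \<and> swap r R k v v')"
    using v'(2) iter_fw_Some[OF i w(1) v(1)] by blast
qed

lemma natural_epass:
  assumes i: "i \<in> {0, 1, 2}"
  shows "natural r R (\<lambda>w v. epass i w v m)"
  unfolding natural_def
proof (intro allI impI)
  fix k w w' v assume w: "okw w" "swap r R k w w'" "epass i w v m"
  then have v: "iter (ew i) (epsw i w) w = Some v" "phiw i w = m" by (simp_all add: epass_def)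
  obtain v' where v': "iter (ew i) (epsw i w) w' = Some v'" "swap r R k v v'"
    using swap_iter_ew[OF i w(2,1) v(1)] by blast
  have "epass i w' v' m"
    using v(2) v'(1) swap_props(1)[OF w(2,1)] swap_props(2,3)[OF w(2,1) i] by (simp add: epass_def)
  then show "okw v \<and> (\<exists>v'. epass i w' v' m \<and> swap r R k v v')"
    using v'(2) iter_ew_Some[OF i w(1) v(1)] by blast
qed

text \<open>The inverse of \<open>S_rel\<close> is natural because each of its four passes, read
  backwards, is a pass with the opposite operator.\<close>

lemma natural_E_rel: "natural r R E_rel"
proof -
  have inv: "(\<lambda>q w. fpass i w q 0) = (\<lambda>q w. epass i q w 0)" "(\<lambda>q w. epass i w q 0) = (\<lambda>q w. fpass i q w 0)"
    if "i \<in> {0, 1, 2}" for i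
    using that fpass_inverse epass_inverse by (auto intro!: ext)
  have S: "S_rel = (\<lambda>w v. fpass (Suc 0) w v 0) OO (\<lambda>w v. fpass 2 w v 0) OO (\<lambda>w v. epass 0 w v 0) OO
    (\<lambda>w v. fpass (Suc 0) w v 0)"
    unfolding S_rel_def relcompp_apply by (intro ext) blast
  have "(\<lambda>q w. S_rel w q) = (\<lambda>q w. fpass (Suc 0) w q 0) OO (\<lambda>q w. epass 0 w q 0) OO (\<lambda>q w. fpass 2 w q 0) OO
    (\<lambda>q w. fpass (Suc 0) w q 0)"
    unfolding S_rel_def relcompp_apply by (intro ext) blast
  then have S': "(\<lambda>q w. S_rel w q) = (\<lambda>q w. epass (Suc 0) q w 0) OO (\<lambda>q w. fpass 0 q w 0) OO (\<lambda>q w. epass 2 q w 0) OO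
    (\<lambda>q w. epass (Suc 0) q w 0)"
    by (simp add: inv)
  have E: "E_rel = S_rel OO (\<lambda>w v. ew 2 w = Some v) OO (\<lambda>q w. S_rel w q)"
    unfolding E_rel_def relcompp_apply by (intro ext) blast
  have "natural r R S_rel" unfolding S by (intro natural_comp natural_fpass natural_epass) auto
  moreover have "natural r R (\<lambda>q w. S_rel w q)"
    unfolding S' by (intro natural_comp natural_fpass natural_epass) auto
  ultimately show ?thesis unfolding E by (intro natural_comp natural_ew) auto
qed

text \<open>Naturality delivers some image of z at the end of the sequence; uniqueness identifies it
  with z'.\<close>

lemma swaps_natural:
  assumes Q: "natural r R Q" and uniq: "\<And>w v v'. Q w v \<Longrightarrow> Q w v' \<Longrightarrow> v = v'"
    and "swaps r R ks w z" "okw w" "Q w w'" "Q z z'"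
  shows "swaps r R ks w' z'"
  using assms(3-)
proof (induction ks arbitrary: w w')
  case Nil
  then show ?case using uniq by auto
next
  case (Cons k ks)
  then obtain v where v: "swap r R k w v" "swaps r R ks v z" by auto
  obtain v' where v': "Q v v'" "swap r R k w' v'"
    using Q v(1) Cons.prems unfolding natural_def by blast
  have "swaps r R ks v' z'"
    using Cons.IH[OF v(2) _ v'(1) Cons.prems(4)] swap_props(1)[OF v(1) Cons.prems(2)] by blast
  with v' show ?case by auto
qed

end

section \<open>Time evolution as a sequence of swaps\<close>

abbreviation word :: "elt list \<Rightarrow> letter list" where
  "word p \<equiv> map (Pair (Suc 0)) p"

text \<open>The positions of the swaps that move \<open>t\<close> carriers, initially at the left end, through a path
  of length \<open>L\<close>; the rightmost carrier moves first.\<close>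

fun sweep :: "nat \<Rightarrow> nat \<Rightarrow> nat list" where
  "sweep 0 L = []"
| "sweep (Suc t) L = [t..<t + L] @ sweep t L"

lemma swaps_carry:
  assumes "carry R c p = (p', c')" "length x = k"
  shows "swaps r R [k..<k + length p] (x @ (r, c) # word p @ y) (x @ word p' @ (r, c') # y)"
  using assms
proof (induction p arbitrary: c p' x k)
  case (Cons b p)
  obtain b1 c1 where R: "R (c, b) = (b1, c1)" by (metis surj_pair)
  obtain p1 where p1: "carry R c1 p = (p1, c')" "p' = b1 # p1"
    using Cons.prems(1) R by (auto split: prod.splits)
  have "swap r R k (x @ (r, c) # word (b # p) @ y) ((x @ [(Suc 0, b1)]) @ (r, c1) # word p @ y)"
  proof -
    have "pairR r R [(r, c), (1, b)] [(1, b1), (r, c1)]" using R by (simp add: pairR_def)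
    then show ?thesis unfolding swap_def using Cons.prems(2)
      by (intro exI[of _ x] exI[of _ "[(r, c), (1, b)]"] exI[of _ "[(1, b1), (r, c1)]"]
          exI[of _ "word p @ y"]) simp
  qed
  moreover have "swaps r R [Suc k..<Suc k + length p] ((x @ [(Suc 0, b1)]) @ (r, c1) # word p @ y)
      ((x @ [(Suc 0, b1)]) @ word p1 @ (r, c') # y)"
    by (rule Cons.IH[OF p1(1)]) (use Cons.prems in simp)
  moreover have "[k..<k + length (b # p)] = k # [Suc k..<Suc k + length p]"
    by (simp add: upt_rec)
  ultimately show ?case using p1(2) by auto
qed auto

lemma carry_length: "carry R c p = (p', c') \<Longrightarrow> length p' = length p"
  by (induction p arbitrary: c p' c') (auto simp: Let_def split: prod.splits)

text \<open>The run of swaps exists without any assumption on the outgoing carriers. A carrier that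
  has left the path is never touched again, so the final word records how each time step
  ended.\<close>

lemma swaps_sweep:
  "\<exists>q cs. swaps r R (sweep t (length p)) (replicate t (r, u r) @ word p @ y) (word q @ map (Pair r) cs @ y)
    \<and> length cs = t \<and> length q = length p \<and> (cs = replicate t (u r) \<longrightarrow> (evolves R r ^^ t) p q)"
proof (induction t arbitrary: p y)
  case (Suc t)
  obtain p1 c1 where c: "carry R (u r) p = (p1, c1)" by (metis surj_pair)
  have len: "length p1 = length p" using carry_length[OF c] .
  have 1: "swaps r R [t..<t + length p] (replicate t (r, u r) @ (r, u r) # word p @ y)
      (replicate t (r, u r) @ word p1 @ (r, c1) # y)"
    by (rule swaps_carry[OF c]) simp
  obtain q cs where q: "swaps r R (sweep t (length p1)) (replicate t (r, u r) @ word p1 @ (r, c1) # y)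
      (word q @ map (Pair r) cs @ (r, c1) # y)"
    "length cs = t" "length q = length p1" "cs = replicate t (u r) \<longrightarrow> (evolves R r ^^ t) p1 q"
    using Suc.IH[of p1 "(r, c1) # y"] by blast
  have "swaps r R (sweep (Suc t) (length p)) (replicate (Suc t) (r, u r) @ word p @ y)
      (word q @ map (Pair r) (cs @ [c1]) @ y)"
    using 1 q(1) len by (auto simp: swaps_append replicate_app_Cons_same)
  moreover have "(evolves R r ^^ Suc t) p q" if "cs @ [c1] = replicate (Suc t) (u r)"
  proof -
    have "cs = replicate t (u r)" "c1 = u r"
      using that q(2) by (simp_all flip: replicate_append_same)
    then have "(evolves R r ^^ t) p1 q" "evolves R r p p1" using q(4) c by (auto simp: evolves_def)
    then show ?thesis by (rule relpowp_Suc_I2[rotated])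
  qed
  ultimately show ?case using q(2,3) len
    by (intro exI[of _ q] exI[of _ "cs @ [c1]"]) simp
qed simp

lemma evolves_imp_swaps:
  "(evolves R r ^^ t) p q \<Longrightarrow>
    swaps r R (sweep t (length p)) (replicate t (r, u r) @ word p @ y) (word q @ replicate t (r, u r) @ y)
    \<and> length q = length p"
proof (induction t arbitrary: p y)
  case (Suc t)
  obtain p1 where p1: "evolves R r p p1" "(evolves R r ^^ t) p1 q"
    using relpowp_Suc_D2[OF Suc.prems] by blast
  have c: "carry R (u r) p = (p1, u r)" using p1(1) by (simp add: evolves_def)
  have len: "length p1 = length p" using carry_length[OF c] .
  have "swaps r R [t..<t + length p] (replicate t (r, u r) @ (r, u r) # word p @ y)
      (replicate t (r, u r) @ word p1 @ (r, u r) # y)"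
    by (rule swaps_carry[OF c]) simp
  then show ?case using Suc.IH[OF p1(2), of "(r, u r) # y"] len
    by (auto simp: swaps_append replicate_app_Cons_same)
qed simp

lemma swaps_imp_evolves:
  assumes "swaps r R (sweep t (length p)) (replicate t (r, u r) @ word p) (word q @ replicate t (r, u r))"
    "length q = length p"
  shows "(evolves R r ^^ t) p q"
proof -
  obtain q' cs where q': "swaps r R (sweep t (length p)) (replicate t (r, u r) @ word p @ []) (word q' @ map (Pair r) cs @ [])"
    "length cs = t" "length q' = length p" "cs = replicate t (u r) \<longrightarrow> (evolves R r ^^ t) p q'"
    using swaps_sweep[of r R t p "[]"] by blast
  have "word q @ replicate t (r, u r) = word q' @ map (Pair r) cs"
    using swaps_fun[OF assms(1)] q'(1) by simp
  then have "word q = word q'" "map (Pair r) (replicate t (u r)) = map (Pair r) cs"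
    using assms(2) q'(2,3) by simp_all
  moreover have "inj (Pair n :: elt \<Rightarrow> letter)" for n by (auto simp: inj_def)
  ultimately have "q = q'" "replicate t (u r) = cs" by (metis inj_map_eq_map)+
  with q'(4) show ?thesis by blast
qed

text \<open>The carriers must come out of Q unchanged, on the left before and on the right after the
  evolution. This is where triviality of Q on the vacuum enters; determinism of swaps then turns the
  transported run back into an evolution.\<close>

lemma evolves_natural:
  assumes iso: "crystal_iso (D43 r \<otimes> D43 1) (D43 1 \<otimes> D43 r) R"
    and Q: "natural r R Q" "\<And>w v v'. Q w v \<Longrightarrow> Q w v' \<Longrightarrow> v = v'"
    and ev: "(evolves R r ^^ t) p q" and ok: "okw (word p)"
    and p: "Q (replicate t (r, u r) @ word p) (replicate t (r, u r) @ word p')"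
    and q: "Q (word q @ replicate t (r, u r)) (word q' @ replicate t (r, u r))"
    and len: "length p' = length p" "length q' = length p"
  shows "(evolves R r ^^ t) p' q'"
proof -
  have "okw (replicate t (r, u r))" using X_ok(1)[of r] by (auto simp: X1_def u_def)
  then have "swaps r R (sweep t (length p)) (replicate t (r, u r) @ word p') (word q' @ replicate t (r, u r))"
    using swaps_natural[OF iso Q _ _ p q] evolves_imp_swaps[OF ev, of "[]"] ok by simp
  then show ?thesis using swaps_imp_evolves[of r R t p' q'] len by simp
qed

section \<open>Carriers that contain only the letters 1 and 2\<close>

text \<open>The bound 1 is what a highest weight factor from B_1 standing in front can
  match.\<close>

lemma highest_weight:
  assumes "c \<in> B_set l" "eps2 c = 0" "eps1 c \<le> 1"
  obtains x1 x2 x3 y1 where "c = (x1, x2, x3, x3, 0, y1)" "0 \<le> x1" "0 \<le> x2" "0 \<le> x3" "0 \<le> y1"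
    "x1 + x2 + x3 + y1 \<le> int l" "eps1 c = y1 + x3 + pos (x2 - x3)" "phi1 c = x1 + pos (x3 - x2)" "phi2 c = x2"
proof -
  obtain x1 x2 x3 m y2 y1 where c: "c = (x1, x2, x3, x3 + 2 * m, y2, y1)"
    and b: "0 \<le> x1" "0 \<le> x2" "0 \<le> x3" "0 \<le> x3 + 2 * m" "0 \<le> y2" "0 \<le> y1"
    "x1 + x2 + x3 + m + y2 + y1 \<le> int l" by (rule B_cases[OF assms(1)])
  have "pos (- (2 * m)) div 2 \<ge> 0" by simp
  moreover have "y2 + pos (- (2 * m)) div 2 = 0" using assms(2) unfolding c by simp
  ultimately have y2: "y2 = 0" "pos (- (2 * m)) div 2 = 0" using b by linarith+
  then have m: "0 \<le> m" by (cases "0 \<le> m") auto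
  have "y1 + pos (x3 + 2 * m + pos (x2 - x3)) \<le> 1" using assms(3) unfolding c y2 by simp
  then have "x3 + 2 * m \<le> 1" using b by linarith
  then have "m = 0" using m b by linarith
  with y2 c b show thesis using that[of x1 x2 x3 y1] by auto
qed

text \<open>The box-ball carrier of capacity r holding j balls, the twos being balls and the ones
  empty boxes.\<close>

definition K :: "nat \<Rightarrow> nat \<Rightarrow> elt" where
  "K r j = (int r - int j, int j, 0, 0, 0, 0)"

context
  fixes r :: nat and R :: "elt \<times> elt \<Rightarrow> elt \<times> elt"
  assumes iso: "crystal_iso (D43 r \<otimes> D43 1) (D43 1 \<otimes> D43 r) R"
begin

lemma K_ok: "j \<le> r \<Longrightarrow> ok (r, K r j)"
  by (auto simp: K_def ok_def B_set_def)

lemma K_vals: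
  assumes "j \<le> r"
  shows "lphi (Suc 0) (r, K r j) = r - j" "leps (Suc 0) (r, K r j) = j"
    "lphi 2 (r, K r j) = j" "leps 2 (r, K r j) = 0"
  using K_ok[OF assms] assms by (auto simp: K_def lphi_leps_eq)

lemma lf_K: "j < r \<Longrightarrow> lf (Suc 0) (r, K r j) = Some (r, K r (Suc j))"
  by (auto simp: K_def lf_def D43_simps into_B_def B_set_def)

text \<open>Since the isomorphism preserves $\varepsilon_i$ and $\varphi_i$, highest weight elements for
  \<open>i = 1, 2\<close> go to such elements of the same weight, of which there are very few.\<close>

lemma R_highest:
  assumes "okw [(r, c), (1, b)]" "R (c, b) = (b', c')"
    "epsw (Suc 0) [(r, c), (1, b)] = 0" "epsw 2 [(r, c), (1, b)] = 0"
  obtains x x1 x2 x3 y1 where "b' = (x, 0, 0, 0, 0, 0)" "0 \<le> x" "x \<le> 1"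
    "c' = (x1, x2, x3, x3, 0, y1)" "0 \<le> x1" "0 \<le> x2" "0 \<le> x3" "0 \<le> y1" "x1 + x2 + x3 + y1 \<le> int r"
    "y1 + x3 + pos (x2 - x3) \<le> x"
    "int (phiw (Suc 0) [(r, c), (1, b)]) = x1 + pos (x3 - x2) + x - (y1 + x3 + pos (x2 - x3))"
    "int (phiw 2 [(r, c), (1, b)]) = x2"
proof -
  have P: "pairR r R [(r, c), (1, b)] [(1, b'), (r, c')]" using assms(2) by (simp add: pairR_def)
  have "okw [(1, b'), (r, c')]" by (rule pairR_props(1)[OF iso P assms(1)])
  then have ok: "ok (1, b')" "ok (r, c')" by auto
  have e: "epsw i [(1, b'), (r, c')] = epsw i [(r, c), (1, b)]" "phiw i [(1, b'), (r, c')] = phiw i [(r, c), (1, b)]"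
    if "i \<in> {0, 1, 2}" for i
    using pairR_epsw[OF iso that P assms(1)] pairR_phiw[OF iso that P assms(1)] by auto
  have e1: "leps (Suc 0) (1, b') = 0" "leps (Suc 0) (r, c') \<le> lphi (Suc 0) (1, b')"
    using e(1)[of "Suc 0"] assms(3) by simp_all
  have e2: "leps 2 (1, b') = 0" "leps 2 (r, c') \<le> lphi 2 (1, b')"
    using e(1)[of 2] assms(4) by simp_all
  note v = lphi_leps_eq[OF ok(1)] lphi_leps_eq[OF ok(2)]
  have pos2: "0 \<le> eps2 z" "0 \<le> eps1 z" "0 \<le> phi1 z" "0 \<le> phi2 z" if "z \<in> B_set n" for z n
    by (rule B_cases[OF that], simp)+
  have B: "b' \<in> B_set 1" "c' \<in> B_set r" using ok by (auto simp: ok_def)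
  note b0 = pos2[OF B(1)] and c0 = pos2[OF B(2)]
  have "eps2 b' = 0" "eps1 b' = 0" using e1 e2 b0 unfolding v by auto
  with B(1) obtain x x2 x3 y1 where b': "b' = (x, x2, x3, x3, 0, y1)" "0 \<le> x" "0 \<le> x2" "0 \<le> x3" "0 \<le> y1"
    "x + x2 + x3 + y1 \<le> int 1" "eps1 b' = y1 + x3 + pos (x2 - x3)"
    by (auto elim!: highest_weight)
  have "y1 = 0" "x3 = 0" "x2 = 0" using b' \<open>eps1 b' = 0\<close> by linarith+
  then have b: "b' = (x, 0, 0, 0, 0, 0)" "0 \<le> x" "x \<le> 1" using b' by auto
  then have pb: "phi1 b' = x" "phi2 b' = 0" by auto
  have "eps2 c' = 0" "eps1 c' \<le> x" using e1 e2 c0 b unfolding v pb by auto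
  with B(2) b obtain x1 x2 x3 y1 where c': "c' = (x1, x2, x3, x3, 0, y1)" "0 \<le> x1" "0 \<le> x2" "0 \<le> x3" "0 \<le> y1"
    "x1 + x2 + x3 + y1 \<le> int r" "eps1 c' = y1 + x3 + pos (x2 - x3)" "phi1 c' = x1 + pos (x3 - x2)" "phi2 c' = x2"
    by (auto elim!: highest_weight)
  have "phiw (Suc 0) [(r, c), (1, b)] = lphi (Suc 0) (r, c') + (lphi (Suc 0) (1, b') - leps (Suc 0) (r, c'))"
    "phiw 2 [(r, c), (1, b)] = lphi 2 (r, c') + (lphi 2 (1, b') - leps 2 (r, c'))"
    using e(2)[of "Suc 0"] e(2)[of 2] by simp_all
  then have p1: "int (phiw (Suc 0) [(r, c), (1, b)]) = x1 + pos (x3 - x2) + x - (y1 + x3 + pos (x2 - x3))"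
    and p2: "int (phiw 2 [(r, c), (1, b)]) = x2"
    using c0 c' b of_nat_diff[of "nat (eps1 c')" "nat x", where ?'a = int] nat_mono[OF \<open>eps1 c' \<le> x\<close>]
    unfolding v pb by simp_all
  show thesis
    by (rule that[of x x1 x2 x3 y1]) (use b c' p1 p2 \<open>eps1 c' \<le> x\<close> in simp_all)
qed

lemma R_K0_1: "R (K r 0, letter1) = (letter1, K r 0)"
proof -
  obtain b' c' where R: "R (K r 0, letter1) = (b', c')" by (metis surj_pair)
  have l: "(Suc 0, letter1) = X1 (Suc 0)" by (simp add: X1_def)
  have ok: "okw [(r, K r 0), (1, letter1)]" using K_ok[of 0] by (simp add: l)
  have v: "epsw (Suc 0) [(r, K r 0), (1, letter1)] = 0" "epsw 2 [(r, K r 0), (1, letter1)] = 0"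
    "int (phiw (Suc 0) [(r, K r 0), (1, letter1)]) = int r + 1" "int (phiw 2 [(r, K r 0), (1, letter1)]) = 0"
    using K_vals[of 0] by (simp_all add: l)
  show ?thesis unfolding R
    by (rule R_highest[OF ok R v(1,2)], unfold v(3,4)) (auto simp: K_def)
qed

lemma R_K0_2: 
  assumes "2 \<le> r"
  shows "R (K r 0, letter2) = (letter1, K r 1)"
proof -
  obtain b' c' where R: "R (K r 0, letter2) = (b', c')" by (metis surj_pair)
  have l: "(Suc 0, letter2) = X2 (Suc 0)" by (simp add: X2_def)
  have ok: "okw [(r, K r 0), (1, letter2)]" using K_ok[of 0] by (simp add: l)
  have v: "epsw (Suc 0) [(r, K r 0), (1, letter2)] = 0" "epsw 2 [(r, K r 0), (1, letter2)] = 0"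
    "int (phiw (Suc 0) [(r, K r 0), (1, letter2)]) = int r - 1" "int (phiw 2 [(r, K r 0), (1, letter2)]) = 1"
    using K_vals[of 0] assms by (simp_all add: l)
  \<comment> \<open>The weight forces x2 = 1 and x1 = r - 1 and leaves x3 = 0 or x3 = 1; the latter
    would give size r + 1.\<close>
  show ?thesis unfolding R
    by (rule R_highest[OF ok R v(1,2)], unfold v(3,4)) (auto simp: K_def)
qed

lemma pairR_fw:
  assumes "pairR r R P P'" "okw P" "i \<in> {0, 1, 2}" "fw i P = Some Q" "fw i P' = Some Q'"
  shows "pairR r R Q Q'"
  using pairR_props(3)[OF iso assms(1,2,3,4)] assms(5) by auto

text \<open>f_1 is applied to both sides, starting from the value at \<open>K r 0\<close>. It fills
  the carrier on both sides, except that the first step on the right turns the letter 1 into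
  2.\<close>

lemma R_K_1: "j < r \<Longrightarrow> R (K r (Suc j), letter1) = (letter2, K r j)"
proof -
  have l: "(Suc 0, letter1) = X1 (Suc 0)" "(Suc 0, letter2) = X2 (Suc 0)" by (simp_all add: X1_def X2_def)
  have lf1: "lf (Suc 0) (X1 (Suc 0)) = Some (X2 (Suc 0))" using lf_letter_iter(1) by (simp add: iter_Some_1)
  have P: "pairR r R [(r, K r 0), (1, letter1)] [(1, letter1), (r, K r 0)]"
    using R_K0_1 by (simp add: pairR_def)
  have "pairR r R [(r, K r (Suc j)), (1, letter1)] [(1, letter2), (r, K r j)]" if "j < r"
    using that
  proof (induction j)
    case 0
    show ?case
      by (rule pairR_fw[OF P, of "Suc 0"])
        (use 0 K_ok[of 0] K_vals[of 0] lf_K[of 0] in \<open>auto simp: l lf1\<close>)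
  next
    case (Suc j)
    then have IH: "pairR r R [(r, K r (Suc j)), (1, letter1)] [(1, letter2), (r, K r j)]" by simp
    show ?case
      by (rule pairR_fw[OF IH, of "Suc 0"])
        (use Suc.prems K_ok[of "Suc j"] K_vals[of "Suc j"] K_vals[of j] lf_K[of j] lf_K[of "Suc j"] in \<open>auto simp: l\<close>)
  qed
  then show "j < r \<Longrightarrow> R (K r (Suc j), letter1) = (letter2, K r j)" by (auto simp: pairR_def)
qed

text \<open>The same along the f_1-string of \<open>K r 0\<close> and 2. That string ends at
  \<open>K r (r - 1)\<close>, so the full carrier is reached instead from its value on the letter
  1.\<close>

lemma R_K_2:
  assumes "2 \<le> r"
  shows "j < r \<Longrightarrow> R (K r j, letter2) = (letter1, K r (Suc j))" "R (K r r, letter2) = (letter2, K r r)"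
proof -
  have l: "(Suc 0, letter1) = X1 (Suc 0)" "(Suc 0, letter2) = X2 (Suc 0)" by (simp_all add: X1_def X2_def)
  have P: "pairR r R [(r, K r 0), (1, letter2)] [(1, letter1), (r, K r 1)]"
    using R_K0_2[OF assms] by (simp add: pairR_def)
  have "pairR r R [(r, K r j), (1, letter2)] [(1, letter1), (r, K r (Suc j))]" if "j < r"
    using that
  proof (induction j)
    case 0
    then show ?case using P by simp
  next
    case (Suc j)
    then have IH: "pairR r R [(r, K r j), (1, letter2)] [(1, letter1), (r, K r (Suc j))]" by simp
    show ?case
      by (rule pairR_fw[OF IH, of "Suc 0"])
        (use Suc.prems K_ok[of j] K_vals[of "Suc j"] K_vals[of j] lf_K[of j] lf_K[of "Suc j"] in \<open>auto simp: l\<close>)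
  qed
  then show "j < r \<Longrightarrow> R (K r j, letter2) = (letter1, K r (Suc j))" by (auto simp: pairR_def)
  have lf1: "lf (Suc 0) (X1 (Suc 0)) = Some (X2 (Suc 0))" using lf_letter_iter(1) by (simp add: iter_Some_1)
  obtain j where j: "r = Suc j" using assms by (cases r) auto
  have Q: "pairR r R [(r, K r r), (1, letter1)] [(1, letter2), (r, K r j)]"
    using R_K_1[of j] j by (simp add: pairR_def)
  have "pairR r R [(r, K r r), (1, letter2)] [(1, letter2), (r, K r r)]"
    by (rule pairR_fw[OF Q, of "Suc 0"])
      (use j K_ok[of r] K_vals[of r] K_vals[of j] lf_K[of j] in \<open>auto simp: l lf1\<close>)
  then show "R (K r r, letter2) = (letter2, K r r)" by (auto simp: pairR_def)
qed

end

section \<open>Box-ball dynamics of the twos\<close>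

lemma carry_append:
  "carry R c (p @ q) = (let (p', c') = carry R c p; (q', c'') = carry R c' q in (p' @ q', c''))"
  by (induction p arbitrary: c) (auto simp: Let_def split: prod.splits)

definition two :: "nat \<Rightarrow> nat \<Rightarrow> nat \<Rightarrow> nat \<Rightarrow> nat \<Rightarrow> elt list" where
  "two A a g b B = replicate A letter1 @ replicate a letter2 @ replicate g letter1 @
     replicate b letter2 @ replicate B letter1"

context
  fixes r :: nat and R :: "elt \<times> elt \<Rightarrow> elt \<times> elt"
  assumes iso: "crystal_iso (D43 r \<otimes> D43 1) (D43 1 \<otimes> D43 r) R" and r: "2 \<le> r"
begin

lemma carry_load:
  "j \<le> r \<Longrightarrow> carry R (K r j) (replicate n letter2) =
    (replicate (min n (r - j)) letter1 @ replicate (n - (r - j)) letter2, K r (min r (j + n)))"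
proof (induction n arbitrary: j)
  case (Suc n)
  show ?case
  proof (cases "j < r")
    case True
    then obtain k where k: "r - j = Suc k" "r - Suc j = k" by (metis Suc_diff_Suc)
    show ?thesis using Suc.IH[of "Suc j"] R_K_2(1)[OF iso r True] True k by simp
  next
    case False
    then have j: "j = r" using Suc.prems by simp
    show ?thesis using Suc.IH[of j] R_K_2(2)[OF iso r] unfolding j by simp
  qed
qed (simp add: min_def)

lemma carry_unload:
  "j \<le> r \<Longrightarrow> carry R (K r j) (replicate n letter1) =
    (replicate (min j n) letter2 @ replicate (n - j) letter1, K r (j - n))"
proof (induction n arbitrary: j)
  case (Suc n)
  show ?case
  proof (cases j)
    case 0
    then show ?thesis using Suc.IH[of 0] R_K0_1[OF iso] by simp
  next
    case (Suc k)
    then show ?thesis using Suc.IH[of k] R_K_1[OF iso, of k] \<open>j \<le> r\<close> by simp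
  qed
qed simp

text \<open>v is the load taken from the first block, x the part dropped in the gap and y the load
  taken from the second block. The rest falls right behind the second block, and the bound on B lets
  the carrier leave empty.\<close>

lemma evolves_two:
  assumes "v = min r a" "x = min v g" "y = min (r - (v - x)) b" "v - x + y \<le> B"
  shows "evolves R r (two A a g b B) (two (A + v) (a - v + x) (g - x + y) (b - y + (v - x + y)) (B - (v - x + y)))"
proof -
  have [simp]: "u r = K r 0" by (simp add: u_def K_def)
  have l1: "carry R (K r 0) (replicate A letter1) = (replicate A letter1, K r 0)"
    using carry_unload[of 0 A] by simp
  have l2: "carry R (K r 0) (replicate a letter2) = (replicate v letter1 @ replicate (a - v) letter2, K r v)"
    using carry_load[of 0 a] assms(1) by (auto simp: min_def)
  have l3: "carry R (K r v) (replicate g letter1) = (replicate x letter2 @ replicate (g - x) letter1, K r (v - x))"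
    using carry_unload[of v g] assms(1,2) by (auto simp: min_def)
  have l4: "carry R (K r (v - x)) (replicate b letter2) =
      (replicate y letter1 @ replicate (b - y) letter2, K r (v - x + y))"
    using carry_load[of "v - x" b] assms(1,3) by (auto simp: min_def)
  have l5: "carry R (K r (v - x + y)) (replicate B letter1) =
      (replicate (v - x + y) letter2 @ replicate (B - (v - x + y)) letter1, K r 0)"
    using carry_unload[of "v - x + y" B] assms(1,3,4) by (auto simp: min_def)
  show ?thesis
    unfolding evolves_def two_def
    by (simp add: carry_append l1 l2 l3 l4 l5 replicate_add)
qed

text \<open>For solitons consisting of twos only, the state depends on the tail length \<open>C\<close> and on \<open>d\<close>:
  the solitons are apart for \<open>d \<le> 0\<close>, exchange letters for \<open>0 \<le> d \<le> l1 - l2\<close>, and have passed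
  each other afterwards. A time step lowers \<open>C\<close> by \<open>l2\<close> and raises \<open>d\<close> by \<open>min r l1 - l2\<close>.\<close>

lemma evolves_two_iter:
  fixes l1 l2 :: nat and d :: int
  assumes l: "1 \<le> l2" "l2 < l1" "l2 < r" and ab: "int a = int l1 - min (max d 0) (int l1 - int l2)"
    "int b = int l2 + min (max d 0) (int l1 - int l2)"
    "int g = int l2 + max (- d) 0 + max (d - (int l1 - int l2)) 0"
    and C: "int B = C - max d 0"
    and ab': "int a' = int l1 - min (max (d + int t * int (min r l1 - l2)) 0) (int l1 - int l2)"
    "int b' = int l2 + min (max (d + int t * int (min r l1 - l2)) 0) (int l1 - int l2)"
    "int g' = int l2 + max (- (d + int t * int (min r l1 - l2))) 0 + max ((d + int t * int (min r l1 - l2)) - (int l1 - int l2)) 0"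
    and C': "int B' = C - int t * int l2 - max (d + int t * int (min r l1 - l2)) 0"
    and A': "A' + a' + g' + b' + B' = A + a + g + b + B"
  shows "(evolves R r ^^ t) (two A a g b B) (two A' a' g' b' B')"
  using ab C C' ab' A'
proof (induction t arbitrary: A a g b B d C)
  case 0
  have "a' = a" "b' = b" "g' = g" "B' = B"
    using 0(1,6) 0(2,7) 0(3,8) 0(4,5) by simp_all
  moreover from this have "A' = A" using 0(9) by simp
  ultimately show ?case by simp
next
  case (Suc t)
  define \<delta> where "\<delta> = int (min r l1) - int l2"
  have \<delta>: "\<delta> > 0" "int (min r l1 - l2) = \<delta>" using l by (auto simp: \<delta>_def min_def)
  define v where "v = min r a"
  define x where "x = min v g"
  define y where "y = min (r - (v - x)) b"
  define d1 where "d1 = d + \<delta>"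
  note defs = v_def x_def y_def
  have S: "d + int (Suc t) * int (min r l1 - l2) = d1 + int t * int (min r l1 - l2)"
    unfolding \<delta>(2) d1_def by (simp add: algebra_simps)
  have tp: "0 \<le> int t * int (min r l1 - l2)" "0 \<le> int t * int l2" by simp_all
  have key: "int (v - x + y) = int l2 + max d1 0 - max d 0 \<and>
    int (a - v + x) = int l1 - min (max d1 0) (int l1 - int l2) \<and>
    int (g - x + y) = int l2 + max (- d1) 0 + max (d1 - (int l1 - int l2)) 0 \<and>
    int (b - y + (v - x + y)) = int l2 + min (max d1 0) (int l1 - int l2)"
  proof -
    have le: "v \<le> a" "x \<le> v" "x \<le> g" "y \<le> b" "v \<le> r" unfolding defs by auto
    define V X Y where "V = int v" "X = int x" "Y = int y"
    have V: "V = min (int r) (int a)" "X = min V (int g)" "Y = min (int r - (V - X)) (int b)"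
      unfolding V_X_Y_def using le(2,5)
      by (simp add: v_def, simp add: x_def, simp add: y_def of_nat_min of_nat_diff)
    have I: "int (v - x + y) = V - X + Y" "int (a - v + x) = int a - V + X" "int (g - x + y) = int g - X + Y"
      "int (b - y + (v - x + y)) = int b + V - X"
      unfolding V_X_Y_def using le by (simp_all add: of_nat_diff)
    have "V - X + Y = int l2 + max d1 0 - max d 0 \<and> int a - V + X = int l1 - min (max d1 0) (int l1 - int l2) \<and>
      int g - X + Y = int l2 + max (- d1) 0 + max (d1 - (int l1 - int l2)) 0 \<and>
      int b + V - X = int l2 + min (max d1 0) (int l1 - int l2)"
    proof -
      have L: "1 \<le> int l2" "int l2 < int l1" "int l2 < int r" using l by linarith+
      define m where "m = min (int r) (int l1)"
      have m: "int l2 < m" "m \<le> int r" "m \<le> int l1" "m = int r \<or> m = int l1"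
        using L unfolding m_def by (simp_all add: min_def)
      have d1: "d1 = d + m - int l2" unfolding d1_def \<delta>_def m_def by simp
      define D where "D = int l1 - int l2"
      note ab = Suc.prems(1-3)[folded D_def]
      have D: "0 < D" "int l1 = D + int l2" using L unfolding D_def by simp_all
      \<comment> \<open>Apart before and after, or exchange beginning in this step, or still going
        on because the first block fills the carrier, or completed because the whole first block
        fits into it, or already past each other.\<close>
      consider "d \<le> 0" "d1 \<le> 0" | "d \<le> 0" "0 < d1" | "0 < d" "d \<le> D" "int r < int l1 - d"
        | "0 < d" "d \<le> D" "int l1 - d \<le> int r" | "D < d" by linarith
      then show ?thesis
      proof cases
        case 1
        have mx: "max d 0 = 0" "max d1 0 = 0" "max (- d1) 0 = - d1" "max (d1 - D) 0 = 0" "max (- d) 0 = - d"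
          "max (d - D) 0 = 0" "min 0 D = 0"
          using 1 D(1) by simp_all
        have "V = m" using V(1) unfolding ab mx m_def by simp
        moreover have "X = m" unfolding V(2) ab mx \<open>V = m\<close> using 1 d1 by simp
        moreover have "Y = int l2" unfolding V(3) ab mx \<open>V = m\<close> \<open>X = m\<close> using L by simp
        ultimately show ?thesis unfolding D_def[symmetric] ab mx using d1 by simp
      next
        case 2
        have "d1 \<le> D" using 2 d1 m(3) unfolding D_def by linarith
        then have mx: "max d 0 = 0" "max d1 0 = d1" "max (- d1) 0 = 0" "max (d1 - D) 0 = 0" "max (- d) 0 = - d"
          "max (d - D) 0 = 0" "min 0 D = 0" "min d1 D = d1"
          using 2 D(1) by simp_all
        have "V = m" using V(1) unfolding ab mx m_def by simp
        moreover have "X = int l2 - d" unfolding V(2) ab mx \<open>V = m\<close> using 2 d1 by simp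
        moreover have "Y = int l2" unfolding V(3) ab mx \<open>V = m\<close> \<open>X = int l2 - d\<close> using m 2 by simp
        ultimately show ?thesis unfolding D_def[symmetric] ab mx using d1 by simp
      next
        case 3
        then have "m = int r" using m by linarith
        then have "0 < d1" "d1 \<le> D" using 3 d1 L unfolding D_def by linarith+
        then have mx: "max d 0 = d" "max d1 0 = d1" "max (- d1) 0 = 0" "max (d1 - D) 0 = 0" "max (- d) 0 = 0"
          "max (d - D) 0 = 0" "min d D = d" "min d1 D = d1"
          using 3 D(1) by simp_all
        have "V = int r" using V(1) 3 unfolding ab mx by simp
        moreover have "X = int l2" unfolding V(2) ab mx \<open>V = int r\<close> using L by simp
        moreover have "Y = int l2" unfolding V(3) ab mx \<open>V = int r\<close> \<open>X = int l2\<close> using 3 by simp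
        ultimately show ?thesis unfolding D_def[symmetric] ab mx using d1 \<open>m = int r\<close> by simp
      next
        case 4
        then have "D \<le> d1" using m d1 unfolding D_def by linarith
        then have mx: "max d 0 = d" "max d1 0 = d1" "max (- d1) 0 = 0" "max (d1 - D) 0 = d1 - D" "max (- d) 0 = 0"
          "max (d - D) 0 = 0" "min d D = d" "min d1 D = D"
          using 4 D(1) by simp_all
        have v: "V = int l1 - d" using V(1) 4 unfolding ab mx by simp
        moreover have x: "X = int l2" unfolding V(2) ab mx v using 4 unfolding D_def by simp
        moreover have "Y = m - int l1 + d + int l2"
          unfolding V(3) ab mx v x m_def by (simp add: min_def)
        ultimately show ?thesis unfolding D_def[symmetric] ab mx using d1 D(2) by simp
      next
        case 5
        then have "D \<le> d1" "0 < d" using m D(1) d1 by linarith+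
        then have mx: "max d 0 = d" "max d1 0 = d1" "max (- d1) 0 = 0" "max (d1 - D) 0 = d1 - D" "max (- d) 0 = 0"
          "max (d - D) 0 = d - D" "min d D = D" "min d1 D = D"
          using 5 D(1) by simp_all
        have v: "V = int l2" unfolding V(1) ab mx D(2) using L by simp
        moreover have x: "X = int l2" unfolding V(2) ab mx v using 5 by simp
        moreover have "Y = m"
          unfolding V(3) ab mx v x m_def D(2) by (simp add: add.commute)
        ultimately show ?thesis unfolding D_def[symmetric] ab mx using d1 D(2) by simp
      qed
    qed
    then show ?thesis unfolding I .
  qed
  have B: "int B = C - max d 0" by fact
  have le: "v - x + y \<le> B"
  proof -
    have "max d1 0 \<le> max (d1 + int t * int (min r l1 - l2)) 0"
      by (rule max.mono) (use tp(1) in simp_all)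
    moreover have "int (Suc t) * int l2 = int l2 + int t * int l2" by (simp add: algebra_simps)
    ultimately have "int l2 + max d1 0 \<le> C"
      using Suc.prems(5) tp(2) unfolding S by linarith
    then have "int (v - x + y) \<le> int B" using conjunct1[OF key] B by linarith
    then show ?thesis by simp
  qed
  have "(evolves R r ^^ t) (two (A + v) (a - v + x) (g - x + y) (b - y + (v - x + y)) (B - (v - x + y)))
      (two A' a' g' b' B')"
  proof (rule Suc.IH[of _ d1 _ _ _ "C - int l2"])
    show "int (B - (v - x + y)) = C - int l2 - max d1 0"
      using conjunct1[OF key] B of_nat_diff[OF le, where ?'a = int] by simp
    show "int B' = C - int l2 - int t * int l2 - max (d1 + int t * int (min r l1 - l2)) 0"
      using Suc.prems(5) unfolding S by (simp add: algebra_simps)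
    have "v \<le> a" "x \<le> g" "y \<le> b" "x \<le> v" unfolding defs by auto
    then show "A' + a' + g' + b' + B' =
        A + v + (a - v + x) + (g - x + y) + (b - y + (v - x + y)) + (B - (v - x + y))"
      using Suc.prems(9) le by linarith
    show "int (a - v + x) = int l1 - min (max d1 0) (int l1 - int l2)"
      "int (b - y + (v - x + y)) = int l2 + min (max d1 0) (int l1 - int l2)"
      "int (g - x + y) = int l2 + max (- d1) 0 + max (d1 - (int l1 - int l2)) 0"
      using key by blast+
  qed (rule Suc.prems(6-8)[unfolded S])+
  with evolves_two[OF v_def x_def y_def le] show ?case by (rule relpowp_Suc_I2)
qed

end

section \<open>Scattering\<close>

definition state :: "nat \<Rightarrow> nat \<times> nat \<Rightarrow> nat \<Rightarrow> nat \<times> nat \<Rightarrow> nat \<Rightarrow> elt list" where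
  "state n0 b1 n1 b2 n2 = replicate n0 letter1 @ block b1 @ replicate n1 letter1 @ block b2 @ replicate n2 letter1"

definition wstate :: "nat list \<Rightarrow> nat \<times> nat \<Rightarrow> nat \<Rightarrow> nat \<times> nat \<Rightarrow> nat list \<Rightarrow> letter list" where
  "wstate ls b1 n1 b2 ms = map X1 ls @ R3 (snd b1) @ R2 (fst b1) @ R1 n1 @ R3 (snd b2) @ R2 (fst b2) @ map X1 ms"

lemma word_state:
  "replicate t (r, u r) @ word (state n0 b1 n1 b2 n2) =
    wstate (replicate t r @ replicate n0 (Suc 0)) b1 n1 b2 (replicate n2 (Suc 0))"
  "word (state n0 b1 n1 b2 n2) @ replicate t (r, u r) =
    wstate (replicate n0 (Suc 0)) b1 n1 b2 (replicate n2 (Suc 0) @ replicate t r)"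
  by (simp_all add: state_def wstate_def block_def X1_def X2_def X3_def u_def)

lemma okw_wstate: "okw (wstate ls b1 n1 b2 ms)"
  by (auto simp: wstate_def okw_def)

lemma length_state: "length (state n0 b1 n1 b2 n2) = n0 + fst b1 + snd b1 + n1 + fst b2 + snd b2 + n2"
  by (simp add: state_def block_def)

text \<open>For index 2 a block has eps = number of threes and phi = number of twos, as its label
  has for index 1 of the A_1 crystal, and ones contribute nothing. f_2 turns the leftmost two of a
  block into its last three, which keeps the shape.\<close>

lemma fw2_wstate:
  assumes "f_op (A1 l \<otimes> A1 l') (Suc 0) (b1, b2) = Some (c1, c2)"
  shows "fw 2 (wstate ls b1 n1 b2 ms) = Some (wstate ls c1 n1 c2 ms)"
proof -
  obtain x1 x2 y1 y2 where b: "b1 = (x1, x2)" "b2 = (y1, y2)" by (metis surj_pair)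
  have V: "epsw 2 (map X1 ks) = 0" "phiw 2 (map X1 ks) = 0" for ks
    by (rule epsw_free; auto) (rule phiw_free; auto)
  have R0: "epsw 2 (R2 k) = 0" "phiw 2 (R3 k) = 0" for k
    by (rule epsw_free; auto) (rule phiw_free; auto)
  have R: "epsw 2 (R1 k) = 0" "phiw 2 (R1 k) = 0" "epsw 2 (R2 k) = 0" "phiw 2 (R2 k) = k"
    "epsw 2 (R3 k) = k" "phiw 2 (R3 k) = 0" for k
    by (simp_all add: epsw_replicate phiw_replicate R0)
  have N: "fw 2 (map X1 ks) = None" "fw 2 (R1 k) = None" "fw 2 (R3 k) = None" for ks k
    using V R by (subst fw_None; auto simp: okw_def)+
  have "lf 2 (X2 (Suc 0)) = Some (X3 (Suc 0))"
    using lf_letter_iter(6) by (simp add: iter_Some_1)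
  then have S: "fw 2 (R2 (Suc k)) = Some (X3 (Suc 0) # R2 k)" for k
    using R by simp
  show ?thesis
  proof (cases "y2 < x1")
    case True
    then obtain k where k: "x1 = Suc k" by (cases x1) auto
    have "c1 = (k, Suc x2)" "c2 = (y1, y2)" using assms True unfolding b by (auto simp: A1_tensor k)
    then show ?thesis using True S[of k] unfolding b wstate_def fst_conv snd_conv
      by (simp only: k) (simp add: fw_append V R epsw_append phiw_append N replicate_app_Cons_same del: replicate_Suc, simp)
  next
    case False
    then obtain k where k: "y1 = Suc k" using assms unfolding b by (cases y1) (auto simp: A1_tensor)
    have "c1 = (x1, x2)" "c2 = (k, Suc y2)" using assms False unfolding b by (auto simp: A1_tensor k)
    then show ?thesis using False S[of k] unfolding b wstate_def fst_conv snd_conv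
      by (simp only: k) (simp add: fw_append V R epsw_append phiw_append N replicate_app_Cons_same del: replicate_Suc, simp)
  qed
qed

lemma E_rel_wstate:
  assumes "2 * y1 \<le> n1" "y2 + 3 \<le> n2"
  shows "E_rel (wstate (ls @ replicate (2 * a) (Suc 0)) (a, 0) (n1 + 3) (Suc y1, y2) (replicate (n2 - 3) (Suc 0) @ ms))
    (wstate (ls @ replicate (2 * a) (Suc 0)) (a, 0) n1 (y1, Suc y2) (replicate n2 (Suc 0) @ ms))"
  using E_rel_soliton[of y1 "n1 + 3" y2 "n2 - 3" ls a ms] assms by (simp add: wstate_def)

text \<open>f_1 lowers x1 only if x1 > y2 and raises y2 only if y2 >= x1, so the minimum
  stays.\<close>

lemma A1_H_f:
  assumes "f_op (A1 l \<otimes> A1 l') (Suc 0) b = Some c"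
  shows "A1_H c = A1_H b"
  using assms by (cases b; cases c) (auto simp: A1_tensor min_def split: if_splits)

context
  fixes r l1 l2 :: nat and R :: "elt \<times> elt \<Rightarrow> elt \<times> elt"
  assumes iso: "crystal_iso (D43 r \<otimes> D43 1) (D43 1 \<otimes> D43 r) R"
    and l: "1 \<le> l2" "l2 < l1" "l2 < r"
begin

definition scatters :: "nat \<Rightarrow> (nat \<times> nat) \<times> (nat \<times> nat) \<Rightarrow> bool" where
  "scatters c b \<longleftrightarrow> (\<forall>n0 n1 n2 n0' n1' n2' t. c \<le> n0 \<and> c \<le> n1 \<and> c \<le> n2 \<and> c \<le> n0' \<and> c \<le> n1' \<and> c \<le> n2' \<and>
     int n0' = int n0 + int l1 + int n1 - (2 * int l2 + 3 * A1_H b) + int t * int l2 \<and>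
     int n1' = int t * (int (min r l1) - int l2) + 2 * (2 * int l2 + 3 * A1_H b) - int n1 - int l1 - int l2 \<and>
     int n2' = int n1 + int l2 + int n2 - (2 * int l2 + 3 * A1_H b) - int t * int (min r l1) \<longrightarrow>
     (evolves R r ^^ t) (state n0 (fst b) n1 (snd b) n2) (state n0' (fst (A1_R b)) n1' (snd (A1_R b)) n2'))"

lemma scatters_mono: "scatters c b \<Longrightarrow> c \<le> c' \<Longrightarrow> scatters c' b"
  unfolding scatters_def by (meson order_trans)

text \<open>Here H = 0. Gaps of at least l2 at both times mean that d begins at l2 - n1 <= 0 and
  ends at l1 - l2 or later, so that the exchange lies in between.\<close>

lemma scatters_base: "scatters l2 ((l1, 0), (l2, 0))"
  unfolding scatters_def
proof (intro allI impI, elim conjE)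
  fix n0 n1 n2 n0' n1' n2' t
  assume n: "l2 \<le> n1" "l2 \<le> n1'"
    "int n0' = int n0 + int l1 + int n1 - (2 * int l2 + 3 * A1_H ((l1, 0), (l2, 0))) + int t * int l2"
    "int n1' = int t * (int (min r l1) - int l2) + 2 * (2 * int l2 + 3 * A1_H ((l1, 0), (l2, 0))) - int n1 - int l1 - int l2"
    "int n2' = int n1 + int l2 + int n2 - (2 * int l2 + 3 * A1_H ((l1, 0), (l2, 0))) - int t * int (min r l1)"
  define T where "T = int t * int (min r l1 - l2)"
  have lt: "l2 \<le> min r l1" using l by simp
  have T: "T = int t * (int (min r l1) - int l2)" "int t * int (min r l1) = T + int t * int l2"
    unfolding T_def of_nat_diff[OF lt] by (simp_all add: algebra_simps)
  have n': "int n1' = T + 3 * int l2 - int n1 - int l1" "int n2' = int n1 + int n2 - int l2 - T - int t * int l2"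
    "int n0' = int n0 + int l1 + int n1 - 2 * int l2 + int t * int l2"
    using n(3-5) unfolding T by simp_all
  have d: "int l2 - int n1 \<le> 0" using n by simp
  have d': "int l1 - int l2 \<le> int l2 - int n1 + T" "0 < int l2 - int n1 + T"
    using n(2) n'(1) l by linarith+
  have "(evolves R r ^^ t) (two n0 l1 n1 l2 n2) (two n0' l2 n1' l1 n2')"
  proof (rule evolves_two_iter[OF iso _ l, where d = "int l2 - int n1" and C = "int n2"], unfold T_def[symmetric])
    show "n0' + l2 + n1' + l1 + n2' = n0 + l1 + n1 + l2 + n2" using n' by linarith
  qed (use l d d' n' in simp_all)
  then show "(evolves R r ^^ t) (state n0 (fst ((l1, 0), (l2, 0))) n1 (snd ((l1, 0), (l2, 0))) n2)
     (state n0' (fst (A1_R ((l1, 0), (l2, 0)))) n1' (snd (A1_R ((l1, 0), (l2, 0)))) n2')"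
    by (simp add: state_def two_def block_def)
qed

text \<open>E_0 shortens the gap by 3 in the initial and in the final state and lowers H by 1; in
  the phase equations these changes cancel. The bound grows by 3 because the last runs of the states
  before E_0 are shorter by 3.\<close>

lemma scatters_E:
  assumes "scatters c ((l1, 0), (Suc y1, y2))" "Suc y1 + y2 = l2" "2 * l1 \<le> c"
  shows "scatters (c + 3) ((l1, 0), (y1, Suc y2))"
  unfolding scatters_def
proof (intro allI impI, elim conjE)
  fix n0 n1 n2 n0' n1' n2' t
  assume n: "c + 3 \<le> n0" "c + 3 \<le> n1" "c + 3 \<le> n2" "c + 3 \<le> n0'" "c + 3 \<le> n1'" "c + 3 \<le> n2'"
    "int n0' = int n0 + int l1 + int n1 - (2 * int l2 + 3 * A1_H ((l1, 0), (y1, Suc y2))) + int t * int l2"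
    "int n1' = int t * (int (min r l1) - int l2) + 2 * (2 * int l2 + 3 * A1_H ((l1, 0), (y1, Suc y2))) - int n1 - int l1 - int l2"
    "int n2' = int n1 + int l2 + int n2 - (2 * int l2 + 3 * A1_H ((l1, 0), (y1, Suc y2))) - int t * int (min r l1)"
  have y: "Suc y2 < l1" using assms(2) l by linarith
  obtain z1 where z1: "l1 - y2 = Suc z1" "l1 - Suc y2 = z1" using y by (metis Suc_diff_Suc Suc_lessD)
  have H: "A1_H ((l1, 0), (y1, Suc y2)) = - int y2 - 1" "A1_H ((l1, 0), (Suc y1, y2)) = - int y2"
    using y by simp_all
  have AR: "A1_R ((l1, 0), (y1, Suc y2)) = ((l2, 0), (z1, Suc y2))"
    "A1_R ((l1, 0), (Suc y1, y2)) = ((l2, 0), (Suc z1, y2))"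
    using y z1 assms(2) by (auto simp: Let_def min_def)
  define v where "v = int (min r l1)"
  define P where "P = int t * int l2"
  define Q where "Q = int t * v"
  define W where "W = int t * (v - int l2)"
  have e: "int n0' = int n0 + int l1 + int n1 - (2 * int l2 + 3 * (- int y2 - 1)) + P"
    "int n1' = W + 2 * (2 * int l2 + 3 * (- int y2 - 1)) - int n1 - int l1 - int l2"
    "int n2' = int n1 + int l2 + int n2 - (2 * int l2 + 3 * (- int y2 - 1)) - Q"
    using n(7-9) unfolding H v_def[symmetric] P_def[symmetric] Q_def[symmetric] W_def[symmetric] .
  have "c \<le> n0" "c \<le> n1 + 3" "c \<le> n2 - 3" "c \<le> n0'" "c \<le> n1' + 3" "c \<le> n2' - 3"
    using n(1-6) by simp_all
  moreover have "int n0' = int n0 + int l1 + int (n1 + 3) - (2 * int l2 + 3 * (- int y2)) + P"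
    "int (n1' + 3) = W + 2 * (2 * int l2 + 3 * (- int y2)) - int (n1 + 3) - int l1 - int l2"
    using e by simp_all
  moreover have "int (n2' - 3) = int (n1 + 3) + int l2 + int (n2 - 3) - (2 * int l2 + 3 * (- int y2)) - Q"
    using e n(3,6) by (simp add: of_nat_diff)
  ultimately have ev: "(evolves R r ^^ t) (state n0 (l1, 0) (n1 + 3) (Suc y1, y2) (n2 - 3))
     (state n0' (l2, 0) (n1' + 3) (Suc z1, y2) (n2' - 3))"
    using assms(1)[unfolded scatters_def AR H fst_conv snd_conv v_def[symmetric]]
    unfolding P_def Q_def W_def by blast
  have z: "z1 \<le> l1" using z1 by simp
  \<comment> \<open>The room of 2*a ones before the left soliton, with a = l1 before the collision
    and a = l2 after it.\<close>
  have sp: "replicate n0 (Suc 0) = replicate (n0 - 2 * l1) (Suc 0) @ replicate (2 * l1) (Suc 0)"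
    "replicate n0' (Suc 0) = replicate (n0' - 2 * l2) (Suc 0) @ replicate (2 * l2) (Suc 0)"
    using n(1,4) assms(3) l by (simp_all flip: replicate_add)
  have b1: "2 * y1 \<le> n1" "y2 + 3 \<le> n2" using n(2,3) assms(2,3) l by linarith+
  have b2: "2 * z1 \<le> n1'" "y2 + 3 \<le> n2'" using n(5,6) assms(2,3) l z by linarith+
  have "(evolves R r ^^ t) (state n0 (l1, 0) n1 (y1, Suc y2) n2) (state n0' (l2, 0) n1' (z1, Suc y2) n2')"
  proof (rule evolves_natural[OF iso natural_E_rel[OF iso] E_rel_fun ev])
    show "E_rel (replicate t (r, u r) @ word (state n0 (l1, 0) (n1 + 3) (Suc y1, y2) (n2 - 3)))
      (replicate t (r, u r) @ word (state n0 (l1, 0) n1 (y1, Suc y2) n2))"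
      unfolding word_state sp
      using E_rel_wstate[of y1 n1 y2 n2 "replicate t r @ replicate (n0 - 2 * l1) (Suc 0)" l1 "[]"] b1 by simp
    show "E_rel (word (state n0' (l2, 0) (n1' + 3) (Suc z1, y2) (n2' - 3)) @ replicate t (r, u r))
      (word (state n0' (l2, 0) n1' (z1, Suc y2) n2') @ replicate t (r, u r))"
      unfolding word_state sp
      using E_rel_wstate[of z1 n1' y2 n2' "replicate (n0' - 2 * l2) (Suc 0)" l2 "replicate t r"] b2 by simp
    show "okw (word (state n0 (l1, 0) (n1 + 3) (Suc y1, y2) (n2 - 3)))"
      using okw_wstate word_state(1)[of 0] by (metis append_Nil replicate_0)
    show "length (state n0 (l1, 0) n1 (y1, Suc y2) n2) = length (state n0 (l1, 0) (n1 + 3) (Suc y1, y2) (n2 - 3))"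
      using n(3) by (simp add: length_state)
    have "length (state n0' (l2, 0) n1' (z1, Suc y2) n2') = length (state n0' (l2, 0) (n1' + 3) (Suc z1, y2) (n2' - 3))"
      using n(6) by (simp add: length_state)
    also have "\<dots> = length (state n0 (l1, 0) (n1 + 3) (Suc y1, y2) (n2 - 3))"
      using evolves_imp_swaps[OF ev] by blast
    finally show "length (state n0' (l2, 0) n1' (z1, Suc y2) n2') = length (state n0 (l1, 0) (n1 + 3) (Suc y1, y2) (n2 - 3))" .
  qed auto
  then show "(evolves R r ^^ t) (state n0 (fst ((l1, 0), (y1, Suc y2))) n1 (snd ((l1, 0), (y1, Suc y2))) n2)
     (state n0' (fst (A1_R ((l1, 0), (y1, Suc y2)))) n1' (snd (A1_R ((l1, 0), (y1, Suc y2)))) n2')"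
    unfolding AR by simp
qed

lemma scatters_f:
  assumes "scatters c b" "f_op (A1 l1 \<otimes> A1 l2) (Suc 0) b = Some b'"
  shows "scatters c b'"
  unfolding scatters_def
proof (intro allI impI)
  fix n0 n1 n2 n0' n1' n2' t
  assume n: "c \<le> n0 \<and> c \<le> n1 \<and> c \<le> n2 \<and> c \<le> n0' \<and> c \<le> n1' \<and> c \<le> n2' \<and>
     int n0' = int n0 + int l1 + int n1 - (2 * int l2 + 3 * A1_H b') + int t * int l2 \<and>
     int n1' = int t * (int (min r l1) - int l2) + 2 * (2 * int l2 + 3 * A1_H b') - int n1 - int l1 - int l2 \<and>
     int n2' = int n1 + int l2 + int n2 - (2 * int l2 + 3 * A1_H b') - int t * int (min r l1)"
  have ev: "(evolves R r ^^ t) (state n0 (fst b) n1 (snd b) n2) (state n0' (fst (A1_R b)) n1' (snd (A1_R b)) n2')"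
    using assms(1) n unfolding scatters_def A1_H_f[OF assms(2)] by blast
  have f: "f_op (A1 l1 \<otimes> A1 l2) (Suc 0) (fst b, snd b) = Some (fst b', snd b')" using assms(2) by simp
  have f': "f_op (A1 l2 \<otimes> A1 l1) (Suc 0) (fst (A1_R b), snd (A1_R b)) = Some (fst (A1_R b'), snd (A1_R b'))"
    using A1_R_commute(4)[of l2 l1 b] assms(2) by simp
  have nat: "natural r R (\<lambda>w v. fw 2 w = Some v)" by (rule natural_fw[OF iso]) simp
  let ?p = "state n0 (fst b) n1 (snd b) n2" and ?q = "state n0' (fst (A1_R b)) n1' (snd (A1_R b)) n2'"
  have fp: "fw 2 (replicate t (r, u r) @ word ?p) = Some (replicate t (r, u r) @ word (state n0 (fst b') n1 (snd b') n2))"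
    for t unfolding word_state by (rule fw2_wstate[OF f])
  have fq: "fw 2 (word ?q @ replicate t (r, u r)) = Some (word (state n0' (fst (A1_R b')) n1' (snd (A1_R b')) n2') @ replicate t (r, u r))"
    unfolding word_state by (rule fw2_wstate[OF f'])
  have okp: "okw (word ?p)" "okw (word ?q @ replicate t (r, u r))"
    using okw_wstate word_state(1)[of 0] word_state(2) by (metis append_Nil replicate_0)+
  have lp: "length (state n0 (fst b') n1 (snd b') n2) = length ?p"
    using fw_Some[of 2 "word ?p"] fp[of 0] okp(1) by (metis append_Nil insertCI length_map replicate_0)
  have "length (word ?q @ replicate t (r, u r)) =
      length (word (state n0' (fst (A1_R b')) n1' (snd (A1_R b')) n2') @ replicate t (r, u r))"
    using fw_Some[OF _ okp(2) fq] by (metis insertCI length_map)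
  then have lq: "length (state n0' (fst (A1_R b')) n1' (snd (A1_R b')) n2') = length ?q" by simp
  moreover have "length ?q = length ?p" using evolves_imp_swaps[OF ev] by blast
  ultimately show "(evolves R r ^^ t) (state n0 (fst b') n1 (snd b') n2)
      (state n0' (fst (A1_R b')) n1' (snd (A1_R b')) n2')"
    by (intro evolves_natural[OF iso nat _ ev okp(1) fp fq lp]) simp_all
qed

lemma scatters_highest: "y1 + y2 = l2 \<Longrightarrow> scatters (2 * l1 + 3 * y2) ((l1, 0), (y1, y2))"
proof (induction y2 arbitrary: y1)
  case 0
  then show ?case using scatters_mono[OF scatters_base] l by simp
next
  case (Suc y2)
  then show ?case using scatters_E[of "2 * l1 + 3 * y2" y1 y2] by (simp add: algebra_simps)
qed

text \<open>e_1 of the A_1 crystal removes threes until it vanishes, which forces x2 = 0; f_2 then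
  leads back to the given label without changing H.\<close>

lemma scatters_all:
  assumes "b \<in> elements (A1 l1 \<otimes> A1 l2)"
  shows "scatters (2 * l1 + 3 * l2) b"
  using assms
proof (induction "snd (fst b) + snd (snd b)" arbitrary: b rule: less_induct)
  case less
  obtain x1 x2 y1 y2 where b: "b = ((x1, x2), (y1, y2))" by (metis surj_pair)
  have el: "x1 + x2 = l1" "y1 + y2 = l2" using less.prems by (auto simp: b A1_tensor)
  show ?case
  proof (cases "e_op (A1 l1 \<otimes> A1 l2) (Suc 0) b")
    case None
    then have "x2 = 0" by (auto simp: b A1_tensor split: if_splits)
    then show ?thesis
      using scatters_mono[OF scatters_highest[OF el(2)], of "2 * l1 + 3 * l2"] el by (simp add: b)
  next
    case (Some c)
    then have "f_op (A1 l1 \<otimes> A1 l2) (Suc 0) c = Some b" "c \<in> elements (A1 l1 \<otimes> A1 l2)"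
      "snd (fst c) + snd (snd c) < snd (fst b) + snd (snd b)"
      using el by (auto simp: b A1_tensor split: if_splits)
    then show ?thesis using less.hyps scatters_f by blast
  qed
qed

end

section \<open>Labels, phases and the asymptotic statement\<close>

lemma soliton_label_two_iff:
  "soliton_label s r t [l1, l2] [(c1, b1), (c2, b2)] p \<longleftrightarrow>
    (\<exists>n0 n1 n2. s \<le> n0 \<and> s \<le> n1 \<and> s \<le> n2 \<and> b1 \<in> elements (A1 l1) \<and> b2 \<in> elements (A1 l2) \<and>
      p = state n0 b1 n1 b2 n2 \<and> c1 = int (min r l1 * t + (n1 + l2 + n2)) \<and> c2 = int (min r l2 * t + n2))"
  (is "?L \<longleftrightarrow> ?R")
proof
  assume ?L
  then obtain n0 p1 where 1: "s \<le> n0" "b1 \<in> elements (A1 l1)" "soliton_label s r t [l2] [(c2, b2)] p1"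
    "p = replicate n0 letter1 @ block b1 @ p1" "c1 = int (min r l1 * t + length p1)"
    by (cases rule: soliton_label.cases) auto
  from 1(3) obtain n1 p2 where 2: "s \<le> n1" "b2 \<in> elements (A1 l2)" "soliton_label s r t [] [] p2"
    "p1 = replicate n1 letter1 @ block b2 @ p2" "c2 = int (min r l2 * t + length p2)"
    by (cases rule: soliton_label.cases) auto
  from 2(3) obtain n2 where "s \<le> n2" "p2 = replicate n2 letter1"
    by (cases rule: soliton_label.cases) auto
  then show ?R using 1 2
    by (intro exI[of _ n0] exI[of _ n1] exI[of _ n2]) (auto simp: state_def block_def A1_simps)
next
  assume ?R
  then obtain n0 n1 n2 where n: "s \<le> n0" "s \<le> n1" "s \<le> n2" "b1 \<in> elements (A1 l1)" "b2 \<in> elements (A1 l2)"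
      "p = state n0 b1 n1 b2 n2" "c1 = int (min r l1 * t + (n1 + l2 + n2))" "c2 = int (min r l2 * t + n2)"
    by blast
  let ?p2 = "replicate n2 letter1" let ?p1 = "replicate n1 letter1 @ block b2 @ ?p2"
  have "length ?p1 = n1 + l2 + n2" using n(5) by (auto simp: block_def A1_simps)
  then show ?L
    using add_soliton[OF n(1,4) add_soliton[OF n(2,5) no_soliton[OF n(3)]], of r t] n(6-8)
    by (simp add: state_def add.assoc)
qed

text \<open>The last letter of the second block differs from \<open>u 1\<close>, so it lies among
  the first m factors. Everything except the last run is thus bounded independently of L, which
  allows the time bound to be fixed before L.\<close>

lemma state_in_paths:
  assumes "state n0 b1 n1 b2 n2 \<in> paths L m" "0 < fst b2 + snd b2"
  shows "n0 + fst b1 + snd b1 + n1 + fst b2 + snd b2 \<le> m"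
    "L = n0 + fst b1 + snd b1 + n1 + fst b2 + snd b2 + n2"
proof -
  let ?k = "n0 + fst b1 + snd b1 + n1" and ?p = "state n0 b1 n1 b2 n2"
  have len: "length (block b) = fst b + snd b" for b by (simp add: block_def)
  show L: "L = n0 + fst b1 + snd b1 + n1 + fst b2 + snd b2 + n2"
    using assms(1) by (simp add: paths_def length_state)
  let ?j = "fst b2 + snd b2 - 1"
  have split: "?p = (replicate n0 letter1 @ block b1 @ replicate n1 letter1) @ block b2 @ replicate n2 letter1"
    by (simp add: state_def)
  have "?p ! (?k + ?j) = (block b2 @ replicate n2 letter1) ! ?j"
    unfolding split by (subst nth_append) (simp add: len)
  also have "\<dots> = block b2 ! ?j" using assms(2) by (simp add: nth_append len)
  finally have nth: "?p ! (?k + ?j) = block b2 ! ?j" .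
  have "?j < length (block b2)" using assms(2) by (simp add: len)
  then have "?p ! (?k + ?j) \<in> set (block b2)" unfolding nth by (rule nth_mem)
  then have "?p ! (?k + ?j) \<noteq> u 1" by (auto simp: block_def u_def)
  moreover have "?p ! j = u 1" if "m \<le> j" "j < L" for j
    using assms(1) that unfolding paths_def by blast
  moreover have "?k + ?j < L" using assms(2) L by linarith
  ultimately have "?k + ?j < m" using not_le by blast
  then show "n0 + fst b1 + snd b1 + n1 + fst b2 + snd b2 \<le> m" using assms(2) by linarith
qed

theorem theorem4p9:
  fixes l\<^sub>1 l\<^sub>2 r :: nat and b\<^sub>1 b\<^sub>2 :: "nat \<times> nat"
    and R :: "elt \<times> elt \<Rightarrow> elt \<times> elt"
  assumes "l\<^sub>1 > l\<^sub>2" "l\<^sub>2 \<ge> 1" "r > l\<^sub>2"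
    and "b\<^sub>1 \<in> elements (A1 l\<^sub>1)" "b\<^sub>2 \<in> elements (A1 l\<^sub>2)"
    and "crystal_iso (D43 r \<otimes> D43 1) (D43 1 \<otimes> D43 r) R"
  shows "\<exists>s\<^sub>0. \<forall>m s. \<exists>t\<^sub>0. \<forall>t\<ge>t\<^sub>0. \<exists>L\<^sub>0. \<forall>L\<ge>L\<^sub>0. \<forall>p\<in>paths L m. \<forall>\<gamma>\<^sub>1 \<gamma>\<^sub>2.
    soliton_label s\<^sub>0 r 0 [l\<^sub>1, l\<^sub>2] [(\<gamma>\<^sub>1, b\<^sub>1), (\<gamma>\<^sub>2, b\<^sub>2)] p \<longrightarrow>
    (\<exists>p' \<gamma>\<^sub>1' \<gamma>\<^sub>2' b\<^sub>1' b\<^sub>2'.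
       (evolves R r ^^ t) p p' \<and>
       soliton_label s r t [l\<^sub>2, l\<^sub>1] [(\<gamma>\<^sub>2', b\<^sub>2'), (\<gamma>\<^sub>1', b\<^sub>1')] p' \<and>
       (b\<^sub>2', b\<^sub>1') = A1_R (b\<^sub>1, b\<^sub>2) \<and>
       \<gamma>\<^sub>2' - \<gamma>\<^sub>2 = 2 * int l\<^sub>2 + 3 * A1_H (b\<^sub>1, b\<^sub>2) \<and>
       \<gamma>\<^sub>1 - \<gamma>\<^sub>1' = 2 * int l\<^sub>2 + 3 * A1_H (b\<^sub>1, b\<^sub>2))"
proof -
  \<comment> \<open>2*l1 is the room for the conjugation, and 3*l2 covers at most l2 uses of
    E_0.\<close>
  define c where "c = 2 * l\<^sub>1 + 3 * l\<^sub>2"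
  define D where "D = 2 * int l\<^sub>2 + 3 * A1_H (b\<^sub>1, b\<^sub>2)"
  define v where "v = min r l\<^sub>1"
  obtain b1' b2' where b': "A1_R (b\<^sub>1, b\<^sub>2) = (b2', b1')" by (metis surj_pair)
  have el: "(b\<^sub>1, b\<^sub>2) \<in> elements (A1 l\<^sub>1 \<otimes> A1 l\<^sub>2)" using assms(4,5) by (simp add: tensor_def)
  have el': "b2' \<in> elements (A1 l\<^sub>2)" "b1' \<in> elements (A1 l\<^sub>1)"
    using A1_R_inverse(1)[OF el] unfolding b' by (simp_all add: tensor_def)
  have sum: "fst b\<^sub>1 + snd b\<^sub>1 = l\<^sub>1" "fst b\<^sub>2 + snd b\<^sub>2 = l\<^sub>2"
    using assms(4,5) by (auto simp: A1_simps)
  have D: "- int l\<^sub>2 \<le> D" "D \<le> 2 * int l\<^sub>2"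
    unfolding D_def using sum by (cases b\<^sub>1; cases b\<^sub>2; simp)+
  have v: "l\<^sub>2 < v" unfolding v_def using assms(1,3) by simp
  have sc: "scatters r l\<^sub>1 l\<^sub>2 R c (b\<^sub>1, b\<^sub>2)"
    unfolding c_def by (rule scatters_all[OF assms(6,2,1,3) el])
  show ?thesis
  proof (rule exI[of _ c], intro allI)
    fix m s
    \<comment> \<open>The term W in the final gap gains at least one site per step. It has to make
      up for n1 + l1 + l2 <= m and for 2*D >= -2*l2, and still leave s and c.\<close>
    define t0 where "t0 = m + s + c + 4 * l\<^sub>2 + 2 * l\<^sub>1"
    show "\<exists>t\<^sub>0. \<forall>t\<ge>t\<^sub>0. \<exists>L\<^sub>0. \<forall>L\<ge>L\<^sub>0. \<forall>p\<in>paths L m. \<forall>\<gamma>\<^sub>1 \<gamma>\<^sub>2.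
      soliton_label c r 0 [l\<^sub>1, l\<^sub>2] [(\<gamma>\<^sub>1, b\<^sub>1), (\<gamma>\<^sub>2, b\<^sub>2)] p \<longrightarrow>
      (\<exists>p' \<gamma>\<^sub>1' \<gamma>\<^sub>2' b\<^sub>1' b\<^sub>2'.
         (evolves R r ^^ t) p p' \<and>
         soliton_label s r t [l\<^sub>2, l\<^sub>1] [(\<gamma>\<^sub>2', b\<^sub>2'), (\<gamma>\<^sub>1', b\<^sub>1')] p' \<and>
         (b\<^sub>2', b\<^sub>1') = A1_R (b\<^sub>1, b\<^sub>2) \<and>
         \<gamma>\<^sub>2' - \<gamma>\<^sub>2 = 2 * int l\<^sub>2 + 3 * A1_H (b\<^sub>1, b\<^sub>2) \<and>
         \<gamma>\<^sub>1 - \<gamma>\<^sub>1' = 2 * int l\<^sub>2 + 3 * A1_H (b\<^sub>1, b\<^sub>2))"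
    proof (rule exI[of _ t0], intro allI impI)
      fix t assume t: "t0 \<le> t"
      \<comment> \<open>Room for t*v sites of travel of the larger soliton and for its displacement
        D <= 2*l2, beyond the m factors that contain the initial blocks.\<close>
      define L0 where "L0 = m + t * v + s + c + 2 * l\<^sub>2"
      show "\<exists>L\<^sub>0. \<forall>L\<ge>L\<^sub>0. \<forall>p\<in>paths L m. \<forall>\<gamma>\<^sub>1 \<gamma>\<^sub>2.
        soliton_label c r 0 [l\<^sub>1, l\<^sub>2] [(\<gamma>\<^sub>1, b\<^sub>1), (\<gamma>\<^sub>2, b\<^sub>2)] p \<longrightarrow>
        (\<exists>p' \<gamma>\<^sub>1' \<gamma>\<^sub>2' b\<^sub>1' b\<^sub>2'.
           (evolves R r ^^ t) p p' \<and>
           soliton_label s r t [l\<^sub>2, l\<^sub>1] [(\<gamma>\<^sub>2', b\<^sub>2'), (\<gamma>\<^sub>1', b\<^sub>1')] p' \<and>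
           (b\<^sub>2', b\<^sub>1') = A1_R (b\<^sub>1, b\<^sub>2) \<and>
           \<gamma>\<^sub>2' - \<gamma>\<^sub>2 = 2 * int l\<^sub>2 + 3 * A1_H (b\<^sub>1, b\<^sub>2) \<and>
           \<gamma>\<^sub>1 - \<gamma>\<^sub>1' = 2 * int l\<^sub>2 + 3 * A1_H (b\<^sub>1, b\<^sub>2))"
      proof (rule exI[of _ L0], intro allI impI ballI)
        fix L p g1 g2
        assume L: "L0 \<le> L" and p: "p \<in> paths L m"
          and lab: "soliton_label c r 0 [l\<^sub>1, l\<^sub>2] [(g1, b\<^sub>1), (g2, b\<^sub>2)] p"
        obtain n0 n1 n2 where n: "c \<le> n0" "c \<le> n1" "c \<le> n2" "p = state n0 b\<^sub>1 n1 b\<^sub>2 n2"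
          "g1 = int (n1 + l\<^sub>2 + n2)" "g2 = int n2"
          using lab unfolding soliton_label_two_iff by auto
        have m: "n0 + l\<^sub>1 + n1 + l\<^sub>2 \<le> m" "L = n0 + l\<^sub>1 + n1 + l\<^sub>2 + n2"
          using state_in_paths[OF p[unfolded n(4)]] sum assms(2) by simp_all
        define P where "P = int t * int l\<^sub>2"
        define Q where "Q = int t * int v"
        define W where "W = int t * (int v - int l\<^sub>2)"
        have PQ: "Q = P + W" unfolding P_def Q_def W_def by (simp add: algebra_simps)
        have P: "int t \<le> P" unfolding P_def using assms(2) by (simp add: mult_le_cancel_left1)
        have W: "int t \<le> W" unfolding W_def using v by (simp add: mult_le_cancel_left1)
        have t': "int m + int s + int c + 4 * int l\<^sub>2 + 2 * int l\<^sub>1 \<le> int t"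
          using t unfolding t0_def by linarith
        have L': "int m + Q + int s + int c + 2 * int l\<^sub>2 \<le> int L"
          using L unfolding L0_def Q_def by (metis of_nat_add of_nat_le_iff of_nat_mult of_nat_numeral)
        define n0' where "n0' = nat (int n0 + int l\<^sub>1 + int n1 - D + P)"
        define n1' where "n1' = nat (W + 2 * D - int n1 - int l\<^sub>1 - int l\<^sub>2)"
        define n2' where "n2' = nat (int n1 + int l\<^sub>2 + int n2 - D - Q)"
        have n0': "int n0' = int n0 + int l\<^sub>1 + int n1 - D + P" "c \<le> n0'" "s \<le> n0'"
          unfolding n0'_def using D P t' by linarith+
        have n1': "int n1' = W + 2 * D - int n1 - int l\<^sub>1 - int l\<^sub>2" "c \<le> n1'" "s \<le> n1'"
          unfolding n1'_def using D W t' m(1) by linarith+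
        have n2': "int n2' = int n1 + int l\<^sub>2 + int n2 - D - Q" "c \<le> n2'" "s \<le> n2'"
          unfolding n2'_def using D L' m by linarith+
        have "(evolves R r ^^ t) p (state n0' b2' n1' b1' n2')"
          using sc n(1-3) n0'(1,2) n1'(1,2) n2'(1,2)
          unfolding n(4) scatters_def[OF assms(6,2,1,3)] b' fst_conv snd_conv D_def[symmetric]
            v_def[symmetric] P_def Q_def W_def by blast
        moreover have "soliton_label s r t [l\<^sub>2, l\<^sub>1]
            [(int (min r l\<^sub>2 * t + (n1' + l\<^sub>1 + n2')), b2'), (int (min r l\<^sub>1 * t + n2'), b1')] (state n0' b2' n1' b1' n2')"
          unfolding soliton_label_two_iff using n0'(3) n1'(3) n2'(3) el' by blast
        moreover have "min r l\<^sub>2 = l\<^sub>2" using assms(3) by simp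
        moreover have "int (l\<^sub>2 * t + (n1' + l\<^sub>1 + n2')) - g2 = D"
        proof -
          have "int (l\<^sub>2 * t) = P" unfolding P_def by simp
          then show ?thesis using n1'(1) n2'(1) PQ n(6) by simp
        qed
        moreover have "g1 - int (min r l\<^sub>1 * t + n2') = D"
        proof -
          have "int (min r l\<^sub>1 * t) = Q" unfolding Q_def v_def by simp
          then show ?thesis using n2'(1) n(5) by simp
        qed
        ultimately show "\<exists>p' \<gamma>\<^sub>1' \<gamma>\<^sub>2' b\<^sub>1' b\<^sub>2'.
           (evolves R r ^^ t) p p' \<and>
           soliton_label s r t [l\<^sub>2, l\<^sub>1] [(\<gamma>\<^sub>2', b\<^sub>2'), (\<gamma>\<^sub>1', b\<^sub>1')] p' \<and>
           (b\<^sub>2', b\<^sub>1') = A1_R (b\<^sub>1, b\<^sub>2) \<and>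
           \<gamma>\<^sub>2' - g2 = 2 * int l\<^sub>2 + 3 * A1_H (b\<^sub>1, b\<^sub>2) \<and>
           g1 - \<gamma>\<^sub>1' = 2 * int l\<^sub>2 + 3 * A1_H (b\<^sub>1, b\<^sub>2)"
          unfolding b' D_def[symmetric] by metis
      qed
    qed
  qed
qed

end
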